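(* Let $P=\{p_1,\dots,p_n\}$ be a finite poset with a unique maximal element $p_n$ and let $d \geq 2$ be an integer. Then $$\beta_i(H_{P,d})=\beta_i(H_{P \setminus \{p_n\},d})+\beta_i(H_{P,d-1})+\beta_{i-1}(H_{P,d-1}) \quad\text{for each } i \geq 0.$$
   Context: Let $\mathbb{k}$ be a field. The poset $P=\{p_1,\dots,p_n\}$ is labelled so that $p_i<p_j$ implies $i<j$. Each subset of $P$ is regarded as a poset with the induced order (its elements keeping their labels). Let $Q\subseteq P$ be a subposet and $e\ge 1$ an integer. A multichain of length $e$ in $Q$ is a sequence $p_{j_1}\le p_{j_2}\le\cdots\le p_{j_e}$ of elements of $Q$ (repetitions allowed). The clutter $\mathcal{C}_{Q,e}$ has vertex set $\{x_{rj}: 1\le r\le e,\ p_j\in Q\}$ and edges $\{x_{1j_1},x_{2j_2},\dots,x_{ej_e}\}$, one for each multichain $p_{j_1}\le\cdots\le p_{j_e}$ of length $e$ in $Q$. A vertex cover is a set of vertices meeting every edge. $H_{Q,e}$ denotes the cover ideal of $\mathcal{C}_{Q,e}$ (the Alexander dual $I(\mathcal{C}_{Q,e})^*$ of its edge ideal): the ideal generated by the monomials $\prod_{x\in W}x$ with $W$ a vertex cover of $\mathcal{C}_{Q,e}$, in the polynomial ring over $\mathbb{k}$ in the vertices (or in any larger polynomial ring; this does not affect Betti numbers). For $Q=\emptyset$ this is the unit ideal, $H_{\emptyset,e}=(1)$, with $\beta_0=1$ and $\beta_i=0$ for $i\ne 0$. For a monomial ideal $I$ in a polynomial ring over $\mathbb{k}$,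 $\beta_i(I)=\dim_{\mathbb{k}}\mathrm{Tor}_i(I,\mathbb{k})$ is the $i$-th total Betti number of $I$ over that ring, with $\beta_i(I)=0$ for $i<0$. *)

theory Defs
  imports
    "HOL-Library.Poly_Mapping"
    "HOL-Algebra.Ideal"
    "Jordan_Normal_Form.Matrix_Kernel"
    "Jordan_Normal_Form.DL_Rank"
begin

section \<open>Polynomial rings in a set of variables\<close>

text \<open>
  A polynomial with coefficients in \<open>'k\<close> is a finitely supported map from exponent vectors
  to \<open>'k\<close>.  The type has all elements of \<open>'v\<close> as variables; the polynomial ring in a set \<open>V\<close>
  of variables is the subring \<open>polys V\<close>.
\<close>

type_synonym ('v, 'k) mpoly = "('v \<Rightarrow>\<^sub>0 nat) \<Rightarrow>\<^sub>0 'k"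

definition polys :: "'v set \<Rightarrow> ('v, 'k::zero) mpoly set" where
  "polys V = {f. \<forall>m \<in> Poly_Mapping.keys f. Poly_Mapping.keys m \<subseteq> V}"

abbreviation poly_ring :: "'v set \<Rightarrow> ('v, 'k::comm_ring_1) mpoly ring" where
  "poly_ring V \<equiv> class_ring\<lparr>carrier := polys V\<rparr>"

definition mvar :: "'v \<Rightarrow> ('v, 'k::comm_ring_1) mpoly" where
  "mvar v = Poly_Mapping.single (Poly_Mapping.single v 1) 1"

definition const_term :: "('v, 'k::zero) mpoly \<Rightarrow> 'k" where
  "const_term f = Poly_Mapping.lookup f 0"


section \<open>Betti numbers\<close>

definition free_module :: "'r set \<Rightarrow> nat \<Rightarrow> 'r vec set" where
  "free_module R m = {v \<in> carrier_vec m. set\<^sub>v v \<subseteq> R}"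

text \<open>
  A resolution of the ideal \<open>I\<close> of \<open>R\<close> by free modules of finite rank,
  \<open>\<cdots> \<rightarrow> R\<^bsup>b 1\<^esup> \<rightarrow> R\<^bsup>b 0\<^esup> \<rightarrow> I \<rightarrow> 0\<close>, given by its matrices:
  \<open>D 0\<close> is the augmentation \<open>R\<^bsup>b 0\<^esup> \<rightarrow> I \<subseteq> R\<close> (one row), and
  \<open>D (i + 1)\<close> is the differential \<open>R\<^bsup>b (i + 1)\<^esup> \<rightarrow> R\<^bsup>b i\<^esup>\<close>.
\<close>

definition free_resolution ::
  "'r::comm_ring_1 set \<Rightarrow> 'r set \<Rightarrow> (nat \<Rightarrow> nat) \<Rightarrow> (nat \<Rightarrow> 'r mat) \<Rightarrow> bool" where
  "free_resolution R I b D \<longleftrightarrow>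
     D 0 \<in> carrier_mat 1 (b 0) \<and>
     (\<forall>i. D (Suc i) \<in> carrier_mat (b i) (b (Suc i))) \<and>
     (\<forall>i. elements_mat (D i) \<subseteq> R) \<and>
     {(D 0 *\<^sub>v v) $ 0 | v. v \<in> free_module R (b 0)} = I \<and>
     (\<forall>i. {v \<in> free_module R (b i). D i *\<^sub>v v = 0\<^sub>v (dim_row (D i))} =
           {D (Suc i) *\<^sub>v w | w. w \<in> free_module R (b (Suc i))})"

text \<open>
  Tensoring over \<open>R = polys V\<close> with the residue field \<open>R / (V)\<close>, on which a polynomial acts through
  its constant term, turns \<open>R\<^bsup>b i\<^esup>\<close> into \<open>'k\<^bsup>b i\<^esup>\<close> and replaces the entries of the
  matrices by their constant terms.  The augmentation is not part of the tensored complex, so the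
  map leaving degree 0 is the map to the zero space.
\<close>

definition residue_diff ::
  "(nat \<Rightarrow> nat) \<Rightarrow> (nat \<Rightarrow> ('v, 'k::field) mpoly mat) \<Rightarrow> nat \<Rightarrow> 'k mat" where
  "residue_diff b D i = (if i = 0 then 0\<^sub>m 0 (b 0) else map_mat const_term (D i))"

definition residue_homology_dim ::
  "(nat \<Rightarrow> nat) \<Rightarrow> (nat \<Rightarrow> ('v, 'k::field) mpoly mat) \<Rightarrow> nat \<Rightarrow> nat" where
  "residue_homology_dim b D i =
     kernel_dim (residue_diff b D i) - vec_space.rank (b i) (residue_diff b D (Suc i))"

text \<open>
  The dimension of \<open>Tor\<^sub>i(I, 'k)\<close> over \<open>polys V\<close>, computed from a chosen free resolution.  Tor does
  not depend on that choice, and for finite \<open>V\<close> every ideal has a resolution by free modules of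
  finite rank.
\<close>

definition betti :: "'v set \<Rightarrow> ('v, 'k::field) mpoly set \<Rightarrow> int \<Rightarrow> nat" where
  "betti V I i =
     (if i < 0 then 0
      else let (b, D) = (SOME (b, D). free_resolution (polys V) I b D)
           in residue_homology_dim b D (nat i))"


section \<open>Multichain clutters and their cover ideals\<close>

text \<open>
  The elements of the poset are \<open>p 1, \<dots>, p n\<close>, and the vertex \<open>x\<^sub>r\<^sub>j\<close> is the pair \<open>(r, j)\<close>.
\<close>

definition clutter_vertices ::
  "(nat \<Rightarrow> 'a) \<Rightarrow> nat \<Rightarrow> 'a set \<Rightarrow> nat \<Rightarrow> (nat \<times> nat) set" where
  "clutter_vertices p n Q e = {(r, j). r \<in> {1..e} \<and> j \<in> {1..n} \<and> p j \<in> Q}"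

definition multichain ::
  "(nat \<Rightarrow> 'a::order) \<Rightarrow> nat \<Rightarrow> 'a set \<Rightarrow> nat \<Rightarrow> (nat \<Rightarrow> nat) \<Rightarrow> bool" where
  "multichain p n Q e j \<longleftrightarrow>
     (\<forall>r \<in> {1..e}. j r \<in> {1..n} \<and> p (j r) \<in> Q) \<and>
     (\<forall>r \<in> {1..<e}. p (j r) \<le> p (j (Suc r)))"

definition clutter_edges ::
  "(nat \<Rightarrow> 'a::order) \<Rightarrow> nat \<Rightarrow> 'a set \<Rightarrow> nat \<Rightarrow> (nat \<times> nat) set set" where
  "clutter_edges p n Q e = {(\<lambda>r. (r, j r)) ` {1..e} | j. multichain p n Q e j}"

definition vertex_cover :: "'v set \<Rightarrow> 'v set set \<Rightarrow> 'v set \<Rightarrow> bool" where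
  "vertex_cover V \<E> W \<longleftrightarrow> W \<subseteq> V \<and> (\<forall>E \<in> \<E>. W \<inter> E \<noteq> {})"

definition cover_ideal ::
  "(nat \<Rightarrow> 'a::order) \<Rightarrow> nat \<Rightarrow> 'a set \<Rightarrow> nat \<Rightarrow> (nat \<times> nat, 'k::field) mpoly set" where
  "cover_ideal p n Q e =
     genideal (poly_ring (clutter_vertices p n Q e))
       {\<Prod>v \<in> W. mvar v | W. vertex_cover (clutter_vertices p n Q e) (clutter_edges p n Q e) W}"

definition betti_cover_ideal ::
  "'k::field itself \<Rightarrow> (nat \<Rightarrow> 'a::order) \<Rightarrow> nat \<Rightarrow> 'a set \<Rightarrow> nat \<Rightarrow> int \<Rightarrow> nat" where
  "betti_cover_ideal _ p n Q e i =
     betti (clutter_vertices p n Q e) (cover_ideal p n Q e :: (nat \<times> nat, 'k) mpoly set) i"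

end

theory Submission
  imports Defs
begin

text \<open>
  Write \<open>K = H\<^bsub>P - {p\<^sub>n}, d\<^esub>\<close>, \<open>J = H\<^bsub>P, d - 1\<^esub>\<close> and \<open>x = x\<^sub>d\<^sub>n\<close>.  As \<open>p\<^sub>n\<close> is the greatest element, a set
  of vertices covers \<open>\<C>\<^bsub>P, d\<^esub>\<close> iff it covers \<open>\<C>\<^bsub>P, d - 1\<^esub>\<close>, or contains \<open>x\<close> and covers
  \<open>\<C>\<^bsub>P - {p\<^sub>n}, d\<^esub>\<close>.  Hence \<open>H\<^bsub>P, d\<^esub> = x K + J\<close> with \<open>x K \<inter> J = x J\<close>, and the mapping cone of
  \<open>x J \<rightarrow> x K \<oplus> J\<close> resolves \<open>H\<^bsub>P, d\<^esub>\<close>.  The component \<open>x J \<rightarrow> J\<close> lifts to multiplication by \<open>x\<close>.  The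
  resolution of \<open>K\<close> does not involve the variables \<open>x\<^sub>r\<^sub>n\<close>, whereas every element of \<open>J\<close> vanishes when
  these are set to \<open>0\<close> (constant multichains at \<open>p\<^sub>n\<close> have to be covered), so the inclusion \<open>J \<rightarrow> K\<close>
  has a lift that vanishes under this specialization.  Modulo the variables both components of the
  map are therefore zero, and the Betti numbers of the cone are the sums of those of its parts.
\<close>


section \<open>Dimensions of subspaces of coordinate spaces\<close>

text \<open>\<open>betti\<close> is computed from an unspecified resolution over
  \<open>polys V\<close>, and the three ideals live in rings with different \<open>V\<close>. Two
  facts make them comparable: the residue homology does not depend on the chosen resolution, and a
  monomial ideal with finitely many generators in \<open>V\<close> has one system of matrices that
  resolves it over \<open>polys V'\<close> for every \<open>V'\<close> containing \<open>V\<close>.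
  Hence everything can be compared in the ring in all variables, while the entries of a resolution
  still use only the vertices of its own clutter. The obstacle is that lifts are unique only up to
  homotopy and the resolutions are not minimal, so an arbitrary lift of \<open>J\<close> into
  \<open>K\<close> may have units among its entries. The coefficients are therefore restricted while
  the lift is built: the resolution of \<open>K\<close> stays exact on vectors with entries in the
  ideal of the variables set to zero, so the comparison theorem can be run inside that ideal. The
  other component needs no choice, as \<open>x J\<close> and \<open>J\<close> share their
  differentials and differ only in the augmentation, which does not enter Tor.\<close>

definition vsubspace :: "nat \<Rightarrow> 'k::field vec set \<Rightarrow> bool" where
  "vsubspace n U \<longleftrightarrow> U \<subseteq> carrier_vec n \<and> 0\<^sub>v n \<in> U \<and> (\<forall>u\<in>U. \<forall>v\<in>U. u + v \<in> U) \<and> (\<forall>c. \<forall>u\<in>U. c \<cdot>\<^sub>v u \<in> U)"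

definition vdim :: "nat \<Rightarrow> 'k::field vec set \<Rightarrow> nat" where
  "vdim n U = vectorspace.dim class_ring ((module_vec TYPE('k) n)\<lparr>carrier := U\<rparr>)"

definition im :: "'k::comm_ring_1 mat \<Rightarrow> 'k vec set" where
  "im A = (\<lambda>v. A *\<^sub>v v) ` carrier_vec (dim_col A)"

lemma vsubspace_subspace:
  assumes "vsubspace n (U :: 'k::field vec set)"
  shows "VectorSpace.subspace class_ring U (module_vec TYPE('k) n)"
proof -
  interpret vec_space "TYPE('k)" n .
  show ?thesis
    using assms unfolding vsubspace_def subspace_def
    by (intro conjI vec_vs submodule.intro vec_module) auto
qed

text \<open>An independent subset of \<open>U\<close> stays independent in the ambient space and so
  has at most \<open>n\<close> elements. Hence a maximal one exists, and it is a finite basis of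
  \<open>U\<close>.\<close>

lemma vsubspace_fin_dim:
  assumes "vsubspace n (U :: 'k::field vec set)"
  shows "vectorspace.fin_dim class_ring ((module_vec TYPE('k) n)\<lparr>carrier := U\<rparr>)"
proof -
  interpret vec_space "TYPE('k)" n .
  have sub: "VectorSpace.subspace class_ring U V" by (rule vsubspace_subspace[OF assms])
  interpret ker: vectorspace class_ring "vs U"
    by (rule subspace_is_vs[OF sub])
  have UC: "U \<subseteq> carrier_vec n" using assms by (simp add: vsubspace_def)
  have sm: "submodule class_ring U V" using sub by (simp add: subspace_def)
  have *: "finite A \<and> card A \<le> dim" if "A \<subseteq> U \<and> ker.lin_indpt A" for A
    using that span_li_not_depend(2)[OF _ sm, of A] UC
    by (intro conjI) (auto intro!: li_le_dim)
  have "\<exists>A. finite A \<and> maximal A (\<lambda>S. S\<subseteq>carrier (vs U) \<and> ker.lin_indpt S)"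
  proof (rule maximal_exists)
    show "{} \<subseteq> carrier (vs U) \<and> ker.lin_indpt {}" by (auto simp: ker.lin_dep_def)
    show "finite A \<and> card A \<le> dim" if "A \<subseteq> carrier (vs U) \<and> ker.lin_indpt A" for A
      using that by (intro *) simp
  qed
  then obtain A where A: "finite A" "maximal A (\<lambda>S. S\<subseteq>carrier (vs U) \<and> ker.lin_indpt S)"
    by blast
  then have "ker.basis A" by (intro ker.max_li_is_basis) auto
  then show ?thesis using A unfolding ker.fin_dim_def ker.basis_def by blast
qed

text \<open>Linearity is asked on \<open>U\<close> alone and \<open>T\<close> is a function, not a
  matrix. This covers the projections and embeddings of concatenated vectors used for direct sums
  below.\<close>

lemma vdim_rank_nullity:
  assumes U: "vsubspace n (U :: 'k::field vec set)"
    and T: "\<And>u. u \<in> U \<Longrightarrow> T u \<in> carrier_vec m"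
    and add: "\<And>u v. u \<in> U \<Longrightarrow> v \<in> U \<Longrightarrow> T (u + v) = T u + T v"
    and scale: "\<And>c u. u \<in> U \<Longrightarrow> T (c \<cdot>\<^sub>v u) = c \<cdot>\<^sub>v T u"
  shows "vdim m (T ` U) + vdim n {v \<in> U. T v = 0\<^sub>v m} = vdim n U"
proof -
  interpret N: vec_space "TYPE('k)" n .
  interpret M: vec_space "TYPE('k)" m .
  have sub: "VectorSpace.subspace class_ring U N.V" by (rule vsubspace_subspace[OF U])
  interpret T: linear_map class_ring "N.vs U" M.V T
  proof (intro linear_map.intro N.subspace_is_vs sub vec_vs mod_hom.intro mod_hom_axioms.intro)
    show "module class_ring (N.vs U)"
      using N.submodule_is_module sub by (simp add: subspace_def)
    show "module class_ring M.V" by (rule vec_module)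
    show "T \<in> LinearCombinations.module_hom class_ring (N.vs U) M.V"
      using T add scale by (auto simp: LinearCombinations.module_hom_def)
  qed
  show ?thesis
    using T.rank_nullity[OF vsubspace_fin_dim[OF U]]
    by (simp add: vdim_def T.im_def T.ker_def)
qed

lemma vdim_mono:
  assumes U: "vsubspace n U" and W: "vsubspace n (W :: 'k::field vec set)" and "U \<subseteq> W"
  shows "vdim n U \<le> vdim n W"
proof -
  interpret N: vec_space "TYPE('k)" n .
  interpret W: vectorspace class_ring "N.vs W"
    by (rule N.subspace_is_vs[OF vsubspace_subspace[OF W]])
  have "VectorSpace.subspace class_ring U (N.vs W)"
    by (rule N.nested_subspaces) (use assms vsubspace_subspace in auto)
  from W.subspace_dim[OF this vsubspace_fin_dim[OF W]] vsubspace_fin_dim[OF U]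
  show ?thesis by (simp add: vdim_def)
qed

lemma vdim_carrier: "vdim n (carrier_vec n :: 'k::field vec set) = n"
proof -
  interpret N: vec_space "TYPE('k)" n .
  have "N.vs (carrier_vec n) = N.V" by (simp add: module_vec_def)
  then show ?thesis using N.dim_is_n unfolding vdim_def by metis
qed

lemma kernel_dim_eq_vdim:
  assumes "A \<in> carrier_mat m n"
  shows "kernel_dim A = vdim n {v \<in> carrier_vec n. A *\<^sub>v v = 0\<^sub>v m}"
proof -
  interpret kernel m n A by unfold_locales (rule assms)
  show ?thesis by (simp add: vdim_def mat_kernel[OF assms])
qed

lemma rank_eq_vdim:
  assumes "A \<in> carrier_mat m n"
  shows "vec_space.rank m A = vdim m (im A)"
proof -
  interpret vec_space "TYPE('a)" m .
  have "{y \<in> carrier_vec (dim_row A). \<exists>x\<in>carrier_vec (dim_col A). A *\<^sub>v x = y} = im A"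
    using assms by (auto simp: im_def)
  with col_space_eq[OF assms] have "span (set (cols A)) = im A"
    by (simp add: col_space_def)
  then show ?thesis by (simp add: rank_def vdim_def)
qed

lemma vsubspace_kernel:
  assumes "A \<in> carrier_mat m n" "vsubspace n U"
  shows "vsubspace n {v \<in> U. A *\<^sub>v v = 0\<^sub>v m}"
  using assms unfolding vsubspace_def
  by (auto simp: mult_add_distrib_mat_vec[OF assms(1)] mult_mat_vec[OF assms(1)] subset_iff)

lemma smult_0_left_vec: "x \<in> carrier_vec n \<Longrightarrow> 0 \<cdot>\<^sub>v x = (0\<^sub>v n :: 'k::mult_zero vec)"
  by (rule eq_vecI) auto

lemma smult_zero_vec: "c \<cdot>\<^sub>v 0\<^sub>v n = (0\<^sub>v n :: 'k::mult_zero vec)"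
  by (rule eq_vecI) auto

lemma vsubspace_linear_image:
  assumes U: "vsubspace n (U :: 'k::field vec set)"
    and T: "\<And>u. u \<in> U \<Longrightarrow> T u \<in> carrier_vec m"
    and add: "\<And>u v. u \<in> U \<Longrightarrow> v \<in> U \<Longrightarrow> T (u + v) = T u + T v"
    and scale: "\<And>c u. u \<in> U \<Longrightarrow> T (c \<cdot>\<^sub>v u) = c \<cdot>\<^sub>v T u"
  shows "vsubspace m (T ` U)"
  unfolding vsubspace_def
proof (intro conjI ballI allI)
  have 0: "0\<^sub>v n \<in> U" using U by (simp add: vsubspace_def)
  have "T (0\<^sub>v n) = 0\<^sub>v m"
    using scale[OF 0, of 0] unfolding smult_0_left_vec[OF T[OF 0]] smult_zero_vec .
  then show "0\<^sub>v m \<in> T ` U" using 0 by (metis image_eqI)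
  show "T ` U \<subseteq> carrier_vec m" using T by auto
  fix u assume u: "u \<in> T ` U"
  then show "c \<cdot>\<^sub>v u \<in> T ` U" for c
    using scale[symmetric] U unfolding vsubspace_def by auto
  fix v assume "v \<in> T ` U"
  with u show "u + v \<in> T ` U"
    using add[symmetric] U unfolding vsubspace_def by auto
qed

lemma vsubspace_carrier: "vsubspace n (carrier_vec n)"
  by (auto simp: vsubspace_def)

lemma vsubspace_im: "A \<in> carrier_mat m n \<Longrightarrow> vsubspace m (im A)"
  unfolding im_def carrier_matD(2)
  by (rule vsubspace_linear_image[OF vsubspace_carrier])
     (auto simp: mult_add_distrib_mat_vec mult_mat_vec)

lemma vdim_mat_rank_nullity:
  assumes A: "A \<in> carrier_mat m n" and U: "vsubspace n U"
  shows "vdim m ((\<lambda>v. A *\<^sub>v v) ` U) + vdim n {v \<in> U. A *\<^sub>v v = 0\<^sub>v m} = vdim n U"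
proof (rule vdim_rank_nullity[OF U])
  have UC: "U \<subseteq> carrier_vec n" using U by (auto simp: vsubspace_def)
  show "A *\<^sub>v u \<in> carrier_vec m" for u by (rule carrier_vecI) (use A in auto)
  show "A *\<^sub>v (u + v) = A *\<^sub>v u + A *\<^sub>v v" if "u \<in> U" "v \<in> U" for u v
    using that UC by (intro mult_add_distrib_mat_vec[OF A]) auto
  show "A *\<^sub>v (c \<cdot>\<^sub>v u) = c \<cdot>\<^sub>v (A *\<^sub>v u)" if "u \<in> U" for c u
    using that UC by (intro mult_mat_vec[OF A]) auto
qed

lemma rank_nullity:
  assumes "A \<in> carrier_mat m n"
  shows "vec_space.rank m A + kernel_dim A = n"
  using vdim_mat_rank_nullity[OF assms vsubspace_carrier] assms
  by (simp add: rank_eq_vdim kernel_dim_eq_vdim vdim_carrier im_def)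

text \<open>For the identity on the zero space, image and kernel are both the zero space, so
  rank-nullity reads \<open>d + d = d\<close> for its dimension \<open>d\<close>.\<close>

lemma vdim_zero: "vdim n {0\<^sub>v n :: 'k::field vec} = 0"
proof -
  have "vsubspace n {0\<^sub>v n :: 'k vec}" by (auto simp: vsubspace_def)
  from vdim_rank_nullity[OF this, where T = "\<lambda>v. v" and m = n]
  have "vdim n {0\<^sub>v n :: 'k vec} + vdim n {v :: 'k vec. v = 0\<^sub>v n \<and> v = 0\<^sub>v n} = vdim n {0\<^sub>v n :: 'k vec}"
    by auto
  moreover have "{v :: 'k vec. v = 0\<^sub>v n \<and> v = 0\<^sub>v n} = {0\<^sub>v n}" by auto
  ultimately show ?thesis by simp
qed

lemma vdim_inj_image:
  assumes U: "vsubspace n (U :: 'k::field vec set)"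
    and T: "\<And>u. u \<in> U \<Longrightarrow> T u \<in> carrier_vec m"
    and add: "\<And>u v. u \<in> U \<Longrightarrow> v \<in> U \<Longrightarrow> T (u + v) = T u + T v"
    and scale: "\<And>c u. u \<in> U \<Longrightarrow> T (c \<cdot>\<^sub>v u) = c \<cdot>\<^sub>v T u"
    and inj: "\<And>u. u \<in> U \<Longrightarrow> T u = 0\<^sub>v m \<Longrightarrow> u = 0\<^sub>v n"
  shows "vdim m (T ` U) = vdim n U"
proof -
  have 0: "0\<^sub>v n \<in> U" using U by (simp add: vsubspace_def)
  have "T (0\<^sub>v n) = 0\<^sub>v m" 
    using scale[OF 0, of 0] unfolding smult_0_left_vec[OF T[OF 0]] smult_zero_vec .
  then have ker: "{v \<in> U. T v = 0\<^sub>v m} = {0\<^sub>v n}" using inj 0 by blast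
  show ?thesis using vdim_rank_nullity[OF U T add scale] unfolding ker vdim_zero by simp
qed

section \<open>Direct sums and quotients of coordinate subspaces\<close>

definition append_vecs :: "'k vec set \<Rightarrow> 'k vec set \<Rightarrow> 'k vec set" where
  "append_vecs X Y = {x @\<^sub>v y | x y. x \<in> X \<and> y \<in> Y}"

lemma smult_append_vec: "c \<cdot>\<^sub>v (x @\<^sub>v y) = (c \<cdot>\<^sub>v x) @\<^sub>v (c \<cdot>\<^sub>v y)"
  by (rule eq_vecI) auto

lemma append_zero_vec: "0\<^sub>v n @\<^sub>v 0\<^sub>v m = 0\<^sub>v (n + m)"
  by (rule eq_vecI) auto

lemma vsubspace_append_vecs:
  assumes "vsubspace n X" "vsubspace m Y"
  shows "vsubspace (n + m) (append_vecs X Y)"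
  unfolding vsubspace_def
proof (intro conjI ballI allI)
  have X: "X \<subseteq> carrier_vec n" and Y: "Y \<subseteq> carrier_vec m"
    using assms by (auto simp: vsubspace_def)
  show "append_vecs X Y \<subseteq> carrier_vec (n + m)"
    using X Y by (auto simp: append_vecs_def)
  show "0\<^sub>v (n + m) \<in> append_vecs X Y"
    using assms unfolding append_vecs_def vsubspace_def append_zero_vec[symmetric] by blast
  fix u assume u: "u \<in> append_vecs X Y"
  then show "c \<cdot>\<^sub>v u \<in> append_vecs X Y" for c
  proof -
    from u obtain x y where *: "u = x @\<^sub>v y" "x \<in> X" "y \<in> Y"
      unfolding append_vecs_def by auto
    then have "c \<cdot>\<^sub>v x \<in> X" "c \<cdot>\<^sub>v y \<in> Y" using assms by (auto simp: vsubspace_def)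
    then show ?thesis unfolding *(1) smult_append_vec append_vecs_def by blast
  qed
  fix v assume "v \<in> append_vecs X Y"
  with u obtain x y x' y' where *: "u = x @\<^sub>v y" "v = x' @\<^sub>v y'" "x \<in> X" "x' \<in> X" "y \<in> Y" "y' \<in> Y"
    unfolding append_vecs_def by auto
  then have "u + v = (x + x') @\<^sub>v (y + y')" using X Y by (auto intro!: append_vec_add)
  moreover have "x + x' \<in> X" "y + y' \<in> Y" using * assms by (auto simp: vsubspace_def)
  ultimately show "u + v \<in> append_vecs X Y" by (auto simp: append_vecs_def)
qed

lemma vec_first_append': "x \<in> carrier_vec n \<Longrightarrow> vec_first (x @\<^sub>v y) n = x"
  by (rule eq_vecI) (auto simp: vec_first_def)

lemma vec_last_append': "y \<in> carrier_vec m \<Longrightarrow> vec_last (x @\<^sub>v y) m = y"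
  by (rule eq_vecI) (auto simp: vec_last_def)

lemma
  assumes "u \<in> carrier_vec (n + m)"
  shows vec_first_smult: "vec_first (c \<cdot>\<^sub>v u) n = c \<cdot>\<^sub>v vec_first u n"
    and vec_last_smult: "vec_last (c \<cdot>\<^sub>v u) m = c \<cdot>\<^sub>v vec_last u m"
  using assms by (auto simp: vec_first_def vec_last_def)

lemma
  assumes "u \<in> carrier_vec (n + m)" "v \<in> carrier_vec (n + m)"
  shows vec_first_add: "vec_first (u + v) n = vec_first u n + vec_first v n"
    and vec_last_add: "vec_last (u + v) m = vec_last u m + vec_last v m"
  using assms by (auto simp: vec_first_def vec_last_def)

text \<open>Rank-nullity for the projection to the first \<open>n\<close> coordinates: its image is
  \<open>X\<close> and its kernel is a copy of \<open>Y\<close>.\<close>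

lemma vdim_append_vecs:
  assumes "vsubspace n (X :: 'k::field vec set)" "vsubspace m Y"
  shows "vdim (n + m) (append_vecs X Y) = vdim n X + vdim m Y"
proof -
  have X: "X \<subseteq> carrier_vec n" and Y: "Y \<subseteq> carrier_vec m" and 0: "0\<^sub>v n \<in> X" "0\<^sub>v m \<in> Y"
    using assms by (auto simp: vsubspace_def)
  let ?U = "append_vecs X Y"
  have UC: "?U \<subseteq> carrier_vec (n + m)"
    using vsubspace_append_vecs[OF assms] by (auto simp: vsubspace_def)
  have "vdim n ((\<lambda>v. vec_first v n) ` ?U) + vdim (n + m) {v \<in> ?U. vec_first v n = 0\<^sub>v n} = vdim (n + m) ?U"
  proof (rule vdim_rank_nullity[OF vsubspace_append_vecs[OF assms]])
    show "vec_first u n \<in> carrier_vec n" for u :: "'k vec" by simp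
    show "vec_first (u + v) n = vec_first u n + vec_first v n" if "u \<in> ?U" "v \<in> ?U" for u v
      using that UC by (intro vec_first_add[of _ _ m]) auto
    show "vec_first (c \<cdot>\<^sub>v u) n = c \<cdot>\<^sub>v vec_first u n" if "u \<in> ?U" for c u
      using that UC by (intro vec_first_smult[of _ _ m]) auto
  qed
  moreover have "(\<lambda>v. vec_first v n) ` ?U = X"
  proof (intro equalityI subsetI)
    show "v \<in> X" if "v \<in> (\<lambda>v. vec_first v n) ` ?U" for v
      using that X by (auto simp: append_vecs_def vec_first_append' subset_iff)
    show "x \<in> (\<lambda>v. vec_first v n) ` ?U" if "x \<in> X" for x
    proof (rule image_eqI)
      show "x = vec_first (x @\<^sub>v 0\<^sub>v m) n" using that X by (auto simp: vec_first_append')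
      show "x @\<^sub>v 0\<^sub>v m \<in> ?U" using that 0 by (auto simp: append_vecs_def)
    qed
  qed
  moreover have "{v \<in> ?U. vec_first v n = 0\<^sub>v n} = (\<lambda>y. 0\<^sub>v n @\<^sub>v y) ` Y"
    using X 0 by (auto simp: append_vecs_def vec_first_append' subset_iff)
  moreover have "vdim (n + m) ((\<lambda>y. 0\<^sub>v n @\<^sub>v y) ` Y) = vdim m Y"
  proof (rule vdim_inj_image[OF assms(2)])
    show "0\<^sub>v n @\<^sub>v u \<in> carrier_vec (n + m)" if "u \<in> Y" for u using that Y by auto
    show "0\<^sub>v n @\<^sub>v (u + v) = (0\<^sub>v n @\<^sub>v u) + (0\<^sub>v n @\<^sub>v v)" if "u \<in> Y" "v \<in> Y" for u v :: "'k vec"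
      using that Y by (subst append_vec_add[of _ n _ _ m]) auto
    show "0\<^sub>v n @\<^sub>v (c \<cdot>\<^sub>v u) = c \<cdot>\<^sub>v (0\<^sub>v n @\<^sub>v u)" for c and u :: "'k vec"
      by (simp add: smult_append_vec smult_zero_vec)
    show "u = 0\<^sub>v m" if "u \<in> Y" "0\<^sub>v n @\<^sub>v u = 0\<^sub>v (n + m)" for u
      using that(2) append_vec_eq[OF zero_carrier_vec zero_carrier_vec, where w = u and w' = "0\<^sub>v m" and n = n]
      unfolding append_zero_vec[symmetric] by blast
  qed
  ultimately show ?thesis by simp
qed

text \<open>The map \<open>x @ y \<mapsto> f x + y\<close> from \<open>Z \<oplus> B'\<close> to \<open>Z'\<close> has a kernel isomorphic to \<open>B\<close>.\<close>

lemma vdim_quotient_le: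
  assumes Z: "vsubspace n Z" and B: "vsubspace n B" and Z': "vsubspace m Z'" and B': "vsubspace m B'"
    and sub: "B \<subseteq> Z" "B' \<subseteq> Z'"
    and f: "f \<in> carrier_mat m n"
    and fZ: "\<And>x. x \<in> Z \<Longrightarrow> f *\<^sub>v x \<in> Z'"
    and fB: "\<And>x. x \<in> B \<Longrightarrow> f *\<^sub>v x \<in> B'"
    and inj: "\<And>x. x \<in> Z \<Longrightarrow> f *\<^sub>v x \<in> B' \<Longrightarrow> x \<in> B"
  shows "vdim n Z + vdim m B' \<le> vdim m Z' + vdim n (B :: 'k::field vec set)"
proof -
  let ?U = "append_vecs Z B'"
  let ?T = "\<lambda>v. f *\<^sub>v (vec_first v n) + vec_last v m"
  have C: "Z \<subseteq> carrier_vec n" "B \<subseteq> carrier_vec n" "Z' \<subseteq> carrier_vec m" "B' \<subseteq> carrier_vec m"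
    using assms by (auto simp: vsubspace_def)
  have U: "vsubspace (n + m) ?U" by (rule vsubspace_append_vecs[OF Z B'])
  have UC: "?U \<subseteq> carrier_vec (n + m)" using U by (auto simp: vsubspace_def)
  have first: "vec_first (u + v) n = vec_first u n + vec_first v n"
      "vec_last (u + v) m = vec_last u m + vec_last v m"
      "vec_first (c \<cdot>\<^sub>v u) n = c \<cdot>\<^sub>v vec_first u n"
      "vec_last (c \<cdot>\<^sub>v u) m = c \<cdot>\<^sub>v vec_last u m"
    if "u \<in> ?U" "v \<in> ?U" for u v :: "'k vec" and c
    using that UC vec_first_add[of u n m v] vec_last_add[of u n m v]
      vec_first_smult[of u n m c] vec_last_smult[of u n m c] by auto
  have TC: "?T u \<in> carrier_vec m" for u using f by auto
  have add: "?T (u + v) = ?T u + ?T v" if "u \<in> ?U" "v \<in> ?U" for u v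
  proof -
    let ?a = "f *\<^sub>v vec_first u n" let ?b = "vec_last u m"
    let ?c = "f *\<^sub>v vec_first v n" let ?d = "vec_last v m"
    have "?a \<in> carrier_vec m" "?c \<in> carrier_vec m" "?b \<in> carrier_vec m" "?d \<in> carrier_vec m"
      using f by auto
    then have "(?a + ?c) + (?b + ?d) = (?a + ?b) + (?c + ?d)"
      by (intro eq_vecI) (auto simp del: index_mult_mat_vec)
    then show ?thesis
      unfolding first[OF that] mult_add_distrib_mat_vec[OF f vec_first_carrier vec_first_carrier] .
  qed
  have scale: "?T (c \<cdot>\<^sub>v u) = c \<cdot>\<^sub>v ?T u" if "u \<in> ?U" for u c
    using f unfolding first[OF that that] by (subst mult_mat_vec[OF f]) (auto simp: smult_add_distrib_vec[of _ m])
  have T: "?T (x @\<^sub>v y) = f *\<^sub>v x + y" if "x \<in> Z" "y \<in> B'" for x y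
    using that C by (simp add: subset_iff vec_first_append' vec_last_append')
  have rn: "vdim m (?T ` ?U) + vdim (n + m) {v \<in> ?U. ?T v = 0\<^sub>v m} = vdim (n + m) ?U"
    by (rule vdim_rank_nullity[OF U TC add scale])
  have imsub: "?T ` ?U \<subseteq> Z'"
  proof (clarsimp simp: append_vecs_def)
    fix x y assume xy: "x \<in> Z" "y \<in> B'"
    with T fZ sub have "?T (x @\<^sub>v y) = f *\<^sub>v x + y" "f *\<^sub>v x \<in> Z'" "y \<in> Z'" by auto
    then show "?T (x @\<^sub>v y) \<in> Z'" using Z' by (auto simp: vsubspace_def)
  qed
  have imsp: "vsubspace m (?T ` ?U)"
    by (rule vsubspace_linear_image[OF U TC add scale])
  \<comment> \<open>A pair \<open>(x, y)\<close> in the kernel has \<open>y = - f x\<close>, and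
    \<open>y \<in> B'\<close> forces \<open>x \<in> B\<close> by \<open>inj\<close>; conversely
    \<open>fB\<close> puts \<open>- f x\<close> into \<open>B'\<close> for every
    \<open>x \<in> B\<close>. So \<open>?S\<close> parametrizes the kernel by
    \<open>B\<close>.\<close>
  let ?S = "\<lambda>x. x @\<^sub>v (f *\<^sub>v (- x))"
  have neg: "- x = (-1) \<cdot>\<^sub>v x" for x :: "'k vec" by (rule eq_vecI) auto
  have fneg: "f *\<^sub>v (- x) = - (f *\<^sub>v x)" if "x \<in> carrier_vec n" for x
    using f that by (simp add: neg mult_mat_vec)
  have ker: "{v \<in> ?U. ?T v = 0\<^sub>v m} = ?S ` B"
  proof (intro equalityI subsetI)
    fix v assume "v \<in> {v \<in> ?U. ?T v = 0\<^sub>v m}"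
    then obtain x y where v: "v = x @\<^sub>v y" "x \<in> Z" "y \<in> B'" "?T v = 0\<^sub>v m"
      by (auto simp: append_vecs_def)
    then have eq: "f *\<^sub>v x + y = 0\<^sub>v m" using T by simp
    have c: "f *\<^sub>v x \<in> carrier_vec m" "y \<in> carrier_vec m" "x \<in> carrier_vec n" using f C v by auto
    have y: "y = - (f *\<^sub>v x)"
    proof (rule eq_vecI)
      fix i assume "i < dim_vec (- (f *\<^sub>v x))"
      then have "i < m" using f by auto
      then have "(f *\<^sub>v x + y) $ i = 0" using eq by simp
      with c \<open>i < m\<close> show "y $ i = (- (f *\<^sub>v x)) $ i" using f by (simp add: add_eq_0_iff2 add.commute)
    qed (use c f in auto)
    have "- y = f *\<^sub>v x" using y by simp
    then have "f *\<^sub>v x \<in> B'" using v(3) B' unfolding vsubspace_def by (metis neg)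
    then have "x \<in> B" using inj v by simp
    then show "v \<in> ?S ` B" using v y fneg c by (intro image_eqI[of _ _ x]) auto
  next
    fix v assume "v \<in> ?S ` B"
    then obtain x where x: "x \<in> B" "v = ?S x" by auto
    then have xc: "x \<in> carrier_vec n" "x \<in> Z" using C sub by auto
    have "- x \<in> B" using x B unfolding vsubspace_def neg by blast
    then have *: "f *\<^sub>v (- x) \<in> B'" by (rule fB)
    have "?T v = f *\<^sub>v x + f *\<^sub>v (- x)" using x T xc * by simp
    also have "\<dots> = 0\<^sub>v m" using fneg xc f by auto
    finally show "v \<in> {v \<in> ?U. ?T v = 0\<^sub>v m}"
      using x xc * by (auto simp: append_vecs_def)
  qed
  have "vdim (n + m) (?S ` B) = vdim n B"
  proof (rule vdim_inj_image[OF B])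
    show "?S u \<in> carrier_vec (n + m)" if "u \<in> B" for u using that C f by auto
    show "?S (u + v) = ?S u + ?S v" if "u \<in> B" "v \<in> B" for u v :: "'k vec"
    proof -
      have "u \<in> carrier_vec n" "v \<in> carrier_vec n" using that C by auto
      moreover from this have "- (u + v) = - u + - v" by auto
      ultimately show ?thesis using f
        by (subst append_vec_add[of _ n _ _ m]) (auto simp: mult_add_distrib_mat_vec[OF f])
    qed
    show "?S (c \<cdot>\<^sub>v u) = c \<cdot>\<^sub>v ?S u" if "u \<in> B" for c and u :: "'k vec"
    proof -
      have "u \<in> carrier_vec n" using that C by auto
      moreover have "- (c \<cdot>\<^sub>v u) = c \<cdot>\<^sub>v (- u)" by auto
      ultimately show ?thesis using f by (simp add: smult_append_vec mult_mat_vec[OF f])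
    qed
    show "u = 0\<^sub>v n" if "u \<in> B" "?S u = 0\<^sub>v (n + m)" for u
    proof -
      have "u \<in> carrier_vec n" using that C by auto
      from append_vec_eq[OF this zero_carrier_vec] that(2) show ?thesis
        unfolding append_zero_vec[symmetric] by blast
    qed
  qed
  then have "vdim m (?T ` ?U) + vdim n B = vdim n Z + vdim m B'"
    using rn ker vdim_append_vecs[OF Z B'] by simp
  moreover have "vdim m (?T ` ?U) \<le> vdim m Z'" by (rule vdim_mono[OF imsp Z' imsub])
  ultimately show ?thesis by simp
qed

section \<open>Kernel and rank of block diagonal and negated matrices\<close>

lemma kernel_dim_four_block_diag:
  assumes A: "A \<in> carrier_mat r n" and B: "B \<in> carrier_mat s m"
  shows "kernel_dim (four_block_mat A (0\<^sub>m r m) (0\<^sub>m s n) B) = kernel_dim A + kernel_dim (B :: 'k::field mat)"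
proof -
  let ?M = "four_block_mat A (0\<^sub>m r m) (0\<^sub>m s n) B"
  have M: "?M \<in> carrier_mat (r + s) (n + m)" using A B by auto
  have mul: "?M *\<^sub>v (x @\<^sub>v y) = A *\<^sub>v x @\<^sub>v B *\<^sub>v y" if "x \<in> carrier_vec n" "y \<in> carrier_vec m" for x y
    using that A B by (subst four_block_mat_mult_vec[OF A _ _ B]) auto
  have "{v \<in> carrier_vec (n + m). ?M *\<^sub>v v = 0\<^sub>v (r + s)}
     = append_vecs {v \<in> carrier_vec n. A *\<^sub>v v = 0\<^sub>v r} {v \<in> carrier_vec m. B *\<^sub>v v = 0\<^sub>v s}" (is "?L = ?R")
  proof (intro equalityI subsetI)
    fix v assume v: "v \<in> ?L"
    then have "v = vec_first v n @\<^sub>v vec_last v m" by simp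
    then obtain x y where xy: "v = x @\<^sub>v y" "x \<in> carrier_vec n" "y \<in> carrier_vec m"
      by (metis vec_first_carrier vec_last_carrier)
    with v mul have "A *\<^sub>v x @\<^sub>v B *\<^sub>v y = 0\<^sub>v r @\<^sub>v 0\<^sub>v s" by (simp add: append_zero_vec)
    moreover have "A *\<^sub>v x \<in> carrier_vec r" by (rule carrier_vecI) (use A in auto)
    ultimately have "A *\<^sub>v x = 0\<^sub>v r" "B *\<^sub>v y = 0\<^sub>v s" by (auto simp: append_vec_eq[of _ r])
    then show "v \<in> ?R" using xy by (auto simp: append_vecs_def)
  next
    fix v assume "v \<in> ?R"
    then show "v \<in> ?L" using mul by (auto simp: append_vecs_def append_zero_vec)
  qed
  then show ?thesis
    using vdim_append_vecs[OF vsubspace_kernel[OF A vsubspace_carrier] vsubspace_kernel[OF B vsubspace_carrier]]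
    by (simp add: kernel_dim_eq_vdim[OF M] kernel_dim_eq_vdim[OF A] kernel_dim_eq_vdim[OF B])
qed

text \<open>Rank and nullity add up to the number of columns for each of the three matrices, so
  additivity of the nullity gives additivity of the rank.\<close>

lemma rank_four_block_diag:
  assumes A: "A \<in> carrier_mat r n" and B: "B \<in> carrier_mat s m"
  shows "vec_space.rank (r + s) (four_block_mat A (0\<^sub>m r m) (0\<^sub>m s n) B)
    = vec_space.rank r A + vec_space.rank s (B :: 'k::field mat)"
  using rank_nullity[OF A] rank_nullity[OF B] kernel_dim_four_block_diag[OF A B]
    rank_nullity[OF four_block_carrier_mat[OF A B, of "0\<^sub>m r m" "0\<^sub>m s n"]]
  by linarith

lemma uminus_vec_eq_0: "- v = 0\<^sub>v n \<longleftrightarrow> v = (0\<^sub>v n :: 'k::field vec)"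
  by (auto simp: vec_eq_iff)

lemma kernel_dim_uminus:
  "A \<in> carrier_mat r n \<Longrightarrow> kernel_dim (- A) = kernel_dim (A :: 'k::field mat)"
  by (simp add: kernel_dim_eq_vdim[of _ r n] uminus_mult_mat_vec uminus_vec_eq_0 cong: conj_cong)

lemma rank_uminus:
  assumes "A \<in> carrier_mat r n"
  shows "vec_space.rank r (- A) = vec_space.rank r (A :: 'k::field mat)"
  using rank_nullity[OF assms] rank_nullity[of "- A" r n] kernel_dim_uminus[OF assms] assms by auto

section \<open>Matrices over a subring\<close>

text \<open>\<open>S\<close> may be any set of entries: besides rings it will be an ideal, so that
  membership in \<open>mats S m n\<close> records that a map vanishes modulo something.\<close>

definition mats :: "'r set \<Rightarrow> nat \<Rightarrow> nat \<Rightarrow> 'r mat set" where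
  "mats S m n = {A \<in> carrier_mat m n. \<forall>i<m. \<forall>j<n. A $$ (i, j) \<in> S}"

lemma mats_carrier: "A \<in> mats S m n \<Longrightarrow> A \<in> carrier_mat m n"
  by (simp add: mats_def)

lemma mats_index: "A \<in> mats S m n \<Longrightarrow> i < m \<Longrightarrow> j < n \<Longrightarrow> A $$ (i, j) \<in> S"
  by (simp add: mats_def)

lemma mats_mono: "A \<in> mats S m n \<Longrightarrow> S \<subseteq> S' \<Longrightarrow> A \<in> mats S' m n"
  by (auto simp: mats_def)

lemma elements_mat_subset_iff:
  "A \<in> carrier_mat m n \<Longrightarrow> elements_mat A \<subseteq> S \<longleftrightarrow> A \<in> mats S m n"
  unfolding mats_def by (auto intro: elements_matI)

lemma free_module_iff: "v \<in> free_module S n \<longleftrightarrow> v \<in> carrier_vec n \<and> (\<forall>i<n. v $ i \<in> S)"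
  by (auto simp: free_module_def vec_set_def)

lemma free_module_carrier: "v \<in> free_module S n \<Longrightarrow> v \<in> carrier_vec n"
  by (simp add: free_module_def)

lemma free_module_col: "A \<in> mats S m n \<Longrightarrow> j < n \<Longrightarrow> col A j \<in> free_module S m"
  by (auto simp: free_module_iff mats_def)

lemma mult_unit_vec:
  fixes A :: "'r::comm_ring_1 mat"
  assumes "A \<in> carrier_mat m n" "j < n"
  shows "A *\<^sub>v unit_vec n j = col A j"
  by (rule eq_vecI) (use assms in auto)

text \<open>A map out of a free module is determined by the images of the basis vectors, so a matrix
  equation may be solved one column at a time.\<close>

lemma lift_columns:
  assumes E: "E \<in> carrier_mat b c" and M: "M \<in> carrier_mat b k"
    and lift: "\<And>j. j < k \<Longrightarrow> \<exists>w \<in> free_module S c. E *\<^sub>v w = col M j"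
  shows "\<exists>N \<in> mats S c k. E * N = M"
proof -
  from lift obtain w where w: "\<And>j. j < k \<Longrightarrow> w j \<in> free_module S c \<and> E *\<^sub>v w j = col M j"
    by metis
  define N where "N = mat c k (\<lambda>(i, j). w j $ i)"
  have N: "N \<in> mats S c k" using w by (auto simp: N_def mats_def free_module_iff)
  have colN: "col N j = w j" if "j < k" for j
    using w[OF that] that by (intro eq_vecI) (auto simp: N_def free_module_iff)
  have "E * N = M"
  proof (rule mat_col_eqI)
    fix j assume "j < dim_col M"
    then have "j < k" using M by simp
    then show "col (E * N) j = col M j"
      using w colN by (simp add: col_mult2[OF E mats_carrier[OF N]])
  qed (use E M mats_carrier[OF N] in auto)
  with N show ?thesis by blast
qed

text \<open>Rings are subsets of one type, because the rings \<open>polys V\<close> for different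
  \<open>V\<close> share their type and a matrix has to be readable over several of them.\<close>

locale subring_set =
  fixes R :: "'r::comm_ring_1 set"
  assumes zero: "0 \<in> R" and one: "1 \<in> R"
    and add: "x \<in> R \<Longrightarrow> y \<in> R \<Longrightarrow> x + y \<in> R"
    and mult: "x \<in> R \<Longrightarrow> y \<in> R \<Longrightarrow> x * y \<in> R"
    and uminus: "x \<in> R \<Longrightarrow> - x \<in> R"

locale ideal_set = subring_set R for R :: "'r::comm_ring_1 set" +
  fixes S :: "'r set"
  assumes S_subset: "S \<subseteq> R" and S_zero: "0 \<in> S"
    and S_add: "x \<in> S \<Longrightarrow> y \<in> S \<Longrightarrow> x + y \<in> S"
    and S_mult: "x \<in> S \<Longrightarrow> y \<in> R \<Longrightarrow> x * y \<in> S"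
begin

lemma S_uminus: "x \<in> S \<Longrightarrow> - x \<in> S"
  using S_mult[of x "- 1"] one uminus by simp

lemma S_minus: "x \<in> S \<Longrightarrow> y \<in> S \<Longrightarrow> x - y \<in> S"
  using S_add[of x "- y"] S_uminus by simp

lemma S_sum: "(\<And>i. i \<in> X \<Longrightarrow> f i \<in> S) \<Longrightarrow> sum f X \<in> S"
  by (induction X rule: infinite_finite_induct) (auto intro: S_zero S_add)

lemma mats_mult:
  "A \<in> mats S m n \<Longrightarrow> B \<in> mats R n k \<Longrightarrow> A * B \<in> mats S m k"
  by (auto simp: mats_def scalar_prod_def intro!: S_sum S_mult)

lemma mats_mult_vec:
  "A \<in> mats R m n \<Longrightarrow> v \<in> free_module S n \<Longrightarrow> A *\<^sub>v v \<in> free_module S m"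
  by (auto simp: mats_def free_module_iff scalar_prod_def mult.commute[of "A $$ _"] intro!: S_sum S_mult)

lemma mats_zero: "0\<^sub>m m n \<in> mats S m n"
  by (auto simp: mats_def S_zero)

lemma mats_minus: "A \<in> mats S m n \<Longrightarrow> B \<in> mats S m n \<Longrightarrow> A - B \<in> mats S m n"
  by (auto simp: mats_def S_minus)

lemma mats_uminus: "A \<in> mats S m n \<Longrightarrow> - A \<in> mats S m n"
  by (auto simp: mats_def S_uminus)

lemma mats_four_block:
  assumes "A \<in> mats S m n" "B \<in> mats S m n'" "C \<in> mats S m' n" "D \<in> mats S m' n'"
  shows "four_block_mat A B C D \<in> mats S (m + m') (n + n')"
  using assms by (auto simp: mats_def)

lemma free_module_minus: "v \<in> free_module S n \<Longrightarrow> w \<in> free_module S n \<Longrightarrow> v - w \<in> free_module S n"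
  by (auto simp: free_module_iff S_minus)

lemma free_module_append:
  "v \<in> free_module S n \<Longrightarrow> w \<in> free_module S m \<Longrightarrow> v @\<^sub>v w \<in> free_module S (n + m)"
  by (auto simp: free_module_iff)

end

text \<open>A ring is an ideal of itself. Facts about matrices over an ideal thus also serve
  matrices over the ring, under the prefix \<open>ring\<close>.\<close>

sublocale subring_set \<subseteq> ring: ideal_set R R
  by unfold_locales (auto intro: zero add mult)

context subring_set
begin

lemma mats_one: "1\<^sub>m n \<in> mats R n n"
  by (auto simp: mats_def zero one)

lemma free_module_split:
  assumes "v \<in> free_module R (n + m)"
  obtains x y where "v = x @\<^sub>v y" "x \<in> free_module R n" "y \<in> free_module R m"
proof
  from assms have "v \<in> carrier_vec (n + m)" by (simp add: free_module_iff)
  then show "v = vec_first v n @\<^sub>v vec_last v m" by simp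
  show "vec_first v n \<in> free_module R n" "vec_last v m \<in> free_module R m"
    using assms by (auto simp: free_module_iff vec_first_def vec_last_def)
qed

end


section \<open>Free resolutions\<close>

text \<open>The augmentation \<open>D 0\<close> maps into the ring, which has rank 1. With this
  convention it can be treated like any other differential.\<close>

definition target_rank :: "(nat \<Rightarrow> nat) \<Rightarrow> nat \<Rightarrow> nat" where
  "target_rank b i = (case i of 0 \<Rightarrow> 1 | Suc i \<Rightarrow> b i)"

lemma target_rank_simps [simp]: "target_rank b 0 = 1" "target_rank b (Suc i) = b i"
  by (simp_all add: target_rank_def)

text \<open>For \<open>S = R\<close> this is the inclusion of kernels in images. For an ideal
  \<open>S\<close> it is a genuine strengthening: a cycle with entries in \<open>S\<close> must
  bound a chain with entries in \<open>S\<close>, so that lifts can be kept inside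
  \<open>S\<close>.\<close>

definition exact_on :: "'r::comm_ring_1 set \<Rightarrow> (nat \<Rightarrow> nat) \<Rightarrow> (nat \<Rightarrow> 'r mat) \<Rightarrow> bool" where
  "exact_on S b D \<longleftrightarrow> (\<forall>i. \<forall>v \<in> free_module S (b i). D i *\<^sub>v v = 0\<^sub>v (target_rank b i) \<longrightarrow>
     (\<exists>w \<in> free_module S (b (Suc i)). D (Suc i) *\<^sub>v w = v))"

context subring_set
begin

text \<open>Each equality of kernel and image is split into exactness and a matrix identity, the
  latter by testing on unit vectors. A matrix identity survives the passage to constant terms, where
  a statement about kernels would not.\<close>

lemma free_resolution_iff:
  "free_resolution R I b D \<longleftrightarrow>
    (\<forall>i. D i \<in> mats R (target_rank b i) (b i)) \<and>
    (\<forall>i. D i * D (Suc i) = 0\<^sub>m (target_rank b i) (b (Suc i))) \<and>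
    exact_on R b D \<and>
    {(D 0 *\<^sub>v v) $ 0 | v. v \<in> free_module R (b 0)} = I" (is "?L \<longleftrightarrow> ?R")
proof
  assume L: ?L
  have D: "D i \<in> mats R (target_rank b i) (b i)" for i
    using L elements_mat_subset_iff[of "D i" "target_rank b i" "b i" R]
    unfolding free_resolution_def by (cases i) auto
  have eq: "{v \<in> free_module R (b i). D i *\<^sub>v v = 0\<^sub>v (dim_row (D i))} =
           {D (Suc i) *\<^sub>v w | w. w \<in> free_module R (b (Suc i))}" for i
    using L unfolding free_resolution_def by blast
  have "D i * D (Suc i) = 0\<^sub>m (target_rank b i) (b (Suc i))" for i
  proof (rule mat_col_eqI)
    fix j assume "j < dim_col (0\<^sub>m (target_rank b i) (b (Suc i)) :: 'r mat)"
    then have j: "j < b (Suc i)" by simp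
    have "unit_vec (b (Suc i)) j \<in> free_module R (b (Suc i))"
      by (auto simp: free_module_iff unit_vec_def zero one)
    then have "D (Suc i) *\<^sub>v unit_vec (b (Suc i)) j \<in> {v \<in> free_module R (b i). D i *\<^sub>v v = 0\<^sub>v (dim_row (D i))}"
      unfolding eq by blast
    then have *: "D i *\<^sub>v (D (Suc i) *\<^sub>v unit_vec (b (Suc i)) j) = 0\<^sub>v (target_rank b i)"
      using carrier_matD(1)[OF mats_carrier[OF D[of i]]] by auto
    have D1: "D (Suc i) \<in> carrier_mat (b i) (b (Suc i))" using mats_carrier[OF D[of "Suc i"]] by simp
    have "D (Suc i) *\<^sub>v unit_vec (b (Suc i)) j = col (D (Suc i)) j"
      using mult_unit_vec[OF D1 j] .
    with * show "col (D i * D (Suc i)) j = col (0\<^sub>m (target_rank b i) (b (Suc i))) j"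
      using j col_mult2[OF mats_carrier[OF D] D1 j] by simp
  qed (use mats_carrier[OF D] mats_carrier[OF D[of "Suc i"]] in auto)
  moreover have "exact_on R b D"
    unfolding exact_on_def
  proof (intro allI ballI impI)
    fix i v assume "v \<in> free_module R (b i)" "D i *\<^sub>v v = 0\<^sub>v (target_rank b i)"
    then have "v \<in> {v \<in> free_module R (b i). D i *\<^sub>v v = 0\<^sub>v (dim_row (D i))}"
      using mats_carrier[OF D[of i]] by auto
    then show "\<exists>w \<in> free_module R (b (Suc i)). D (Suc i) *\<^sub>v w = v" unfolding eq by blast
  qed
  ultimately show ?R using D L unfolding free_resolution_def by blast
next
  assume R: ?R
  then have D: "D i \<in> mats R (target_rank b i) (b i)" for i by blast
  have D1: "D (Suc i) \<in> mats R (b i) (b (Suc i))" for i using D[of "Suc i"] by simp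
  have eq: "{v \<in> free_module R (b i). D i *\<^sub>v v = 0\<^sub>v (dim_row (D i))} =
           {D (Suc i) *\<^sub>v w | w. w \<in> free_module R (b (Suc i))}" (is "?A = ?B") for i
  proof (intro equalityI subsetI)
    fix v assume "v \<in> ?A"
    then show "v \<in> ?B" using R mats_carrier[OF D, of i] unfolding exact_on_def by fastforce
  next
    fix v assume "v \<in> ?B"
    then obtain w where w: "v = D (Suc i) *\<^sub>v w" "w \<in> free_module R (b (Suc i))" by blast
    have "D i *\<^sub>v v = (D i * D (Suc i)) *\<^sub>v w"
      unfolding w(1) using assoc_mult_mat_vec[OF mats_carrier[OF D] mats_carrier[OF D1]] w
      by (metis free_module_carrier)
    also have "\<dots> = 0\<^sub>v (target_rank b i)"
      using R w by (auto simp: free_module_iff)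
    finally show "v \<in> ?A" using w ring.mats_mult_vec[OF D1] mats_carrier[OF D, of i] by auto
  qed
  show ?L unfolding free_resolution_def
    using R eq D[of 0] D1 mats_carrier[OF D1] mats_carrier[OF D[of 0]]
      elements_mat_subset_iff[OF mats_carrier[OF D], of _ R] D by auto
qed

lemma free_resolutionD:
  assumes "free_resolution R I b D"
  shows "D i \<in> mats R (target_rank b i) (b i)" "D 0 \<in> mats R 1 (b 0)" "D (Suc i) \<in> mats R (b i) (b (Suc i))"
    "D i \<in> carrier_mat (target_rank b i) (b i)" "D 0 \<in> carrier_mat 1 (b 0)" "D (Suc i) \<in> carrier_mat (b i) (b (Suc i))"
    "D i * D (Suc i) = 0\<^sub>m (target_rank b i) (b (Suc i))" "exact_on R b D"
    "{(D 0 *\<^sub>v v) $ 0 | v. v \<in> free_module R (b 0)} = I"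
proof -
  note * = assms[unfolded free_resolution_iff]
  from * show D: "D i \<in> mats R (target_rank b i) (b i)" for i by blast
  from D[of 0] D[of "Suc i"] show D1: "D 0 \<in> mats R 1 (b 0)" "D (Suc i) \<in> mats R (b i) (b (Suc i))" by auto
  from D D1 show "D i \<in> carrier_mat (target_rank b i) (b i)"
    "D 0 \<in> carrier_mat 1 (b 0)" "D (Suc i) \<in> carrier_mat (b i) (b (Suc i))" by (auto intro: mats_carrier)
  from * show "D i * D (Suc i) = 0\<^sub>m (target_rank b i) (b (Suc i))" "exact_on R b D"
    "{(D 0 *\<^sub>v v) $ 0 | v. v \<in> free_module R (b 0)} = I" by blast+
qed

text \<open>The comparison theorem with control of coefficients. If the augmentation lifts with
  entries in the ideal \<open>S\<close> and the target is exact on \<open>S\<close>, every later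
  lifting problem is again posed in \<open>S\<close>, since multiplying by \<open>D (Suc n)\<close>
  over \<open>R\<close> does not leave the ideal.\<close>

lemma lift_chain_map:
  assumes S: "ideal_set R S"
    and D: "\<And>i. D i \<in> mats R (target_rank b i) (b i)"
    and DD: "\<And>i. D i * D (Suc i) = 0\<^sub>m (target_rank b i) (b (Suc i))"
    and D': "\<And>i. D' i \<in> mats R (target_rank b' i) (b' i)"
    and ex: "exact_on S b' D'"
    and aug: "\<And>j. j < b 0 \<Longrightarrow> \<exists>w \<in> free_module S (b' 0). D' 0 *\<^sub>v w = col (D 0) j"
  shows "\<exists>f. (\<forall>i. f i \<in> mats S (b' i) (b i)) \<and> D' 0 * f 0 = D 0 \<and>
     (\<forall>i. D' (Suc i) * f (Suc i) = f i * D (Suc i))"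
proof -
  interpret S: ideal_set R S by (rule S)
  note c = mats_carrier[OF D] mats_carrier[OF D']
  have D1: "D (Suc i) \<in> carrier_mat (b i) (b (Suc i))" "D' (Suc i) \<in> carrier_mat (b' i) (b' (Suc i))" for i
    using c[of "Suc i"] by simp_all
  have D0: "D 0 \<in> carrier_mat 1 (b 0)" "D' 0 \<in> carrier_mat 1 (b' 0)"
    using c[of 0] by simp_all
  \<comment> \<open>The identity in \<open>P\<close> says that the columns of
    \<open>x * D (Suc n)\<close> are cycles of the target, which is what is needed to lift them one
    degree further.\<close>
  define P where "P n x \<longleftrightarrow> x \<in> mats S (b' n) (b n) \<and>
      D' n * x * D (Suc n) = 0\<^sub>m (target_rank b' n) (b (Suc n)) \<and> (n = 0 \<longrightarrow> D' 0 * x = D 0)" for n x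
  define Q where "Q n x y \<longleftrightarrow> D' (Suc n) * y = x * D (Suc n)" for n x y
  have "\<exists>f. \<forall>n. P n (f n) \<and> Q n (f n) (f (Suc n))"
  proof (rule dependent_nat_choice)
    from lift_columns[OF D0(2) D0(1) aug] obtain N where "N \<in> mats S (b' 0) (b 0)" "D' 0 * N = D 0"
      by blast
    then show "\<exists>x. P 0 x" unfolding P_def using DD[of 0] by auto
  next
    fix x n assume P: "P n x"
    then have x: "x \<in> mats S (b' n) (b n)" by (simp add: P_def)
    have xc: "x \<in> carrier_mat (b' n) (b n)" by (rule mats_carrier[OF x])
    have xD: "x * D (Suc n) \<in> mats S (b' n) (b (Suc n))"
      using S.mats_mult[OF x] D[of "Suc n"] by simp
    have "\<exists>w \<in> free_module S (b' (Suc n)). D' (Suc n) *\<^sub>v w = col (x * D (Suc n)) j" if j: "j < b (Suc n)" for j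
    proof -
      have "D' n *\<^sub>v col (x * D (Suc n)) j = col (D' n * (x * D (Suc n))) j"
        using col_mult2[OF c(2) mats_carrier[OF xD] j] by simp
      also have "D' n * (x * D (Suc n)) = D' n * x * D (Suc n)"
        by (rule assoc_mult_mat[OF c(2) xc D1(1), symmetric])
      also have "col \<dots> j = 0\<^sub>v (target_rank b' n)" using P j by (simp add: P_def)
      finally show ?thesis using ex free_module_col[OF xD j] unfolding exact_on_def by blast
    qed
    from lift_columns[OF D1(2) mats_carrier[OF xD] this] obtain y where
      y: "y \<in> mats S (b' (Suc n)) (b (Suc n))" "D' (Suc n) * y = x * D (Suc n)" by blast
    have "D' (Suc n) * y * D (Suc (Suc n)) = x * (D (Suc n) * D (Suc (Suc n)))"
      unfolding y(2) by (rule assoc_mult_mat[OF xc D1(1) D1(1)])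
    also have "\<dots> = 0\<^sub>m (b' n) (b (Suc (Suc n)))" using xc DD[of "Suc n"] by simp
    finally show "\<exists>y. P (Suc n) y \<and> Q n x y" using y unfolding P_def Q_def by auto
  qed
  then show ?thesis unfolding P_def Q_def by (metis)
qed

text \<open>\<open>T\<close> is a chain map that lifts the zero map of \<open>I\<close>. The
  homotopy is built by degree: the part of \<open>T (Suc n)\<close> that
  \<open>h * D (Suc n)\<close> leaves over consists of cycles, so it factors through the next
  differential.\<close>

lemma null_homotopy:
  assumes F: "free_resolution R I b D"
    and T: "\<And>i. T i \<in> mats R (b i) (b i)"
    and T0: "D 0 * T 0 = 0\<^sub>m 1 (b 0)"
    and TS: "\<And>i. D (Suc i) * T (Suc i) = T i * D (Suc i)"
  shows "\<exists>h. (\<forall>i. h i \<in> mats R (b (Suc i)) (b i)) \<and> T 0 = D 1 * h 0 \<and>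
     (\<forall>i. T (Suc i) = D (Suc (Suc i)) * h (Suc i) + h i * D (Suc i))"
proof -
  note D = free_resolutionD[OF F]
  note Tc = mats_carrier[OF T]
  have lift: "\<exists>N \<in> mats R (b (Suc i)) k. D (Suc i) * N = M"
    if M: "M \<in> mats R (b i) k" and 0: "D i * M = 0\<^sub>m (target_rank b i) k" for i k M
  proof (rule lift_columns[OF D(6) mats_carrier[OF M]])
    fix j assume j: "j < k"
    have "D i *\<^sub>v col M j = col (D i * M) j" using col_mult2[OF D(4) mats_carrier[OF M] j] by simp
    also have "\<dots> = 0\<^sub>v (target_rank b i)" using 0 j by simp
    finally show "\<exists>w \<in> free_module R (b (Suc i)). D (Suc i) *\<^sub>v w = col M j"
      using D(8) free_module_col[OF M j] unfolding exact_on_def by blast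
  qed
  define P where "P n h \<longleftrightarrow> h \<in> mats R (b (Suc n)) (b n) \<and>
      D (Suc n) * (T (Suc n) - h * D (Suc n)) = 0\<^sub>m (b n) (b (Suc n)) \<and> (n = 0 \<longrightarrow> T 0 = D 1 * h)" for n h
  define Q where "Q n h h' \<longleftrightarrow> T (Suc n) = D (Suc (Suc n)) * h' + h * D (Suc n)" for n h h'
  have "\<exists>f. \<forall>n. P n (f n) \<and> Q n (f n) (f (Suc n))"
  proof (rule dependent_nat_choice)
    from lift[OF T, of 0] T0 obtain h where h: "h \<in> mats R (b 1) (b 0)" "D 1 * h = T 0" by auto
    have hc: "h \<in> carrier_mat (b (Suc 0)) (b 0)" using mats_carrier[OF h(1)] by simp
    have "D 1 * (T 1 - h * D 1) = D 1 * T 1 - D 1 * (h * D 1)"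
      using mult_minus_distrib_mat[OF D(6) Tc mult_carrier_mat[OF hc D(6)]] by simp
    also have "D 1 * (h * D 1) = T 0 * D 1"
      using assoc_mult_mat[OF D(6) hc D(6)] h(2) by simp
    also have "D 1 * T 1 - T 0 * D 1 = 0\<^sub>m (b 0) (b 1)"
      using TS[of 0] mult_carrier_mat[OF Tc[of 0] D(6)[of 0]] by simp
    finally show "\<exists>h. P 0 h" using h unfolding P_def by auto
  next
    fix h n assume P: "P n h"
    then have h: "h \<in> mats R (b (Suc n)) (b n)" by (simp add: P_def)
    note hc = mats_carrier[OF h]
    have hD: "h * D (Suc n) \<in> mats R (b (Suc n)) (b (Suc n))" by (rule ring.mats_mult[OF h D(3)])
    note hDc = mats_carrier[OF hD]
    from P lift[OF ring.mats_minus[OF T hD]] obtain h' where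
      h': "h' \<in> mats R (b (Suc (Suc n))) (b (Suc n))" "D (Suc (Suc n)) * h' = T (Suc n) - h * D (Suc n)"
      by (auto simp: P_def)
    note h'c = mats_carrier[OF h'(1)]
    have Q: "Q n h h'" unfolding Q_def h'(2) by (rule eq_matI) (use hDc Tc[of "Suc n"] in auto)
    let ?D = "D (Suc (Suc n))"
    have "?D * (T (Suc (Suc n)) - h' * ?D) = ?D * T (Suc (Suc n)) - ?D * (h' * ?D)"
      using mult_minus_distrib_mat[OF D(6) Tc mult_carrier_mat[OF h'c D(6)]] by simp
    also have "?D * (h' * ?D) = (T (Suc n) - h * D (Suc n)) * ?D"
      using assoc_mult_mat[OF D(6) h'c D(6)] h'(2) by simp
    also have "\<dots> = T (Suc n) * ?D - h * D (Suc n) * ?D"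
      by (rule minus_mult_distrib_mat[OF Tc hDc D(6)])
    also have "h * D (Suc n) * ?D = 0\<^sub>m (b (Suc n)) (b (Suc (Suc n)))"
      using assoc_mult_mat[OF hc D(6) D(6)] D(7)[of "Suc n"] hc by simp
    also have "?D * T (Suc (Suc n)) - (T (Suc n) * ?D - \<dots>) = 0\<^sub>m (b (Suc n)) (b (Suc (Suc n)))"
      unfolding TS using mult_carrier_mat[OF Tc[of "Suc n"] D(6)[of "Suc n"]]
      by (intro eq_matI) auto
    finally show "\<exists>y. P (Suc n) y \<and> Q n h y" using h' Q unfolding P_def by auto
  qed
  then show ?thesis unfolding P_def Q_def by metis
qed

text \<open>The comparison theorem with unrestricted coefficients. For \<open>I = I'\<close> it
  supplies the maps between two resolutions of the same ideal.\<close>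

lemma lift_inclusion:
  assumes F: "free_resolution R I b D" and F': "free_resolution R I' b' D'" and sub: "I \<subseteq> I'"
  shows "\<exists>f. (\<forall>i. f i \<in> mats R (b' i) (b i)) \<and> D' 0 * f 0 = D 0 \<and>
     (\<forall>i. D' (Suc i) * f (Suc i) = f i * D (Suc i))"
proof (rule lift_chain_map)
  show "ideal_set R R" by unfold_locales
  note D = free_resolutionD[OF F] and D' = free_resolutionD[OF F']
  fix j assume j: "j < b 0"
  have unit: "unit_vec (b 0) j \<in> free_module R (b 0)"
    by (auto simp: free_module_iff unit_vec_def zero one)
  have col: "D 0 *\<^sub>v unit_vec (b 0) j = col (D 0) j"
    using mult_unit_vec[OF D(5) j] .
  then have "col (D 0) j $ 0 \<in> I'" using D(9) unit sub by force
  then obtain w where w: "w \<in> free_module R (b' 0)" "(D' 0 *\<^sub>v w) $ 0 = col (D 0) j $ 0"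
    using D'(9) by force
  have "D' 0 *\<^sub>v w = col (D 0) j"
    by (rule eq_vecI) (use w D(5) D'(5) in auto)
  then show "\<exists>w \<in> free_module R (b' 0). D' 0 *\<^sub>v w = col (D 0) j" using w by blast
qed (use free_resolutionD[OF F] free_resolutionD[OF F'] in auto)

end

section \<open>Polynomials\<close>

lemma poly_mapping_sum_single:
  "f = (\<Sum>a \<in> Poly_Mapping.keys f. Poly_Mapping.single a (Poly_Mapping.lookup f a))"
proof (rule poly_mapping_eqI)
  fix k
  have "Poly_Mapping.lookup (\<Sum>a \<in> Poly_Mapping.keys f. Poly_Mapping.single a (Poly_Mapping.lookup f a)) k
      = (\<Sum>a \<in> Poly_Mapping.keys f. if a = k then Poly_Mapping.lookup f a else 0)"
    by (auto simp: lookup_sum lookup_single when_def intro!: sum.cong)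
  also have "\<dots> = Poly_Mapping.lookup f k"
    by (simp add: sum.delta in_keys_iff)
  finally show "Poly_Mapping.lookup f k =
    Poly_Mapping.lookup (\<Sum>a \<in> Poly_Mapping.keys f. Poly_Mapping.single a (Poly_Mapping.lookup f a)) k" ..
qed

lemma poly_mapping_additive_induct [case_names zero single add]:
  assumes "P 0" and single: "\<And>a c. P (Poly_Mapping.single a c)" and add: "\<And>f g. P f \<Longrightarrow> P g \<Longrightarrow> P (f + g)"
  shows "P (f :: 'a \<Rightarrow>\<^sub>0 'b::comm_monoid_add)"
proof -
  have "P (\<Sum>a \<in> A. Poly_Mapping.single a (Poly_Mapping.lookup f a))" for A
    by (induction A rule: infinite_finite_induct) (auto intro: assms)
  from this[of "Poly_Mapping.keys f"] show ?thesis by (simp flip: poly_mapping_sum_single)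
qed

text \<open>One construction with three uses: \<open>F = {0}\<close> isolates the constant term,
  \<open>F = avoiding X\<close> sets the variables in \<open>X\<close> to zero, and a general
  \<open>F\<close> splits a polynomial along a sum of monomial ideals.\<close>

definition keep_terms :: "'a set \<Rightarrow> ('a \<Rightarrow>\<^sub>0 'b::zero) \<Rightarrow> ('a \<Rightarrow>\<^sub>0 'b)" where
  "keep_terms F f = Abs_poly_mapping (\<lambda>m. if m \<in> F then Poly_Mapping.lookup f m else 0)"

lemma lookup_keep_terms:
  "Poly_Mapping.lookup (keep_terms F f) m = (if m \<in> F then Poly_Mapping.lookup f m else 0)"
proof -
  have "{m. (if m \<in> F then Poly_Mapping.lookup f m else 0) \<noteq> 0} \<subseteq> Poly_Mapping.keys f"
    by (auto simp: in_keys_iff)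
  then have "finite {m. (if m \<in> F then Poly_Mapping.lookup f m else 0) \<noteq> 0}"
    by (rule finite_subset) simp
  then show ?thesis by (simp add: keep_terms_def)
qed

lemma keys_keep_terms: "Poly_Mapping.keys (keep_terms F f) = Poly_Mapping.keys f \<inter> F"
  by (auto simp: in_keys_iff lookup_keep_terms split: if_splits)

lemma keep_terms_zero: "keep_terms F 0 = 0"
  by (rule poly_mapping_eqI) (simp add: lookup_keep_terms)

lemma keep_terms_add: "keep_terms F (f + g) = keep_terms F f + keep_terms F (g :: 'a \<Rightarrow>\<^sub>0 'b::comm_monoid_add)"
  by (rule poly_mapping_eqI) (simp add: lookup_keep_terms lookup_add)

lemma keep_terms_single:
  "keep_terms F (Poly_Mapping.single m c) = (if m \<in> F then Poly_Mapping.single m c else 0)"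
  by (rule poly_mapping_eqI) (auto simp: lookup_keep_terms lookup_single when_def)

text \<open>A product of terms is kept exactly when both factors are, so discarded terms never
  contribute to a kept one and truncation is multiplicative.\<close>

lemma keep_terms_mult:
  assumes F: "\<And>m m'. m + m' \<in> F \<longleftrightarrow> m \<in> F \<and> m' \<in> F"
  shows "keep_terms F (f * g) = keep_terms F f * keep_terms F (g :: 'a::monoid_add \<Rightarrow>\<^sub>0 'b::semiring_0)"
proof (induction f rule: poly_mapping_additive_induct)
  case (single a c)
  show ?case
    by (induction g rule: poly_mapping_additive_induct)
       (auto simp: keep_terms_add keep_terms_zero keep_terms_single mult_single F distrib_left)
qed (auto simp: keep_terms_add keep_terms_zero distrib_right)

lemma add_eq_zero_poly_mapping_nat: "a + b = 0 \<longleftrightarrow> a = 0 \<and> b = (0 :: 'v \<Rightarrow>\<^sub>0 nat)"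
  by (auto simp: poly_mapping_eq_iff fun_eq_iff lookup_add)

lemma keys_add_nat: "Poly_Mapping.keys (a + b) = Poly_Mapping.keys a \<union> Poly_Mapping.keys (b :: 'v \<Rightarrow>\<^sub>0 nat)"
  by (auto simp: in_keys_iff lookup_add)

lemma const_term_mult: "const_term (f * g) = const_term f * const_term (g :: ('v, 'k::comm_ring_1) mpoly)"
proof -
  have single: "keep_terms {0} f = Poly_Mapping.single 0 (const_term f)" for f :: "('v, 'k) mpoly"
    by (rule poly_mapping_eqI) (auto simp: lookup_keep_terms const_term_def lookup_single when_def)
  have "keep_terms {0} (f * g) = keep_terms {0} f * keep_terms {0} g"
    by (rule keep_terms_mult) (auto simp: add_eq_zero_poly_mapping_nat)
  then have "Poly_Mapping.single 0 (const_term (f * g))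
      = Poly_Mapping.single (0 :: 'v \<Rightarrow>\<^sub>0 nat) (const_term f * const_term g)"
    unfolding single by (simp add: mult_single)
  then show ?thesis by (metis lookup_single_eq)
qed

interpretation const_term: comm_ring_hom "const_term :: ('v, 'k::comm_ring_1) mpoly \<Rightarrow> 'k"
  by unfold_locales (auto simp: const_term_mult, auto simp: const_term_def lookup_add lookup_one)

lemma const_term_uminus: "const_term (- f) = - const_term (f :: ('v, 'k::comm_ring_1) mpoly)"
  by (simp add: const_term_def)

lemma keys_times_subset:
  "m \<in> Poly_Mapping.keys (f * g) \<Longrightarrow> \<exists>a b. m = a + b \<and> a \<in> Poly_Mapping.keys f \<and> b \<in> Poly_Mapping.keys g"
  using keys_mult[of f g] by auto

lemma subring_polys: "subring_set (polys V :: ('v, 'k::comm_ring_1) mpoly set)"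
proof
  fix f g :: "('v, 'k) mpoly"
  assume f: "f \<in> polys V" and g: "g \<in> polys V"
  show "f + g \<in> polys V" using f g keys_add[of f g] by (auto simp: polys_def)
  show "f * g \<in> polys V"
  proof (clarsimp simp: polys_def)
    fix m v assume "m \<in> Poly_Mapping.keys (f * g)" "v \<in> Poly_Mapping.keys m"
    with keys_times_subset[of m f g] f g show "v \<in> V" by (fastforce simp: polys_def keys_add_nat)
  qed
qed (auto simp: polys_def in_keys_iff)


section \<open>Independence of the resolution\<close>

abbreviation residue_mat :: "('v, 'k::field) mpoly mat \<Rightarrow> 'k mat" where
  "residue_mat \<equiv> map_mat const_term"

lemma residue_mat_mult:
  "A \<in> carrier_mat m n \<Longrightarrow> B \<in> carrier_mat n k \<Longrightarrow> residue_mat (A * B) = residue_mat A * residue_mat B"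
  by (rule const_term.mat_hom_mult)

lemma residue_mat_add:
  "A \<in> carrier_mat m n \<Longrightarrow> B \<in> carrier_mat m n \<Longrightarrow> residue_mat (A + B) = residue_mat A + residue_mat B"
  by (rule eq_matI) (auto simp: const_term.hom_add)

lemma residue_mat_minus:
  "A \<in> carrier_mat m n \<Longrightarrow> B \<in> carrier_mat m n \<Longrightarrow> residue_mat (A - B) = residue_mat A - residue_mat B"
  by (rule eq_matI) (auto simp: const_term.hom_minus)

lemma residue_mat_uminus: "residue_mat (- A) = - residue_mat A"
  by (rule eq_matI) (auto simp: const_term_uminus)

lemma residue_mat_one: "residue_mat (1\<^sub>m n) = 1\<^sub>m n"
  by (rule eq_matI) auto

lemma residue_mat_zero: "residue_mat (0\<^sub>m m n) = 0\<^sub>m m n"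
  by (rule eq_matI) auto

text \<open>In degree 0 every vector is a cycle, because the augmentation does not belong to the
  tensored complex. The disjunct \<open>i = 0\<close> also shields the truncated index
  \<open>i - 1\<close>.\<close>

definition res_cycles :: "(nat \<Rightarrow> nat) \<Rightarrow> (nat \<Rightarrow> ('v, 'k::field) mpoly mat) \<Rightarrow> nat \<Rightarrow> 'k vec set" where
  "res_cycles b D i = {v \<in> carrier_vec (b i). i = 0 \<or> residue_mat (D i) *\<^sub>v v = 0\<^sub>v (b (i - 1))}"

definition res_boundaries :: "(nat \<Rightarrow> nat) \<Rightarrow> (nat \<Rightarrow> ('v, 'k::field) mpoly mat) \<Rightarrow> nat \<Rightarrow> 'k vec set" where
  "res_boundaries b D i = im (residue_mat (D (Suc i)))"

context
  fixes b :: "nat \<Rightarrow> nat" and D :: "nat \<Rightarrow> ('v, 'k::field) mpoly mat"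
  assumes D: "\<And>i. D (Suc i) \<in> carrier_mat (b i) (b (Suc i))"
begin

lemma vsubspace_res_cycles: "vsubspace (b i) (res_cycles b D i)"
proof (cases i)
  case 0
  then show ?thesis by (simp add: res_cycles_def vsubspace_carrier)
next
  case (Suc j)
  then show ?thesis
    using vsubspace_kernel[OF _ vsubspace_carrier, of "residue_mat (D i)" "b j" "b i"] D[of j]
    by (simp add: res_cycles_def)
qed

lemma vsubspace_res_boundaries: "vsubspace (b i) (res_boundaries b D i)"
  unfolding res_boundaries_def by (rule vsubspace_im) (use D in auto)

lemma kernel_dim_residue_diff: "kernel_dim (residue_diff b D i) = vdim (b i) (res_cycles b D i)"
proof (cases i)
  case 0
  have "{v \<in> carrier_vec (b 0). 0\<^sub>m 0 (b 0) *\<^sub>v v = (0\<^sub>v 0 :: 'k vec)} = carrier_vec (b 0)" by auto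
  then show ?thesis using 0 kernel_dim_eq_vdim[of "0\<^sub>m 0 (b 0) :: 'k mat" 0 "b 0"]
    by (simp add: residue_diff_def res_cycles_def)
next
  case (Suc j)
  then show ?thesis using kernel_dim_eq_vdim[of "residue_mat (D i)" "b j" "b i"] D[of j]
    by (simp add: residue_diff_def res_cycles_def)
qed

lemma rank_residue_diff: "vec_space.rank (b i) (residue_diff b D (Suc i)) = vdim (b i) (res_boundaries b D i)"
  using rank_eq_vdim[of "residue_mat (D (Suc i))" "b i" "b (Suc i)"] D[of i]
  by (simp add: residue_diff_def res_boundaries_def)

lemma residue_homology_dim_eq:
  "residue_homology_dim b D i = vdim (b i) (res_cycles b D i) - vdim (b i) (res_boundaries b D i)"
  by (simp add: residue_homology_dim_def kernel_dim_residue_diff rank_residue_diff)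

lemma res_boundaries_cycles:
  assumes DD: "\<And>i. D (Suc i) * D (Suc (Suc i)) = 0\<^sub>m (b i) (b (Suc (Suc i)))"
  shows "res_boundaries b D i \<subseteq> res_cycles b D i"
proof
  fix v assume "v \<in> res_boundaries b D i"
  then obtain w where w: "v = residue_mat (D (Suc i)) *\<^sub>v w" "w \<in> carrier_vec (b (Suc i))"
    using D[of i] by (auto simp: res_boundaries_def im_def)
  have vc: "v \<in> carrier_vec (b i)" unfolding w(1) by (rule carrier_vecI) (use D[of i] in auto)
  show "v \<in> res_cycles b D i"
  proof (cases i)
    case (Suc j)
    have r: "residue_mat (D (Suc k)) \<in> carrier_mat (b k) (b (Suc k))" for k using D[of k] by simp
    have w': "w \<in> carrier_vec (b (Suc (Suc j)))" using w Suc by simp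
    have "residue_mat (D (Suc j)) *\<^sub>v v = (residue_mat (D (Suc j)) * residue_mat (D (Suc (Suc j)))) *\<^sub>v w"
      unfolding w(1) Suc using assoc_mult_mat_vec[OF r r w'] by simp
    also have "\<dots> = 0\<^sub>v (b j)"
      unfolding residue_mat_mult[OF D D, symmetric] DD residue_mat_zero
      by (rule eq_vecI) (use w' in auto)
    finally show ?thesis using vc Suc by (simp add: res_cycles_def)
  qed (use vc in \<open>simp add: res_cycles_def\<close>)
qed

end

text \<open>A comparison map \<open>f\<close> with homotopy inverse \<open>g\<close> is injective on
  residue homology, so one homology space is no larger than the other. The inequality is stated with
  sums, where truncated subtraction cannot lose information.\<close>

lemma residue_homology_le:
  fixes D D' :: "nat \<Rightarrow> ('v, 'k::field) mpoly mat"
  assumes R: "subring_set R" and F: "free_resolution R I b D" and F': "free_resolution R I b' D'"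
  shows "vdim (b i) (res_cycles b D i) + vdim (b' i) (res_boundaries b' D' i)
    \<le> vdim (b' i) (res_cycles b' D' i) + vdim (b i) (res_boundaries b D i)"
proof -
  interpret subring_set R by (rule R)
  note D = free_resolutionD[OF F] and D' = free_resolutionD[OF F']
  obtain f where f: "\<And>i. f i \<in> mats R (b' i) (b i)" "D' 0 * f 0 = D 0"
     "\<And>i. D' (Suc i) * f (Suc i) = f i * D (Suc i)"
    using lift_inclusion[OF F F' order_refl] by blast
  obtain g where g: "\<And>i. g i \<in> mats R (b i) (b' i)" "D 0 * g 0 = D' 0"
     "\<And>i. D (Suc i) * g (Suc i) = g i * D' (Suc i)"
    using lift_inclusion[OF F' F order_refl] by blast
  note fc = mats_carrier[OF f(1)] and gc = mats_carrier[OF g(1)]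
  \<comment> \<open>\<open>g f\<close> and the identity lift the same map of \<open>I\<close>, so
    their difference lifts zero and is null-homotopic.\<close>
  define T where "T i = g i * f i - 1\<^sub>m (b i)" for i
  have T: "T i \<in> mats R (b i) (b i)" for i
    unfolding T_def by (intro ring.mats_minus ring.mats_mult[OF g(1) f(1)] mats_one)
  have gfc: "g i * f i \<in> carrier_mat (b i) (b i)" for i by (rule mult_carrier_mat[OF gc fc])
  have T0: "D 0 * T 0 = 0\<^sub>m 1 (b 0)"
  proof -
    have "D 0 * T 0 = D 0 * (g 0 * f 0) - D 0 * 1\<^sub>m (b 0)"
      unfolding T_def by (rule mult_minus_distrib_mat[OF D(5) gfc one_carrier_mat])
    also have "D 0 * (g 0 * f 0) = D 0"
      unfolding assoc_mult_mat[OF D(5) gc fc, symmetric] g(2) f(2) ..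
    finally show ?thesis using D(5) by simp
  qed
  have TS: "D (Suc i) * T (Suc i) = T i * D (Suc i)" for i
  proof -
    have "D (Suc i) * T (Suc i) = D (Suc i) * (g (Suc i) * f (Suc i)) - D (Suc i) * 1\<^sub>m (b (Suc i))"
      unfolding T_def by (rule mult_minus_distrib_mat[OF D(6) gfc one_carrier_mat])
    also have "D (Suc i) * (g (Suc i) * f (Suc i)) = g i * f i * D (Suc i)"
      unfolding assoc_mult_mat[OF D(6) gc fc, symmetric] g(3)
      unfolding assoc_mult_mat[OF gc D'(6) fc] f(3)
      by (rule assoc_mult_mat[OF gc fc D(6), symmetric])
    also have "g i * f i * D (Suc i) - D (Suc i) * 1\<^sub>m (b (Suc i)) = T i * D (Suc i)"
      unfolding T_def minus_mult_distrib_mat[OF gfc one_carrier_mat D(6)]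
      using D(6)[of i] by simp
    finally show ?thesis .
  qed
  obtain h where h: "\<And>i. h i \<in> mats R (b (Suc i)) (b i)" "T 0 = D 1 * h 0"
    "\<And>i. T (Suc i) = D (Suc (Suc i)) * h (Suc i) + h i * D (Suc i)"
    using null_homotopy[OF F T T0 TS] by blast
  note hc = mats_carrier[OF h(1)]
  let ?r = residue_mat
  have rc: "?r (D (Suc i)) \<in> carrier_mat (b i) (b (Suc i))" "?r (D' (Suc i)) \<in> carrier_mat (b' i) (b' (Suc i))"
     "?r (f i) \<in> carrier_mat (b' i) (b i)" "?r (g i) \<in> carrier_mat (b i) (b' i)"
     "?r (h i) \<in> carrier_mat (b (Suc i)) (b i)" for i
    using D(6)[of i] D'(6)[of i] fc[of i] gc[of i] hc[of i] by simp_all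
  have rf: "?r (D' (Suc i)) * ?r (f (Suc i)) = ?r (f i) * ?r (D (Suc i))" for i
    unfolding residue_mat_mult[OF D'(6) fc, symmetric] residue_mat_mult[OF fc D(6), symmetric] f(3) ..
  have rg: "?r (D (Suc i)) * ?r (g (Suc i)) = ?r (g i) * ?r (D' (Suc i))" for i
    unfolding residue_mat_mult[OF D(6) gc, symmetric] residue_mat_mult[OF gc D'(6), symmetric] g(3) ..
  have rT: "?r (T i) = ?r (g i) * ?r (f i) - 1\<^sub>m (b i)" for i
    unfolding T_def residue_mat_minus[OF gfc one_carrier_mat] residue_mat_mult[OF gc fc] residue_mat_one ..
  \<comment> \<open>The summand of the homotopy that starts with a differential kills cycles; what
    remains of \<open>T\<close> on a cycle is a boundary.\<close>
  have homotopy: "?r (T i) *\<^sub>v x = ?r (D (Suc i)) *\<^sub>v (?r (h i) *\<^sub>v x)"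
    if x: "x \<in> res_cycles b D i" for x i
  proof (cases i)
    case 0
    have "?r (T 0) = ?r (D (Suc 0)) * ?r (h 0)"
      unfolding h(2) One_nat_def by (rule residue_mat_mult[OF D(6) hc])
    then show ?thesis using x 0 assoc_mult_mat_vec[OF rc(1) rc(5), of x 0] by (simp add: res_cycles_def)
  next
    case (Suc j)
    have xc: "x \<in> carrier_vec (b (Suc j))" and 0: "?r (D (Suc j)) *\<^sub>v x = 0\<^sub>v (b j)"
      using x Suc by (auto simp: res_cycles_def)
    have "?r (T (Suc j)) = ?r (D (Suc (Suc j))) * ?r (h (Suc j)) + ?r (h j) * ?r (D (Suc j))"
      unfolding h(3) residue_mat_add[OF mult_carrier_mat[OF D(6) hc] mult_carrier_mat[OF hc D(6)]]
        residue_mat_mult[OF D(6) hc] residue_mat_mult[OF hc D(6)] ..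
    then have "?r (T (Suc j)) *\<^sub>v x = ?r (D (Suc (Suc j))) *\<^sub>v (?r (h (Suc j)) *\<^sub>v x) + ?r (h j) *\<^sub>v (?r (D (Suc j)) *\<^sub>v x)"
      using add_mult_distrib_mat_vec[OF mult_carrier_mat[OF rc(1) rc(5)] mult_carrier_mat[OF rc(5) rc(1)] xc]
        assoc_mult_mat_vec[OF rc(1) rc(5) xc] assoc_mult_mat_vec[OF rc(5) rc(1) xc] by simp
    also have "?r (h j) *\<^sub>v (?r (D (Suc j)) *\<^sub>v x) = 0\<^sub>v (b (Suc j))"
      unfolding 0 by (rule eq_vecI) (use hc[of j] in auto)
    finally show ?thesis unfolding Suc
      using mult_mat_vec_carrier[OF rc(1) mult_mat_vec_carrier[OF rc(5) xc]] by simp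
  qed
  have DD: "D (Suc i) * D (Suc (Suc i)) = 0\<^sub>m (b i) (b (Suc (Suc i)))"
    "D' (Suc i) * D' (Suc (Suc i)) = 0\<^sub>m (b' i) (b' (Suc (Suc i)))" for i
    using D(7)[of "Suc i"] D'(7)[of "Suc i"] by simp_all
  have im: "im (?r (D (Suc i))) = {?r (D (Suc i)) *\<^sub>v w | w. w \<in> carrier_vec (b (Suc i))}"
    "im (?r (D' (Suc i))) = {?r (D' (Suc i)) *\<^sub>v w | w. w \<in> carrier_vec (b' (Suc i))}" for i
    using rc(1)[of i] rc(2)[of i] unfolding im_def by auto
  show ?thesis
  proof (rule vdim_quotient_le[of _ _ _ _ _ _ "?r (f i)"])
    show "vsubspace (b i) (res_cycles b D i)" "vsubspace (b' i) (res_cycles b' D' i)"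
      by (intro vsubspace_res_cycles D(6) D'(6))+
    show B: "vsubspace (b i) (res_boundaries b D i)" and "vsubspace (b' i) (res_boundaries b' D' i)"
      by (intro vsubspace_res_boundaries D(6) D'(6))+
    show "res_boundaries b D i \<subseteq> res_cycles b D i" "res_boundaries b' D' i \<subseteq> res_cycles b' D' i"
      by (intro res_boundaries_cycles D(6) D'(6) DD)+
    show "?r (f i) \<in> carrier_mat (b' i) (b i)" by (rule rc)
    show "?r (f i) *\<^sub>v x \<in> res_cycles b' D' i" if x: "x \<in> res_cycles b D i" for x
    proof (cases i)
      case 0
      then have "x \<in> carrier_vec (b 0)" using x by (simp add: res_cycles_def)
      from mult_mat_vec_carrier[OF rc(3) this] show ?thesis unfolding 0 res_cycles_def by blast
    next
      case (Suc j)
      have xc: "x \<in> carrier_vec (b (Suc j))" and 0: "?r (D (Suc j)) *\<^sub>v x = 0\<^sub>v (b j)"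
        using x Suc by (auto simp: res_cycles_def)
      have "?r (D' (Suc j)) *\<^sub>v (?r (f (Suc j)) *\<^sub>v x) = ?r (f j) *\<^sub>v (?r (D (Suc j)) *\<^sub>v x)"
        unfolding assoc_mult_mat_vec[OF rc(2) rc(3) xc, symmetric] rf
        by (rule assoc_mult_mat_vec[OF rc(3) rc(1) xc])
      also have "\<dots> = 0\<^sub>v (b' j)" unfolding 0 by (rule eq_vecI) (use fc[of j] in auto)
      finally show ?thesis using Suc mult_mat_vec_carrier[OF rc(3) xc] by (simp add: res_cycles_def)
    qed
    show "?r (f i) *\<^sub>v x \<in> res_boundaries b' D' i" if "x \<in> res_boundaries b D i" for x
    proof -
      from that obtain w where w: "x = ?r (D (Suc i)) *\<^sub>v w" "w \<in> carrier_vec (b (Suc i))"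
        unfolding res_boundaries_def im by blast
      have "?r (f i) *\<^sub>v x = ?r (D' (Suc i)) *\<^sub>v (?r (f (Suc i)) *\<^sub>v w)"
        unfolding w(1) assoc_mult_mat_vec[OF rc(3) rc(1) w(2), symmetric] rf[symmetric]
        by (rule assoc_mult_mat_vec[OF rc(2) rc(3) w(2)])
      then show ?thesis unfolding res_boundaries_def im using mult_mat_vec_carrier[OF rc(3) w(2)] by blast
    qed
    \<comment> \<open>If \<open>f x\<close> bounds, so does \<open>g f x\<close>. It differs from
      \<open>x\<close> by \<open>T x\<close>, which is a boundary by the homotopy, and hence
      \<open>x\<close> bounds.\<close>
    show "x \<in> res_boundaries b D i" if x: "x \<in> res_cycles b D i" and fx: "?r (f i) *\<^sub>v x \<in> res_boundaries b' D' i" for x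
    proof -
      have xc: "x \<in> carrier_vec (b i)" using x by (simp add: res_cycles_def)
      from fx obtain w where w: "?r (f i) *\<^sub>v x = ?r (D' (Suc i)) *\<^sub>v w" "w \<in> carrier_vec (b' (Suc i))"
        unfolding res_boundaries_def im by blast
      have "?r (g i) *\<^sub>v (?r (f i) *\<^sub>v x) = ?r (D (Suc i)) *\<^sub>v (?r (g (Suc i)) *\<^sub>v w)"
        unfolding w(1) assoc_mult_mat_vec[OF rc(4) rc(2) w(2), symmetric] rg[symmetric]
        by (rule assoc_mult_mat_vec[OF rc(1) rc(4) w(2)])
      then have gf: "?r (g i) *\<^sub>v (?r (f i) *\<^sub>v x) \<in> res_boundaries b D i"
        unfolding res_boundaries_def im using mult_mat_vec_carrier[OF rc(4) w(2)] by blast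
      have hx: "?r (D (Suc i)) *\<^sub>v (?r (h i) *\<^sub>v x) \<in> res_boundaries b D i"
        unfolding res_boundaries_def im using mult_mat_vec_carrier[OF rc(5) xc] by blast
      have "?r (T i) *\<^sub>v x = ?r (g i) *\<^sub>v (?r (f i) *\<^sub>v x) - x"
        unfolding rT minus_mult_distrib_mat_vec[OF mult_carrier_mat[OF rc(4) rc(3)] one_carrier_mat xc]
          assoc_mult_mat_vec[OF rc(4) rc(3) xc] one_mult_mat_vec[OF xc] ..
      then have "?r (D (Suc i)) *\<^sub>v (?r (h i) *\<^sub>v x) = ?r (g i) *\<^sub>v (?r (f i) *\<^sub>v x) - x"
        unfolding homotopy[OF x] .
      moreover have "u = v - w" if "w = v - u" "u \<in> carrier_vec n" "v \<in> carrier_vec n" for u v w :: "'k vec" and n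
        by (rule eq_vecI) (use that in auto)
      ultimately have eq: "x = ?r (g i) *\<^sub>v (?r (f i) *\<^sub>v x) - ?r (D (Suc i)) *\<^sub>v (?r (h i) *\<^sub>v x)"
        using xc mult_mat_vec_carrier[OF rc(4) mult_mat_vec_carrier[OF rc(3) xc]] by blast
      have sub: "u - v \<in> U" if "vsubspace n U" "u \<in> U" "v \<in> U" for u v :: "'k vec" and n U
      proof -
        from that have "u \<in> carrier_vec n" "v \<in> carrier_vec n" by (auto simp: vsubspace_def)
        then have "u - v = u + (- 1) \<cdot>\<^sub>v v" by (intro eq_vecI) simp_all
        with that show ?thesis unfolding vsubspace_def by metis
      qed
      show ?thesis by (subst eq) (rule sub[OF B gf hx])
    qed
  qed
qed

theorem residue_homology_dim_unique:
  fixes D D' :: "nat \<Rightarrow> ('v, 'k::field) mpoly mat"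
  assumes R: "subring_set R" and F: "free_resolution R I b D" and F': "free_resolution R I b' D'"
  shows "residue_homology_dim b D i = residue_homology_dim b' D' i"
proof -
  have c: "D (Suc i) \<in> carrier_mat (b i) (b (Suc i))" "D' (Suc i) \<in> carrier_mat (b' i) (b' (Suc i))" for i
    using F F' by (auto simp: free_resolution_def)
  have "residue_homology_dim b D i = vdim (b i) (res_cycles b D i) - vdim (b i) (res_boundaries b D i)"
    "residue_homology_dim b' D' i = vdim (b' i) (res_cycles b' D' i) - vdim (b' i) (res_boundaries b' D' i)"
    using residue_homology_dim_eq[where D = D and b = b, OF c(1)] residue_homology_dim_eq[where D = D' and b = b', OF c(2)] by auto
  with residue_homology_le[OF R F F', of i] residue_homology_le[OF R F' F, of i] show ?thesis by linarith
qed

text \<open>Any resolution at hand guarantees that the choice inside \<open>betti\<close> yields a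
  genuine one, and uniqueness carries the value over.\<close>

lemma betti_eq_residue_homology_dim:
  assumes "free_resolution (polys V) (I :: ('v, 'k::field) mpoly set) b D"
  shows "betti V I (int i) = residue_homology_dim b D i"
proof -
  obtain b' and D' :: "nat \<Rightarrow> ('v, 'k) mpoly mat" where
    s: "(SOME (b, D). free_resolution (polys V) I b D) = (b', D')" by fastforce
  have "free_resolution (polys V) I b' D'"
    using someI[of "\<lambda>(b, D). free_resolution (polys V) I b D" "(b, D)"] assms s by auto
  from residue_homology_dim_unique[OF subring_polys this assms, of i] show ?thesis
    unfolding betti_def s by simp
qed

section \<open>Mapping cones\<close>

text \<open>
  The cone of \<open>(\<Phi>, \<Psi>) : C \<rightarrow> A \<oplus> B\<close>.  Both \<open>\<Phi>\<close> and \<open>\<Psi>\<close> commute with the higher differentials,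
  but one of them lifts the negative of an inclusion, so that \<open>C \<rightarrow> A \<oplus> B \<rightarrow> A + B\<close> vanishes.
\<close>

definition cone_rank :: "(nat \<Rightarrow> nat) \<Rightarrow> (nat \<Rightarrow> nat) \<Rightarrow> (nat \<Rightarrow> nat) \<Rightarrow> nat \<Rightarrow> nat" where
  "cone_rank bA bB bC i = bA i + bB i + (case i of 0 \<Rightarrow> 0 | Suc j \<Rightarrow> bC j)"

text \<open>In degree \<open>Suc i\<close> the summands are \<open>A\<close>, \<open>B\<close> in
  that degree and \<open>C\<close> in degree \<open>i\<close>. Negating the differential of
  \<open>C\<close> makes consecutive maps compose to zero. The copy of \<open>C\<close> in degree 0
  has an empty block below it, as the augmentation of \<open>C\<close> is not part of the
  cone.\<close>

definition cone_mat :: "(nat \<Rightarrow> nat) \<Rightarrow> (nat \<Rightarrow> 'r mat) \<Rightarrow> (nat \<Rightarrow> nat) \<Rightarrow> (nat \<Rightarrow> 'r mat) \<Rightarrow>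
    (nat \<Rightarrow> nat) \<Rightarrow> (nat \<Rightarrow> 'r mat) \<Rightarrow> (nat \<Rightarrow> 'r mat) \<Rightarrow> (nat \<Rightarrow> 'r mat) \<Rightarrow> nat \<Rightarrow> 'r::comm_ring_1 mat" where
  "cone_mat bA DA bB DB bC DC \<Phi> \<Psi> i = (case i of
     0 \<Rightarrow> four_block_mat (DA 0) (DB 0) (0\<^sub>m 0 (bA 0)) (0\<^sub>m 0 (bB 0))
   | Suc i \<Rightarrow> four_block_mat
       (four_block_mat (DA (Suc i)) (0\<^sub>m (bA i) (bB (Suc i))) (0\<^sub>m (bB i) (bA (Suc i))) (DB (Suc i)))
       (\<Phi> i @\<^sub>r \<Psi> i)
       (0\<^sub>m (case i of 0 \<Rightarrow> 0 | Suc j \<Rightarrow> bC j) (bA (Suc i) + bB (Suc i)))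
       (- (case i of 0 \<Rightarrow> 0\<^sub>m 0 (bC 0) | Suc j \<Rightarrow> DC (Suc j))))"

lemma append_vec_dim_zero: "dim_vec w = 0 \<Longrightarrow> v @\<^sub>v w = v"
  by (rule eq_vecI) auto

lemma vec_add_eq_zero:
  assumes "u \<in> carrier_vec n" "v \<in> carrier_vec n" "u + v = 0\<^sub>v n"
  shows "u = - (v :: 'r::ab_group_add vec)"
proof (rule eq_vecI)
  fix i assume i: "i < dim_vec (- v)"
  then have "(u + v) $ i = 0" unfolding assms(3) using assms(2) by simp
  then show "u $ i = (- v) $ i" using assms(1,2) i by (simp add: eq_neg_iff_add_eq_0)
qed (use assms in auto)

lemma vec_1_eqI:
  assumes "u \<in> carrier_vec 1" "v \<in> carrier_vec 1" "u $ 0 = v $ 0"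
  shows "u = v"
proof (rule eq_vecI)
  fix i assume "i < dim_vec v"
  then have "i = 0" using assms(2) by simp
  then show "u $ i = v $ i" using assms(3) by simp
qed (use assms in auto)

lemma zero_mat_mult_vec: "v \<in> carrier_vec n \<Longrightarrow> 0\<^sub>m m n *\<^sub>v v = (0\<^sub>v m :: 'r::comm_ring_1 vec)"
  by (rule eq_vecI) auto

lemma mat_eq_imp_mult_vec_eq:
  assumes "A * B = C * D" "A \<in> carrier_mat m n" "B \<in> carrier_mat n k" "C \<in> carrier_mat m n'"
    "D \<in> carrier_mat n' k" "v \<in> carrier_vec k"
  shows "A *\<^sub>v (B *\<^sub>v v) = C *\<^sub>v (D *\<^sub>v (v :: 'r::comm_ring_1 vec))"
  using assms by (metis assoc_mult_mat_vec)

lemma mult_mat_zero_vec: "A \<in> carrier_mat m n \<Longrightarrow> A *\<^sub>v 0\<^sub>v n = (0\<^sub>v m :: 'r::comm_ring_1 vec)"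
  by (rule eq_vecI) auto

lemma mult_mat_vec_uminus:
  "A \<in> carrier_mat m n \<Longrightarrow> v \<in> carrier_vec n \<Longrightarrow> A *\<^sub>v (- v) = - (A *\<^sub>v (v :: 'r::comm_ring_1 vec))"
  by (rule eq_vecI) auto

context subring_set
begin

lemma free_resolution_vec_zero:
  assumes F: "free_resolution R I b D" and v: "v \<in> carrier_vec (b (Suc i))"
  shows "D i *\<^sub>v (D (Suc i) *\<^sub>v v) = 0\<^sub>v (target_rank b i)"
  using assoc_mult_mat_vec[OF free_resolutionD(4,6)[OF F] v] v
  unfolding free_resolutionD(7)[OF F] by (metis zero_mat_mult_vec)

text \<open>Two vectors with the same image differ by a cycle, hence by a boundary. This produces
  the corrections in both exactness proofs for the cone.\<close>

lemma free_resolution_solve: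
  assumes F: "free_resolution R I b D" and x: "x \<in> free_module R (b i)" and w: "w \<in> free_module R (b i)"
    and eq: "D i *\<^sub>v x = D i *\<^sub>v w"
  shows "\<exists>x' \<in> free_module R (b (Suc i)). D (Suc i) *\<^sub>v x' + w = x"
proof -
  note D = free_resolutionD[OF F]
  note xc = free_module_carrier[OF x] and wc = free_module_carrier[OF w]
  have "D i *\<^sub>v (x - w) = 0\<^sub>v (target_rank b i)"
    unfolding mult_minus_distrib_mat_vec[OF D(4) xc wc] eq
    by (rule eq_vecI) (use D(4)[of i] in auto)
  then obtain x' where x': "x' \<in> free_module R (b (Suc i))" "D (Suc i) *\<^sub>v x' = x - w"
    using D(8) ring.free_module_minus[OF x w] unfolding exact_on_def by blast
  have "D (Suc i) *\<^sub>v x' + w = x"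
    unfolding x'(2) by (rule eq_vecI) (use xc wc in auto)
  with x'(1) show ?thesis by blast
qed

lemma free_module_uminus: "v \<in> free_module R n \<Longrightarrow> - v \<in> free_module R n"
  by (auto simp: free_module_iff uminus)

context
  fixes A B :: "'r set" and bA bB bC :: "nat \<Rightarrow> nat" and DA DB DC \<Phi> \<Psi> :: "nat \<Rightarrow> 'r mat"
  assumes FA: "free_resolution R A bA DA" and FB: "free_resolution R B bB DB"
    and FC: "free_resolution R (A \<inter> B) bC DC"
    and \<Phi>: "\<And>i. \<Phi> i \<in> mats R (bA i) (bC i)" and \<Phi>0: "DA 0 * \<Phi> 0 = DC 0"
    and \<Phi>S: "\<And>i. DA (Suc i) * \<Phi> (Suc i) = \<Phi> i * DC (Suc i)"
    and \<Psi>: "\<And>i. \<Psi> i \<in> mats R (bB i) (bC i)" and \<Psi>0: "DB 0 * \<Psi> 0 = - DC 0"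
    and \<Psi>S: "\<And>i. DB (Suc i) * \<Psi> (Suc i) = \<Psi> i * DC (Suc i)"
begin

private abbreviation (input) "E \<equiv> cone_mat bA DA bB DB bC DC \<Phi> \<Psi>"
private abbreviation (input) "b \<equiv> cone_rank bA bB bC"
private abbreviation (input) "DC' i \<equiv> (case i of 0 \<Rightarrow> 0\<^sub>m 0 (bC 0) | Suc j \<Rightarrow> DC (Suc j))"
private abbreviation (input) "bC' i \<equiv> (case i of 0 \<Rightarrow> 0 | Suc j \<Rightarrow> bC j)"

lemmas cone_DA = free_resolutionD[OF FA]
lemmas cone_DB = free_resolutionD[OF FB]
lemmas cone_DC = free_resolutionD[OF FC]
lemmas cone_\<Phi>c = mats_carrier[OF \<Phi>]
lemmas cone_\<Psi>c = mats_carrier[OF \<Psi>]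

lemma cone_DC': "DC' i \<in> mats R (bC' i) (bC i)"
  using cone_DC(3) by (cases i) (auto simp: ring.mats_zero)

lemma cone_mat_0: "E 0 \<in> mats R 1 (b 0)"
  using ring.mats_four_block[OF cone_DA(2) cone_DB(2) ring.mats_zero[of 0] ring.mats_zero[of 0]]
  by (simp add: cone_mat_def cone_rank_def)

lemma cone_mat_Suc: "E (Suc i) \<in> mats R (b i) (b (Suc i))"
proof -
  have "\<Phi> i @\<^sub>r \<Psi> i \<in> mats R (bA i + bB i) (bC i + 0)"
    unfolding append_rows_def carrier_matD(1)[OF cone_\<Phi>c] carrier_matD(1)[OF cone_\<Psi>c]
    by (intro ring.mats_four_block \<Phi> \<Psi> ring.mats_zero)
  then show ?thesis
    unfolding cone_mat_def cone_rank_def nat.case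
    by (intro ring.mats_four_block cone_DA(3) cone_DB(3) ring.mats_zero ring.mats_uminus cone_DC') simp_all
qed

lemma cone_mat_0_vec:
  assumes "x \<in> carrier_vec (bA 0)" "y \<in> carrier_vec (bB 0)"
  shows "E 0 *\<^sub>v (x @\<^sub>v y) = DA 0 *\<^sub>v x + DB 0 *\<^sub>v y"
  unfolding cone_mat_def nat.case
  by (subst four_block_mat_mult_vec[OF cone_DA(5) cone_DB(5) zero_carrier_mat zero_carrier_mat assms])
     (simp add: append_vec_dim_zero)

lemma cone_mat_Suc_vec:
  assumes x: "x \<in> carrier_vec (bA (Suc i))" and y: "y \<in> carrier_vec (bB (Suc i))" and z: "z \<in> carrier_vec (bC i)"
  shows "E (Suc i) *\<^sub>v ((x @\<^sub>v y) @\<^sub>v z) =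
    ((DA (Suc i) *\<^sub>v x + \<Phi> i *\<^sub>v z) @\<^sub>v (DB (Suc i) *\<^sub>v y + \<Psi> i *\<^sub>v z)) @\<^sub>v - (DC' i *\<^sub>v z)"
proof -
  let ?G = "four_block_mat (DA (Suc i)) (0\<^sub>m (bA i) (bB (Suc i))) (0\<^sub>m (bB i) (bA (Suc i))) (DB (Suc i))"
  have G: "?G \<in> carrier_mat (bA i + bB i) (bA (Suc i) + bB (Suc i))"
    by (rule four_block_carrier_mat[OF cone_DA(6) cone_DB(6)])
  have X: "\<Phi> i @\<^sub>r \<Psi> i \<in> carrier_mat (bA i + bB i) (bC i)"
    by (rule carrier_append_rows[OF cone_\<Phi>c cone_\<Psi>c])
  have C: "- DC' i \<in> carrier_mat (bC' i) (bC i)" using mats_carrier[OF cone_DC'] by simp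
  have Ax: "DA (Suc i) *\<^sub>v x \<in> carrier_vec (bA i)" by (rule mult_mat_vec_carrier[OF cone_DA(6) x])
  have By: "DB (Suc i) *\<^sub>v y \<in> carrier_vec (bB i)" by (rule mult_mat_vec_carrier[OF cone_DB(6) y])
  have Gxy: "?G *\<^sub>v (x @\<^sub>v y) = (DA (Suc i) *\<^sub>v x) @\<^sub>v (DB (Suc i) *\<^sub>v y)"
    unfolding four_block_mat_mult_vec[OF cone_DA(6) zero_carrier_mat zero_carrier_mat cone_DB(6) x y]
    unfolding zero_mat_mult_vec[OF x] zero_mat_mult_vec[OF y]
    using Ax By by simp
  have Cz: "- DC' i *\<^sub>v z = - (DC' i *\<^sub>v z)"
    by (rule uminus_mult_mat_vec) (use z mats_carrier[OF cone_DC', of i] in auto)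
  have Cz': "DC' i *\<^sub>v z \<in> carrier_vec (bC' i)" by (rule mult_mat_vec_carrier[OF mats_carrier[OF cone_DC'] z])
  have "E (Suc i) *\<^sub>v ((x @\<^sub>v y) @\<^sub>v z) =
    (?G *\<^sub>v (x @\<^sub>v y) + (\<Phi> i @\<^sub>r \<Psi> i) *\<^sub>v z) @\<^sub>v
    (0\<^sub>m (bC' i) (bA (Suc i) + bB (Suc i)) *\<^sub>v (x @\<^sub>v y) + - DC' i *\<^sub>v z)"
    unfolding cone_mat_def nat.case
    by (rule four_block_mat_mult_vec[OF G X zero_carrier_mat C]) (use x y z in auto)
  also have "0\<^sub>m (bC' i) (bA (Suc i) + bB (Suc i)) *\<^sub>v (x @\<^sub>v y) + - DC' i *\<^sub>v z = - (DC' i *\<^sub>v z)"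
  proof -
    have "x @\<^sub>v y \<in> carrier_vec (bA (Suc i) + bB (Suc i))" using x y by simp
    from zero_mat_mult_vec[OF this] show ?thesis unfolding Cz using Cz' by simp
  qed
  also have "?G *\<^sub>v (x @\<^sub>v y) + (\<Phi> i @\<^sub>r \<Psi> i) *\<^sub>v z =
    (DA (Suc i) *\<^sub>v x + \<Phi> i *\<^sub>v z) @\<^sub>v (DB (Suc i) *\<^sub>v y + \<Psi> i *\<^sub>v z)"
    unfolding Gxy mat_mult_append[OF cone_\<Phi>c cone_\<Psi>c z]
    by (rule append_vec_add) (use Ax By mult_mat_vec_carrier[OF cone_\<Phi>c z] mult_mat_vec_carrier[OF cone_\<Psi>c z] in auto)
  finally show ?thesis .
qed

lemma cone_split:
  assumes "v \<in> free_module R (b (Suc i))"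
  obtains x y z where "v = (x @\<^sub>v y) @\<^sub>v z" "x \<in> free_module R (bA (Suc i))" "y \<in> free_module R (bB (Suc i))"
    "z \<in> free_module R (bC i)"
  using assms unfolding cone_rank_def nat.case by (metis free_module_split)

text \<open>The component \<open>z\<close> reaches the ring once through \<open>A\<close>, as
  \<open>DC 0\<close> applied to \<open>z\<close>, and once through \<open>B\<close>, with the
  opposite sign.\<close>

lemma cone_complex_aug:
  assumes "w \<in> free_module R (b (Suc 0))"
  shows "E 0 *\<^sub>v (E (Suc 0) *\<^sub>v w) = 0\<^sub>v 1"
proof -
  from assms obtain x y z where w: "w = (x @\<^sub>v y) @\<^sub>v z" and x: "x \<in> carrier_vec (bA (Suc 0))"
    and y: "y \<in> carrier_vec (bB (Suc 0))" and z: "z \<in> carrier_vec (bC 0)"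
    by (metis cone_split free_module_carrier)
  have c: "DA (Suc 0) *\<^sub>v x \<in> carrier_vec (bA 0)" "\<Phi> 0 *\<^sub>v z \<in> carrier_vec (bA 0)"
    "DB (Suc 0) *\<^sub>v y \<in> carrier_vec (bB 0)" "\<Psi> 0 *\<^sub>v z \<in> carrier_vec (bB 0)"
    by (rule mult_mat_vec_carrier[OF cone_DA(6) x] mult_mat_vec_carrier[OF cone_\<Phi>c z]
        mult_mat_vec_carrier[OF cone_DB(6) y] mult_mat_vec_carrier[OF cone_\<Psi>c z])+
  have "E (Suc 0) *\<^sub>v w = (DA (Suc 0) *\<^sub>v x + \<Phi> 0 *\<^sub>v z) @\<^sub>v (DB (Suc 0) *\<^sub>v y + \<Psi> 0 *\<^sub>v z)"
    unfolding w cone_mat_Suc_vec[OF x y z] by (simp add: append_vec_dim_zero)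
  then have "E 0 *\<^sub>v (E (Suc 0) *\<^sub>v w) =
      DA 0 *\<^sub>v (DA (Suc 0) *\<^sub>v x + \<Phi> 0 *\<^sub>v z) + DB 0 *\<^sub>v (DB (Suc 0) *\<^sub>v y + \<Psi> 0 *\<^sub>v z)"
    using c by (simp add: cone_mat_0_vec)
  also have "DA 0 *\<^sub>v (DA (Suc 0) *\<^sub>v x + \<Phi> 0 *\<^sub>v z) = DC 0 *\<^sub>v z"
    unfolding mult_add_distrib_mat_vec[OF cone_DA(5) c(1,2)] free_resolution_vec_zero[OF FA x]
      assoc_mult_mat_vec[OF cone_DA(5) cone_\<Phi>c z, symmetric] \<Phi>0
    using mult_mat_vec_carrier[OF cone_DC(5) z] by simp
  also have "DB 0 *\<^sub>v (DB (Suc 0) *\<^sub>v y + \<Psi> 0 *\<^sub>v z) = - (DC 0 *\<^sub>v z)"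
    unfolding mult_add_distrib_mat_vec[OF cone_DB(5) c(3,4)] free_resolution_vec_zero[OF FB y]
      assoc_mult_mat_vec[OF cone_DB(5) cone_\<Psi>c z, symmetric] \<Psi>0
    using mult_mat_vec_carrier[OF cone_DC(5) z] z cone_DC(5) by simp
  also have "DC 0 *\<^sub>v z + - (DC 0 *\<^sub>v z) = 0\<^sub>v 1"
    using mult_mat_vec_carrier[OF cone_DC(5) z] by simp
  finally show ?thesis .
qed

lemma cone_complex_Suc:
  assumes "w \<in> free_module R (b (Suc (Suc i)))"
  shows "E (Suc i) *\<^sub>v (E (Suc (Suc i)) *\<^sub>v w) = 0\<^sub>v (b i)"
proof -
  from assms obtain x y z where w: "w = (x @\<^sub>v y) @\<^sub>v z" and x: "x \<in> carrier_vec (bA (Suc (Suc i)))"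
    and y: "y \<in> carrier_vec (bB (Suc (Suc i)))" and z: "z \<in> carrier_vec (bC (Suc i))"
    by (metis cone_split free_module_carrier)
  let ?z = "DC (Suc i) *\<^sub>v z"
  have zc: "?z \<in> carrier_vec (bC i)" by (rule mult_mat_vec_carrier[OF cone_DC(6) z])
  then have nz: "- ?z \<in> carrier_vec (bC i)" by simp
  \<comment> \<open>The same computation serves \<open>A\<close> and \<open>B\<close>: the chain map
    property turns the contribution of \<open>z\<close> into \<open>f i\<close> applied to
    \<open>?z\<close>, and the sign of the shifted differential cancels it.\<close>
  have half: "D (Suc i) *\<^sub>v (D (Suc (Suc i)) *\<^sub>v x + f (Suc i) *\<^sub>v z) + f i *\<^sub>v (- ?z) = 0\<^sub>v (bX i)"
    if F: "free_resolution R X bX D" and x: "x \<in> carrier_vec (bX (Suc (Suc i)))"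
      and f: "\<And>i. f i \<in> carrier_mat (bX i) (bC i)" and fS: "\<And>i. D (Suc i) * f (Suc i) = f i * DC (Suc i)"
    for X bX x D f
  proof -
    note D = free_resolutionD[OF F]
    have c: "D (Suc (Suc i)) *\<^sub>v x \<in> carrier_vec (bX (Suc i))" "f (Suc i) *\<^sub>v z \<in> carrier_vec (bX (Suc i))"
      "f i *\<^sub>v ?z \<in> carrier_vec (bX i)"
      by (rule mult_mat_vec_carrier[OF D(6) x] mult_mat_vec_carrier[OF f z] mult_mat_vec_carrier[OF f zc])+
    have "D (Suc i) *\<^sub>v (D (Suc (Suc i)) *\<^sub>v x + f (Suc i) *\<^sub>v z) = f i *\<^sub>v ?z"
      unfolding mult_add_distrib_mat_vec[OF D(6) c(1,2)] free_resolution_vec_zero[OF F x]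
        mat_eq_imp_mult_vec_eq[OF fS D(6) f f cone_DC(6) z] using c(3) by simp
    then show ?thesis using mult_mat_vec_uminus[OF f zc] c(3) by simp
  qed
  have c: "DA (Suc (Suc i)) *\<^sub>v x + \<Phi> (Suc i) *\<^sub>v z \<in> carrier_vec (bA (Suc i))"
    "DB (Suc (Suc i)) *\<^sub>v y + \<Psi> (Suc i) *\<^sub>v z \<in> carrier_vec (bB (Suc i))"
    using mult_mat_vec_carrier[OF cone_DA(6) x] mult_mat_vec_carrier[OF cone_\<Phi>c z]
        mult_mat_vec_carrier[OF cone_DB(6) y] mult_mat_vec_carrier[OF cone_\<Psi>c z] by auto
  have DC'z: "- (DC' i *\<^sub>v (- ?z)) = 0\<^sub>v (bC' i)"
  proof (cases i)
    case (Suc j)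
    have "z \<in> carrier_vec (bC (Suc (Suc j)))" using z Suc by simp
    from free_resolution_vec_zero[OF FC this] have "DC (Suc j) *\<^sub>v ?z = 0\<^sub>v (bC j)" unfolding Suc by simp
    moreover have "DC (Suc j) *\<^sub>v (- ?z) = - (DC (Suc j) *\<^sub>v ?z)"
      using mult_mat_vec_uminus[OF cone_DC(6)] zc Suc by blast
    ultimately show ?thesis unfolding Suc by simp
  qed auto
  have "E (Suc (Suc i)) *\<^sub>v w = ((DA (Suc (Suc i)) *\<^sub>v x + \<Phi> (Suc i) *\<^sub>v z) @\<^sub>v
      (DB (Suc (Suc i)) *\<^sub>v y + \<Psi> (Suc i) *\<^sub>v z)) @\<^sub>v - ?z"
    unfolding w cone_mat_Suc_vec[OF x y z] by simp
  then have "E (Suc i) *\<^sub>v (E (Suc (Suc i)) *\<^sub>v w) = (0\<^sub>v (bA i) @\<^sub>v 0\<^sub>v (bB i)) @\<^sub>v 0\<^sub>v (bC' i)"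
    unfolding cone_mat_Suc_vec[OF c nz, folded cone_mat_def]
    using half[OF FA x cone_\<Phi>c \<Phi>S] half[OF FB y cone_\<Psi>c \<Psi>S] DC'z c nz by (simp add: cone_mat_Suc_vec)
  then show ?thesis by (simp add: append_zero_vec cone_rank_def)
qed

text \<open>This is where the intersection enters. If the images of \<open>x\<close> and
  \<open>y\<close> add up to zero, the image of \<open>x\<close> lies in both \<open>A\<close> and
  \<open>B\<close> and so comes from some \<open>z\<close> in \<open>C\<close>. Then
  \<open>x\<close> and \<open>y\<close> agree with the lifts of \<open>z\<close> up to
  boundaries.\<close>

lemma cone_exact_aug:
  assumes "v \<in> free_module R (b 0)" "E 0 *\<^sub>v v = 0\<^sub>v 1"
  shows "\<exists>w \<in> free_module R (b (Suc 0)). E (Suc 0) *\<^sub>v w = v"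
proof -
  from assms(1) obtain x y where v: "v = x @\<^sub>v y" and x: "x \<in> free_module R (bA 0)" and y: "y \<in> free_module R (bB 0)"
    unfolding cone_rank_def nat.case add_0_right by (metis free_module_split)
  note xc = free_module_carrier[OF x] and yc = free_module_carrier[OF y]
  have c: "DA 0 *\<^sub>v x \<in> carrier_vec 1" "DB 0 *\<^sub>v y \<in> carrier_vec 1"
    by (rule mult_mat_vec_carrier[OF cone_DA(5) xc] mult_mat_vec_carrier[OF cone_DB(5) yc])+
  have sum: "DA 0 *\<^sub>v x + DB 0 *\<^sub>v y = 0\<^sub>v 1" using assms(2) cone_mat_0_vec[OF xc yc] v by simp
  have Bneg: "DB 0 *\<^sub>v (- y) = - (DB 0 *\<^sub>v y)" by (rule mult_mat_vec_uminus[OF cone_DB(5) yc])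
  have eq: "DA 0 *\<^sub>v x = DB 0 *\<^sub>v (- y)" unfolding Bneg by (rule vec_add_eq_zero[OF c sum])
  have "(DA 0 *\<^sub>v x) $ 0 \<in> A" using cone_DA(9) x by blast
  moreover have "(DA 0 *\<^sub>v x) $ 0 \<in> B" unfolding eq using cone_DB(9) free_module_uminus[OF y] by blast
  ultimately obtain z where z: "z \<in> free_module R (bC 0)" "(DC 0 *\<^sub>v z) $ 0 = (DA 0 *\<^sub>v x) $ 0"
    using cone_DC(9) by force
  note zc = free_module_carrier[OF z(1)]
  have DCz: "DC 0 *\<^sub>v z \<in> carrier_vec 1" by (rule mult_mat_vec_carrier[OF cone_DC(5) zc])
  have z': "DC 0 *\<^sub>v z = DA 0 *\<^sub>v x"
    by (rule vec_1_eqI[OF DCz c(1) z(2)])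
  have "DA 0 *\<^sub>v x = DA 0 *\<^sub>v (\<Phi> 0 *\<^sub>v z)"
    unfolding assoc_mult_mat_vec[OF cone_DA(5) cone_\<Phi>c zc, symmetric] \<Phi>0 z' ..
  from free_resolution_solve[OF FA x ring.mats_mult_vec[OF \<Phi> z(1)] this]
  obtain x' where x': "x' \<in> free_module R (bA (Suc 0))" "DA (Suc 0) *\<^sub>v x' + \<Phi> 0 *\<^sub>v z = x" by blast
  have "DB 0 *\<^sub>v (\<Psi> 0 *\<^sub>v z) = - (DC 0 *\<^sub>v z)"
    unfolding assoc_mult_mat_vec[OF cone_DB(5) cone_\<Psi>c zc, symmetric] \<Psi>0
    using zc cone_DC(5) by simp
  also have "\<dots> = DB 0 *\<^sub>v y" unfolding z' eq Bneg by simp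
  finally have "DB 0 *\<^sub>v y = DB 0 *\<^sub>v (\<Psi> 0 *\<^sub>v z)" ..
  from free_resolution_solve[OF FB y ring.mats_mult_vec[OF \<Psi> z(1)] this]
  obtain y' where y': "y' \<in> free_module R (bB (Suc 0))" "DB (Suc 0) *\<^sub>v y' + \<Psi> 0 *\<^sub>v z = y" by blast
  show ?thesis
  proof (rule bexI)
    show "(x' @\<^sub>v y') @\<^sub>v z \<in> free_module R (b (Suc 0))"
      unfolding cone_rank_def nat.case by (intro ring.free_module_append x' y' z)
    show "E (Suc 0) *\<^sub>v ((x' @\<^sub>v y') @\<^sub>v z) = v"
      unfolding cone_mat_Suc_vec[OF free_module_carrier[OF x'(1)] free_module_carrier[OF y'(1)] zc] x'(2) y'(2) v
      by (simp add: append_vec_dim_zero)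
  qed
qed

text \<open>The component \<open>z\<close> of a cycle is a cycle of \<open>C\<close>, hence a
  boundary. Once it is bounded, the components in \<open>A\<close> and \<open>B\<close> become
  cycles up to the contribution of the bounding chain.\<close>

lemma cone_exact_Suc:
  assumes "v \<in> free_module R (b (Suc i))" "E (Suc i) *\<^sub>v v = 0\<^sub>v (b i)"
  shows "\<exists>w \<in> free_module R (b (Suc (Suc i))). E (Suc (Suc i)) *\<^sub>v w = v"
proof -
  from assms(1) obtain x y z where v: "v = (x @\<^sub>v y) @\<^sub>v z" and x: "x \<in> free_module R (bA (Suc i))"
    and y: "y \<in> free_module R (bB (Suc i))" and z: "z \<in> free_module R (bC i)"
    by (rule cone_split)
  note xc = free_module_carrier[OF x] and yc = free_module_carrier[OF y] and zc = free_module_carrier[OF z]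
  let ?p = "DA (Suc i) *\<^sub>v x + \<Phi> i *\<^sub>v z" and ?q = "DB (Suc i) *\<^sub>v y + \<Psi> i *\<^sub>v z"
  have c: "DA (Suc i) *\<^sub>v x \<in> carrier_vec (bA i)" "\<Phi> i *\<^sub>v z \<in> carrier_vec (bA i)"
    "DB (Suc i) *\<^sub>v y \<in> carrier_vec (bB i)" "\<Psi> i *\<^sub>v z \<in> carrier_vec (bB i)"
    by (rule mult_mat_vec_carrier[OF cone_DA(6) xc] mult_mat_vec_carrier[OF cone_\<Phi>c zc]
        mult_mat_vec_carrier[OF cone_DB(6) yc] mult_mat_vec_carrier[OF cone_\<Psi>c zc])+
  have DC'z: "DC' i *\<^sub>v z \<in> carrier_vec (bC' i)" by (rule mult_mat_vec_carrier[OF mats_carrier[OF cone_DC'] zc])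
  have "(?p @\<^sub>v ?q) @\<^sub>v - (DC' i *\<^sub>v z) = (0\<^sub>v (bA i) @\<^sub>v 0\<^sub>v (bB i)) @\<^sub>v 0\<^sub>v (bC' i)"
    using assms(2) unfolding v cone_mat_Suc_vec[OF xc yc zc] by (simp add: append_zero_vec cone_rank_def)
  moreover have "?p \<in> carrier_vec (bA i)" "?q \<in> carrier_vec (bB i)" using c by auto
  moreover from this have "?p @\<^sub>v ?q \<in> carrier_vec (bA i + bB i)" by auto
  ultimately have p: "?p = 0\<^sub>v (bA i)" and q: "?q = 0\<^sub>v (bB i)" and r: "- (DC' i *\<^sub>v z) = 0\<^sub>v (bC' i)"
    using append_vec_eq[of "?p @\<^sub>v ?q" "bA i + bB i" "0\<^sub>v (bA i) @\<^sub>v 0\<^sub>v (bB i)"]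
      append_vec_eq[of ?p "bA i" "0\<^sub>v (bA i)"] by auto
  \<comment> \<open>For \<open>i = 0\<close> the empty block under \<open>C\<close> gives no
    information on \<open>z\<close>; there the claim follows by applying the augmentation of
    \<open>A\<close> to the first component.\<close>
  have "DC i *\<^sub>v z = 0\<^sub>v (target_rank bC i)"
  proof (cases i)
    case 0
    have "DC 0 *\<^sub>v z = DA 0 *\<^sub>v (\<Phi> 0 *\<^sub>v z)"
      using zc 0 assoc_mult_mat_vec[OF cone_DA(5) cone_\<Phi>c] \<Phi>0 by metis
    moreover have "DA 0 *\<^sub>v (DA (Suc 0) *\<^sub>v x + \<Phi> 0 *\<^sub>v z) = 0\<^sub>v 1"
      using p 0 mult_mat_zero_vec[OF cone_DA(5)] by simp
    moreover have "DA 0 *\<^sub>v (DA (Suc 0) *\<^sub>v x + \<Phi> 0 *\<^sub>v z) = DA 0 *\<^sub>v (DA (Suc 0) *\<^sub>v x) + DA 0 *\<^sub>v (\<Phi> 0 *\<^sub>v z)"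
      using c 0 by (intro mult_add_distrib_mat_vec[OF cone_DA(5)]) auto
    moreover have "DA 0 *\<^sub>v (DA (Suc 0) *\<^sub>v x) = 0\<^sub>v 1"
      using free_resolution_vec_zero[OF FA, of x 0] xc 0 by simp
    moreover have "DA 0 *\<^sub>v (\<Phi> 0 *\<^sub>v z) \<in> carrier_vec 1"
      using mult_mat_vec_carrier[OF cone_DA(5)] c(2) 0 by simp
    ultimately show ?thesis using 0 by simp
  next
    case (Suc j)
    then show ?thesis using r DC'z uminus_zero_vec_eq[of "DC i *\<^sub>v z" "bC j"] by simp
  qed
  then obtain z' where z': "z' \<in> free_module R (bC (Suc i))" "DC (Suc i) *\<^sub>v z' = z"
    using cone_DC(8) z unfolding exact_on_def by blast
  \<comment> \<open>The cone negates the differential of \<open>C\<close>, so the chain bounding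
    \<open>z\<close> in the cone is \<open>- z'\<close>.\<close>
  have nz: "- z' \<in> free_module R (bC (Suc i))" by (rule free_module_uminus[OF z'(1)])
  note nzc = free_module_carrier[OF nz] and z'c = free_module_carrier[OF z'(1)]
  have half: "\<exists>x' \<in> free_module R (bX (Suc (Suc i))). D (Suc (Suc i)) *\<^sub>v x' + f (Suc i) *\<^sub>v (- z') = x"
    if F: "free_resolution R X bX D" and x: "x \<in> free_module R (bX (Suc i))"
      and f: "\<And>i. f i \<in> mats R (bX i) (bC i)" and fS: "\<And>i. D (Suc i) * f (Suc i) = f i * DC (Suc i)"
      and p: "D (Suc i) *\<^sub>v x + f i *\<^sub>v z = 0\<^sub>v (bX i)"
    for X bX D f x
  proof (rule free_resolution_solve[OF F x ring.mats_mult_vec[OF f nz]])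
    note D = free_resolutionD[OF F] and fc = mats_carrier[OF f]
    have c: "D (Suc i) *\<^sub>v x \<in> carrier_vec (bX i)" "f i *\<^sub>v z \<in> carrier_vec (bX i)"
      by (rule mult_mat_vec_carrier[OF D(6) free_module_carrier[OF x]] mult_mat_vec_carrier[OF fc zc])+
    have "D (Suc i) *\<^sub>v (f (Suc i) *\<^sub>v (- z')) = f i *\<^sub>v (DC (Suc i) *\<^sub>v (- z'))"
      by (rule mat_eq_imp_mult_vec_eq[OF fS D(6) fc fc cone_DC(6) nzc])
    also have "\<dots> = - (f i *\<^sub>v z)"
      unfolding mult_mat_vec_uminus[OF cone_DC(6) z'c] z'(2) by (rule mult_mat_vec_uminus[OF fc zc])
    also have "\<dots> = D (Suc i) *\<^sub>v x" by (rule vec_add_eq_zero[OF c p, symmetric])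
    finally show "D (Suc i) *\<^sub>v x = D (Suc i) *\<^sub>v (f (Suc i) *\<^sub>v (- z'))" ..
  qed
  from half[OF FA x \<Phi> \<Phi>S p] obtain x' where
    x': "x' \<in> free_module R (bA (Suc (Suc i)))" "DA (Suc (Suc i)) *\<^sub>v x' + \<Phi> (Suc i) *\<^sub>v (- z') = x" by blast
  from half[OF FB y \<Psi> \<Psi>S q] obtain y' where
    y': "y' \<in> free_module R (bB (Suc (Suc i)))" "DB (Suc (Suc i)) *\<^sub>v y' + \<Psi> (Suc i) *\<^sub>v (- z') = y" by blast
  show ?thesis
  proof (rule bexI)
    show "(x' @\<^sub>v y') @\<^sub>v (- z') \<in> free_module R (b (Suc (Suc i)))"
      unfolding cone_rank_def nat.case by (intro ring.free_module_append x' y' nz)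
    have "- (DC (Suc i) *\<^sub>v (- z')) = z"
      unfolding mult_mat_vec_uminus[OF cone_DC(6) z'c] z'(2) by simp
    then show "E (Suc (Suc i)) *\<^sub>v ((x' @\<^sub>v y') @\<^sub>v (- z')) = v"
      unfolding cone_mat_Suc_vec[OF free_module_carrier[OF x'(1)] free_module_carrier[OF y'(1)] nzc] x'(2) y'(2) v
      by simp
  qed
qed

text \<open>The cone realizes the short exact sequence of \<open>A \<inter> B\<close>,
  \<open>A \<oplus> B\<close> and \<open>A + B\<close> on the level of resolutions.\<close>

theorem cone_free_resolution:
  "free_resolution R {x + y | x y. x \<in> A \<and> y \<in> B} b E"
proof -
  have img: "{(E 0 *\<^sub>v v) $ 0 | v. v \<in> free_module R (b 0)} = {x + y | x y. x \<in> A \<and> y \<in> B}" (is "?L = ?R")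
  proof -
    have val: "(E 0 *\<^sub>v (x @\<^sub>v y)) $ 0 = (DA 0 *\<^sub>v x) $ 0 + (DB 0 *\<^sub>v y) $ 0"
      if "x \<in> free_module R (bA 0)" "y \<in> free_module R (bB 0)" for x y
      using that cone_DA(5) cone_DB(5) by (simp add: cone_mat_0_vec free_module_carrier)
    show ?thesis
    proof (intro equalityI subsetI)
      fix a assume "a \<in> ?L"
      then obtain x y where "x \<in> free_module R (bA 0)" "y \<in> free_module R (bB 0)" "a = (E 0 *\<^sub>v (x @\<^sub>v y)) $ 0"
        unfolding cone_rank_def nat.case add_0_right by (smt (verit) free_module_split mem_Collect_eq)
      then show "a \<in> ?R" using val cone_DA(9) cone_DB(9) by blast
    next
      fix a assume "a \<in> ?R"
      then obtain p q where "a = p + q" "p \<in> A" "q \<in> B" by blast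
      then obtain x y where xy: "x \<in> free_module R (bA 0)" "y \<in> free_module R (bB 0)"
        "a = (DA 0 *\<^sub>v x) $ 0 + (DB 0 *\<^sub>v y) $ 0"
        unfolding cone_DA(9)[symmetric] cone_DB(9)[symmetric] by blast
      then have "a = (E 0 *\<^sub>v (x @\<^sub>v y)) $ 0" using val by simp
      moreover have "x @\<^sub>v y \<in> free_module R (b 0)"
        using xy by (simp add: cone_rank_def ring.free_module_append)
      ultimately show "a \<in> ?L" by blast
    qed
  qed
  have exact: "{v \<in> free_module R (b i). E i *\<^sub>v v = 0\<^sub>v (dim_row (E i))} =
      {E (Suc i) *\<^sub>v w | w. w \<in> free_module R (b (Suc i))}" for i
  proof (cases i)
    case 0
    then show ?thesis
      using cone_complex_aug cone_exact_aug ring.mats_mult_vec[OF cone_mat_Suc] mats_carrier[OF cone_mat_0]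
      by fastforce
  next
    case (Suc j)
    then show ?thesis
      using cone_complex_Suc cone_exact_Suc ring.mats_mult_vec[OF cone_mat_Suc] mats_carrier[OF cone_mat_Suc[of j]]
      by fastforce
  qed
  have "elements_mat (E i) \<subseteq> R" for i
    using cone_mat_0 cone_mat_Suc elements_mat_subset_iff[OF mats_carrier[OF cone_mat_0]]
      elements_mat_subset_iff[OF mats_carrier[OF cone_mat_Suc]] by (cases i) auto
  then show ?thesis
    unfolding free_resolution_def
    using mats_carrier[OF cone_mat_0] mats_carrier[OF cone_mat_Suc] img exact by blast
qed

end

end

text \<open>Once \<open>\<Phi>\<close> and \<open>\<Psi>\<close> vanish modulo the variables, the
  cone differential is block diagonal. The empty block under \<open>C\<close> in degree 0 is
  \<open>residue_diff bC DC 0\<close>, so all degrees have the same form.\<close>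

lemma residue_diff_cone:
  fixes DA DB DC \<Phi> \<Psi> :: "nat \<Rightarrow> ('v, 'k::field) mpoly mat"
  assumes DA: "\<And>i. DA (Suc i) \<in> carrier_mat (bA i) (bA (Suc i))"
    and DB: "\<And>i. DB (Suc i) \<in> carrier_mat (bB i) (bB (Suc i))"
    and DC: "\<And>i. DC (Suc i) \<in> carrier_mat (bC i) (bC (Suc i))"
    and \<Phi>: "\<And>i. \<Phi> i \<in> carrier_mat (bA i) (bC i)" "\<And>i. residue_mat (\<Phi> i) = 0\<^sub>m (bA i) (bC i)"
    and \<Psi>: "\<And>i. \<Psi> i \<in> carrier_mat (bB i) (bC i)" "\<And>i. residue_mat (\<Psi> i) = 0\<^sub>m (bB i) (bC i)"
  shows "residue_diff (cone_rank bA bB bC) (cone_mat bA DA bB DB bC DC \<Phi> \<Psi>) (Suc i) =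
    four_block_mat
      (four_block_mat (residue_diff bA DA (Suc i)) (0\<^sub>m (bA i) (bB (Suc i)))
        (0\<^sub>m (bB i) (bA (Suc i))) (residue_diff bB DB (Suc i)))
      (0\<^sub>m (bA i + bB i) (bC i))
      (0\<^sub>m (case i of 0 \<Rightarrow> 0 | Suc j \<Rightarrow> bC j) (bA (Suc i) + bB (Suc i)))
      (- residue_diff bC DC i)"
proof -
  let ?G = "four_block_mat (DA (Suc i)) (0\<^sub>m (bA i) (bB (Suc i))) (0\<^sub>m (bB i) (bA (Suc i))) (DB (Suc i))"
  let ?C = "case i of 0 \<Rightarrow> 0\<^sub>m 0 (bC 0) | Suc j \<Rightarrow> DC (Suc j)"
  have G: "?G \<in> carrier_mat (bA i + bB i) (bA (Suc i) + bB (Suc i))"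
    by (rule four_block_carrier_mat[OF DA DB])
  have X: "\<Phi> i @\<^sub>r \<Psi> i \<in> carrier_mat (bA i + bB i) (bC i)"
    by (rule carrier_append_rows[OF \<Phi>(1) \<Psi>(1)])
  have C: "?C \<in> carrier_mat (case i of 0 \<Rightarrow> 0 | Suc j \<Rightarrow> bC j) (bC i)"
    using DC by (cases i) auto
  have rC: "residue_mat ?C = residue_diff bC DC i"
    by (cases i) (auto simp: residue_diff_def residue_mat_zero)
  have rX: "residue_mat (\<Phi> i @\<^sub>r \<Psi> i) = 0\<^sub>m (bA i + bB i) (bC i)"
  proof -
    have "residue_mat (\<Phi> i @\<^sub>r \<Psi> i) = residue_mat (\<Phi> i) @\<^sub>r residue_mat (\<Psi> i)"
      unfolding append_rows_def
      by (subst map_four_block_mat[OF \<Phi>(1) _ \<Psi>(1)]) (use \<Phi>(1)[of i] \<Psi>(1)[of i] in \<open>auto simp: residue_mat_zero\<close>)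
    also have "\<dots> = 0\<^sub>m (bA i + bB i) (bC i)"
      unfolding \<Phi>(2) \<Psi>(2) append_rows_def by (rule eq_matI) auto
    finally show ?thesis .
  qed
  have rG: "residue_mat ?G = four_block_mat (residue_diff bA DA (Suc i)) (0\<^sub>m (bA i) (bB (Suc i)))
        (0\<^sub>m (bB i) (bA (Suc i))) (residue_diff bB DB (Suc i))"
    unfolding map_four_block_mat[OF DA zero_carrier_mat zero_carrier_mat DB]
    by (simp add: residue_mat_zero residue_diff_def)
  have "residue_diff (cone_rank bA bB bC) (cone_mat bA DA bB DB bC DC \<Phi> \<Psi>) (Suc i) =
     residue_mat (four_block_mat ?G (\<Phi> i @\<^sub>r \<Psi> i)
      (0\<^sub>m (case i of 0 \<Rightarrow> 0 | Suc j \<Rightarrow> bC j) (bA (Suc i) + bB (Suc i))) (- ?C))"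
    by (simp add: residue_diff_def cone_mat_def)
  then show ?thesis
    unfolding map_four_block_mat[OF G X zero_carrier_mat uminus_carrier_mat[OF C]]
      rG rX residue_mat_uminus rC residue_mat_zero .
qed

text \<open>The connecting maps vanish modulo the variables, so the long exact sequence of Tor splits.\<close>

theorem residue_homology_dim_cone:
  fixes DA DB DC \<Phi> \<Psi> :: "nat \<Rightarrow> ('v, 'k::field) mpoly mat"
  assumes R: "subring_set R"
    and FA: "free_resolution R A bA DA" and FB: "free_resolution R B bB DB"
    and FC: "free_resolution R C bC DC"
    and \<Phi>: "\<And>i. \<Phi> i \<in> carrier_mat (bA i) (bC i)" "\<And>i. residue_mat (\<Phi> i) = 0\<^sub>m (bA i) (bC i)"
    and \<Psi>: "\<And>i. \<Psi> i \<in> carrier_mat (bB i) (bC i)" "\<And>i. residue_mat (\<Psi> i) = 0\<^sub>m (bB i) (bC i)"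
  shows "residue_homology_dim (cone_rank bA bB bC) (cone_mat bA DA bB DB bC DC \<Phi> \<Psi>) i =
    residue_homology_dim bA DA i + residue_homology_dim bB DB i +
    (case i of 0 \<Rightarrow> 0 | Suc j \<Rightarrow> residue_homology_dim bC DC j)"
proof -
  interpret subring_set R by (rule R)
  note DA = free_resolutionD(6)[OF FA] and DB = free_resolutionD(6)[OF FB] and DC = free_resolutionD(6)[OF FC]
  let ?b = "cone_rank bA bB bC" and ?E = "cone_mat bA DA bB DB bC DC \<Phi> \<Psi>"
  let ?rk = "\<lambda>b (D :: nat \<Rightarrow> ('v, 'k) mpoly mat) i. vec_space.rank (b i) (residue_diff b D (Suc i))"
  let ?kd = "\<lambda>b (D :: nat \<Rightarrow> ('v, 'k) mpoly mat) i. kernel_dim (residue_diff b D i)"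
  note diff = residue_diff_cone[where DA = DA and DB = DB and DC = DC and \<Phi> = \<Phi> and \<Psi> = \<Psi>
      and bA = bA and bB = bB and bC = bC, OF DA DB DC \<Phi> \<Psi>]
  have rc: "residue_diff b D (Suc i) \<in> carrier_mat (b i) (b (Suc i))"
    if "D (Suc i) \<in> carrier_mat (b i) (b (Suc i))" for b i and D :: "nat \<Rightarrow> ('v, 'k) mpoly mat"
    using that by (simp add: residue_diff_def)
  have rC: "residue_diff bC DC i \<in> carrier_mat (case i of 0 \<Rightarrow> 0 | Suc j \<Rightarrow> bC j) (bC i)" for i
    using rc[where D = DC and b = bC, OF DC] by (cases i) (auto simp: residue_diff_def)
  have G: "four_block_mat (residue_diff bA DA (Suc i)) (0\<^sub>m (bA i) (bB (Suc i)))
        (0\<^sub>m (bB i) (bA (Suc i))) (residue_diff bB DB (Suc i)) \<in> carrier_mat (bA i + bB i) (bA (Suc i) + bB (Suc i))" for i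
    by (rule four_block_carrier_mat[OF rc[where D = DA and b = bA, OF DA] rc[where D = DB and b = bB, OF DB]])
  have nC: "- residue_diff bC DC i \<in> carrier_mat (case i of 0 \<Rightarrow> 0 | Suc j \<Rightarrow> bC j) (bC i)" for i
    using rC by simp
  have zero_kd: "?kd b D 0 = b 0" for b and D :: "nat \<Rightarrow> ('v, 'k) mpoly mat"
    using kernel_dim_eq_vdim[of "0\<^sub>m 0 (b 0) :: 'k mat" 0 "b 0"] vdim_carrier[of "b 0", where ?'k = 'k]
    by (simp add: residue_diff_def zero_mat_mult_vec cong: conj_cong)
  have kd: "?kd ?b ?E i = ?kd bA DA i + ?kd bB DB i + (case i of 0 \<Rightarrow> 0 | Suc j \<Rightarrow> ?kd bC DC j)"
  proof (cases i)
    case 0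
    then show ?thesis by (simp add: zero_kd cone_rank_def)
  next
    case (Suc j)
    have "?kd ?b ?E (Suc j) = ?kd bA DA (Suc j) + ?kd bB DB (Suc j) + ?kd bC DC j"
      unfolding diff kernel_dim_four_block_diag[OF G nC] kernel_dim_uminus[OF rC]
        kernel_dim_four_block_diag[OF rc[where D = DA and b = bA, OF DA] rc[where D = DB and b = bB, OF DB]] ..
    then show ?thesis using Suc by simp
  qed
  have rk: "?rk ?b ?E i = ?rk bA DA i + ?rk bB DB i + (case i of 0 \<Rightarrow> 0 | Suc j \<Rightarrow> ?rk bC DC j)"
  proof -
    have "?rk ?b ?E i = ?rk bA DA i + ?rk bB DB i
        + vec_space.rank (case i of 0 \<Rightarrow> 0 | Suc j \<Rightarrow> bC j) (residue_diff bC DC i)"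
      unfolding diff cone_rank_def rank_four_block_diag[OF G nC] rank_uminus[OF rC]
        rank_four_block_diag[OF rc[where D = DA and b = bA, OF DA] rc[where D = DB and b = bB, OF DB]] ..
    \<comment> \<open>The lowest copy of \<open>C\<close> maps to the zero space: its kernel has the
      full dimension \<open>bC 0\<close>, and rank-nullity leaves rank 0.\<close>
    moreover have "vec_space.rank 0 (residue_diff bC DC 0) = 0"
      using rank_nullity[OF rC[of 0]] zero_kd[of bC DC] by simp
    ultimately show ?thesis by (cases i) simp_all
  qed
  \<comment> \<open>Homology dimensions are truncated differences, and these add up only if no rank
    exceeds the corresponding kernel dimension.\<close>
  have le: "?rk b D i \<le> ?kd b D i" if F: "free_resolution R I b D" for b i I and D :: "nat \<Rightarrow> ('v, 'k) mpoly mat"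
  proof -
    note D = free_resolutionD[OF F]
    have DD: "D (Suc i) * D (Suc (Suc i)) = 0\<^sub>m (b i) (b (Suc (Suc i)))" for i
      using D(7)[of "Suc i"] by simp
    show ?thesis
      unfolding rank_residue_diff[where D = D and b = b, OF D(6)] kernel_dim_residue_diff[where D = D and b = b, OF D(6)]
      by (rule vdim_mono[OF vsubspace_res_boundaries vsubspace_res_cycles res_boundaries_cycles]) (rule D(6) DD)+
  qed
  show ?thesis
    unfolding residue_homology_dim_def kd rk
    using le[OF FA, of i] le[OF FB, of i] le[OF FC] by (cases i) (simp_all add: diff_add_eq le_add_diff)
qed

section \<open>Monomial ideals\<close>

text \<open>With an arbitrary exponent set \<open>U\<close>, sums and intersections of monomial
  ideals become unions and intersections of sets, and one \<open>U\<close> describes the extensions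
  of an ideal to all rings \<open>polys V\<close> at once.\<close>

definition mono_ideal :: "'v set \<Rightarrow> ('v \<Rightarrow>\<^sub>0 nat) set \<Rightarrow> ('v, 'k::zero) mpoly set" where
  "mono_ideal V U = {f \<in> polys V. Poly_Mapping.keys f \<subseteq> U}"

definition multiples :: "('v \<Rightarrow>\<^sub>0 nat) set \<Rightarrow> ('v \<Rightarrow>\<^sub>0 nat) set" where
  "multiples A = {a + c | a c. a \<in> A}"

abbreviation monomial :: "('v \<Rightarrow>\<^sub>0 nat) \<Rightarrow> ('v, 'k::comm_ring_1) mpoly" where
  "monomial a \<equiv> Poly_Mapping.single a 1"

lemma mono_ideal_UNIV: "mono_ideal V UNIV = polys V"
  by (simp add: mono_ideal_def)

lemma polys_UNIV: "polys UNIV = UNIV"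
  by (simp add: polys_def)

lemma polys_mono: "V \<subseteq> V' \<Longrightarrow> polys V \<subseteq> polys V'"
  by (auto simp: polys_def)

lemma mono_ideal_Int: "mono_ideal V (U \<inter> U') = mono_ideal V U \<inter> mono_ideal V U'"
  by (auto simp: mono_ideal_def)

text \<open>Membership is decided term by term, so a polynomial splits into its terms in
  \<open>U\<close> and the rest.\<close>

lemma mono_ideal_Un:
  "mono_ideal V (U \<union> U') = {f + g | f g. f \<in> mono_ideal V U \<and> g \<in> (mono_ideal V U' :: ('v, 'k::comm_ring_1) mpoly set)}"
proof (intro equalityI subsetI)
  fix f :: "('v, 'k) mpoly" assume f: "f \<in> mono_ideal V (U \<union> U')"
  have "f = keep_terms U f + keep_terms (- U) f"
    by (rule poly_mapping_eqI) (simp add: lookup_add lookup_keep_terms)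
  moreover have "keep_terms U f \<in> mono_ideal V U" "keep_terms (- U) f \<in> mono_ideal V U'"
    using f by (auto simp: mono_ideal_def polys_def keys_keep_terms)
  ultimately show "f \<in> {f + g | f g. f \<in> mono_ideal V U \<and> g \<in> mono_ideal V U'}" by blast
next
  fix h :: "('v, 'k) mpoly" assume "h \<in> {f + g | f g. f \<in> mono_ideal V U \<and> g \<in> mono_ideal V U'}"
  then obtain f g where h: "h = f + g" "f \<in> mono_ideal V U" "g \<in> mono_ideal V U'" by blast
  interpret subring_set "polys V :: ('v, 'k) mpoly set" by (rule subring_polys)
  from h show "h \<in> mono_ideal V (U \<union> U')"
    using keys_add[of f g] add[of f g] by (auto simp: mono_ideal_def)
qed

lemma lookup_mono_mult:
  fixes f :: "('v, 'k::comm_ring_1) mpoly"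
  shows "Poly_Mapping.lookup (monomial a * f) (a + m) = Poly_Mapping.lookup f m"
proof (induction f rule: poly_mapping_additive_induct)
  case (single b c)
  then show ?case by (simp add: mult_single lookup_single when_def)
qed (simp_all add: distrib_left lookup_add)

lemma keys_mono_mult:
  "Poly_Mapping.keys (monomial a * f) = (+) a ` Poly_Mapping.keys (f :: ('v, 'k::comm_ring_1) mpoly)"
proof -
  have "\<exists>k. m = a + k" if "m \<in> Poly_Mapping.keys (monomial a * f)" for m
    using keys_times_subset[OF that] by (auto split: if_splits)
  then show ?thesis by (fastforce simp: in_keys_iff lookup_mono_mult image_iff)
qed

lemma mono_mult_eq_0: "monomial a * f = 0 \<Longrightarrow> f = (0 :: ('v, 'k::comm_ring_1) mpoly)"
  using keys_mono_mult[of a f] by (metis image_is_empty keys_eq_empty)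

lemma mono_mult_ideal:
  assumes a: "Poly_Mapping.keys a \<subseteq> V"
  shows "{monomial a * f | f. f \<in> mono_ideal V U} = (mono_ideal V ((+) a ` U) :: ('v, 'k::comm_ring_1) mpoly set)"
proof (intro equalityI subsetI)
  fix g :: "('v, 'k) mpoly" assume "g \<in> {monomial a * f | f. f \<in> mono_ideal V U}"
  then obtain f :: "('v, 'k) mpoly" where "g = monomial a * f" "f \<in> mono_ideal V U" by blast
  then show "g \<in> mono_ideal V ((+) a ` U)"
    using a by (auto simp: mono_ideal_def polys_def keys_mono_mult keys_add_nat)
next
  fix g :: "('v, 'k) mpoly" assume g: "g \<in> mono_ideal V ((+) a ` U)"
  have inj: "inj ((+) a)" by (simp add: inj_def)
  \<comment> \<open>Reindexing the coefficients of \<open>g\<close> along the injective shift by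
    \<open>a\<close> is division by the monomial with exponent \<open>a\<close>.\<close>
  define f where "f = Poly_Mapping.map_key ((+) a) g"
  have f: "Poly_Mapping.lookup f m = Poly_Mapping.lookup g (a + m)" for m
    unfolding f_def by (simp add: map_key.rep_eq[OF inj])
  have "monomial a * f = g"
  proof (rule poly_mapping_eqI)
    fix m
    show "Poly_Mapping.lookup (monomial a * f) m = Poly_Mapping.lookup g m"
    proof (cases "m \<in> range ((+) a)")
      case True
      then show ?thesis using f by (auto simp: lookup_mono_mult)
    next
      case False
      then have "m \<notin> Poly_Mapping.keys (monomial a * f)" "m \<notin> Poly_Mapping.keys g"
        using g by (auto simp: keys_mono_mult mono_ideal_def)
      then show ?thesis by (simp add: in_keys_iff)
    qed
  qed
  moreover have "f \<in> mono_ideal V U"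
  proof -
    have "a + m \<in> Poly_Mapping.keys g" if "m \<in> Poly_Mapping.keys f" for m
      using that by (simp add: in_keys_iff f)
    moreover have "Poly_Mapping.keys m \<subseteq> Poly_Mapping.keys (a + m)" for m
      by (simp add: keys_add_nat)
    ultimately show ?thesis using g unfolding mono_ideal_def polys_def by fastforce
  qed
  ultimately show "g \<in> {monomial a * f | f. f \<in> mono_ideal V U}" by blast
qed

lemma multiples_insert: "multiples (insert a A) = multiples A \<union> (+) a ` UNIV"
  by (auto simp: multiples_def)

text \<open>Subtraction of exponents is truncated, so \<open>a + (b - a)\<close> is the pointwise
  maximum of \<open>a\<close> and \<open>b\<close>, the exponent of their least common
  multiple.\<close>

lemma multiples_Int_principal: "multiples A \<inter> (+) a ` UNIV = multiples ((\<lambda>b. a + (b - a)) ` A)"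
proof (intro equalityI subsetI)
  fix m assume "m \<in> multiples A \<inter> (+) a ` UNIV"
  then obtain b c c' where m: "b \<in> A" "m = b + c" "m = a + c'" by (auto simp: multiples_def)
  have "m = (a + (b - a)) + (m - (a + (b - a)))"
  proof (rule poly_mapping_eqI)
    fix v
    have "Poly_Mapping.lookup m v = Poly_Mapping.lookup b v + Poly_Mapping.lookup c v"
      "Poly_Mapping.lookup m v = Poly_Mapping.lookup a v + Poly_Mapping.lookup c' v"
      using m(2,3) lookup_add by metis+
    then show "Poly_Mapping.lookup m v = Poly_Mapping.lookup (a + (b - a) + (m - (a + (b - a)))) v"
      by (simp add: lookup_add lookup_minus)
  qed
  then show "m \<in> multiples ((\<lambda>b. a + (b - a)) ` A)" using m(1) unfolding multiples_def by blast
next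
  fix m assume "m \<in> multiples ((\<lambda>b. a + (b - a)) ` A)"
  then obtain b c where m: "b \<in> A" "m = a + (b - a) + c" by (auto simp: multiples_def)
  have "m = b + ((a - b) + c)"
    unfolding m(2) by (rule poly_mapping_eqI) (simp add: lookup_add lookup_minus)
  moreover have "m = a + ((b - a) + c)" using m(2) by (simp add: add.assoc)
  ultimately show "m \<in> multiples A \<inter> (+) a ` UNIV"
    using m(1) unfolding multiples_def by blast
qed

lemma poly_ring_ideal:
  "ideal (mono_ideal V (multiples A)) (poly_ring V :: ('v, 'k::comm_ring_1) mpoly ring)" (is ?thesis1)
  and ring_poly_ring: "ring (poly_ring V :: ('v, 'k::comm_ring_1) mpoly ring)" (is ?thesis2)
proof -
  interpret P: subring_set "polys V :: ('v, 'k) mpoly set" by (rule subring_polys)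
  show ring: ?thesis2
  proof (rule ringI)
    show "abelian_group (poly_ring V :: ('v, 'k) mpoly ring)"
    proof (rule abelian_groupI)
      show "\<exists>y\<in>carrier (poly_ring V :: ('v, 'k) mpoly ring). y \<oplus>\<^bsub>poly_ring V\<^esub> x = \<zero>\<^bsub>poly_ring V\<^esub>"
        if "x \<in> carrier (poly_ring V :: ('v, 'k) mpoly ring)" for x
        using that P.uminus[of x] by (intro bexI[of _ "- x"]) auto
    qed (auto simp: P.add P.zero ac_simps)
    show "Group.monoid (poly_ring V :: ('v, 'k) mpoly ring)"
      by (rule monoidI) (auto simp: P.mult P.one mult.assoc)
  qed (auto simp: distrib_left distrib_right)
  show ?thesis1
  proof (rule idealI[OF ring])
    let ?I = "mono_ideal V (multiples A) :: ('v, 'k) mpoly set"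
    have up: "m + m' \<in> multiples A" if "m \<in> multiples A" for m m'
      using that unfolding multiples_def by (clarsimp simp: add.assoc) blast
    show "subgroup ?I (add_monoid (poly_ring V))"
    proof
      show "inv\<^bsub>add_monoid (poly_ring V)\<^esub> x \<in> ?I" if "x \<in> ?I" for x
      proof -
        have "x \<in> polys V" "- x \<in> ?I" using that P.uminus by (auto simp: mono_ideal_def)
        moreover have "inv\<^bsub>add_monoid (poly_ring V)\<^esub> x = - x"
          using \<open>x \<in> polys V\<close> P.uminus
          by (intro group.inv_equality abelian_group.a_group ring.is_abelian_group ring) auto
        ultimately show ?thesis by simp
      qed
      show "x \<otimes>\<^bsub>add_monoid (poly_ring V)\<^esub> y \<in> ?I" if "x \<in> ?I" "y \<in> ?I" for x y
        using that P.add[of x y] keys_add[of x y] by (auto simp: mono_ideal_def)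
    qed (auto simp: mono_ideal_def P.zero)
    show *: "x \<otimes>\<^bsub>poly_ring V\<^esub> f \<in> ?I" if "f \<in> ?I" "x \<in> carrier (poly_ring V)" for f x
    proof -
      have "m \<in> multiples A" if m: "m \<in> Poly_Mapping.keys (x * f)" for m
      proof -
        obtain k l where "m = k + l" "l \<in> Poly_Mapping.keys f" using keys_times_subset[OF m] by blast
        then show ?thesis using up[of l k] \<open>f \<in> ?I\<close> by (auto simp: mono_ideal_def add.commute)
      qed
      then show ?thesis using that P.mult[of x f] by (auto simp: mono_ideal_def)
    qed
    show "f \<otimes>\<^bsub>poly_ring V\<^esub> x \<in> ?I" if "f \<in> ?I" "x \<in> carrier (poly_ring V)" for f x
      using *[OF that] by (simp add: mult.commute)
  qed
qed

text \<open>Each term of \<open>f\<close> is a generator times a term whose exponent still lies in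
  \<open>V\<close>, so the terms, and hence their sum, belong to every ideal containing the
  generators.\<close>

lemma genideal_mono:
  assumes A: "\<And>a. a \<in> A \<Longrightarrow> Poly_Mapping.keys a \<subseteq> V"
  shows "genideal (poly_ring V) (monomial ` A) = (mono_ideal V (multiples A) :: ('v, 'k::comm_ring_1) mpoly set)"
proof (intro equalityI subsetI)
  interpret ring "poly_ring V :: ('v, 'k) mpoly ring" by (rule ring_poly_ring)
  have sub: "monomial ` A \<subseteq> (mono_ideal V (multiples A) :: ('v, 'k) mpoly set)"
  proof
    fix f :: "('v, 'k) mpoly" assume "f \<in> monomial ` A"
    then obtain a where a: "a \<in> A" "f = monomial a" by blast
    then have "a \<in> multiples A" unfolding multiples_def by (intro CollectI exI[of _ a] exI[of _ 0]) simp
    then show "f \<in> mono_ideal V (multiples A)" using a A[OF a(1)] by (auto simp: mono_ideal_def polys_def)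
  qed
  show "f \<in> mono_ideal V (multiples A)" if "f \<in> genideal (poly_ring V) (monomial ` A)" for f :: "('v, 'k) mpoly"
    using genideal_minimal[OF poly_ring_ideal sub] that by blast
  have carr: "monomial ` A \<subseteq> carrier (poly_ring V :: ('v, 'k) mpoly ring)"
    using A by (fastforce simp: polys_def)
  interpret J: ideal "genideal (poly_ring V) (monomial ` A)" "poly_ring V :: ('v, 'k) mpoly ring"
    by (rule genideal_ideal[OF carr])
  have gen: "monomial ` A \<subseteq> genideal (poly_ring V) (monomial ` A :: ('v, 'k) mpoly set)"
    by (rule genideal_self[OF carr])
  fix f :: "('v, 'k) mpoly" assume f: "f \<in> mono_ideal V (multiples A)"
  have coeff: "Poly_Mapping.single m (Poly_Mapping.lookup f m) \<in> genideal (poly_ring V) (monomial ` A)"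
    if m: "m \<in> Poly_Mapping.keys f" for m
  proof -
    from f m obtain a c where ac: "a \<in> A" "m = a + c" by (auto simp: mono_ideal_def multiples_def)
    have "Poly_Mapping.keys m \<subseteq> V" using f m by (auto simp: mono_ideal_def polys_def)
    then have "Poly_Mapping.single c (Poly_Mapping.lookup f m) \<in> carrier (poly_ring V)"
      unfolding ac(2) keys_add_nat by (auto simp: polys_def)
    moreover have "monomial a \<in> genideal (poly_ring V) (monomial ` A :: ('v, 'k) mpoly set)" using gen ac by blast
    ultimately have "monomial a * Poly_Mapping.single c (Poly_Mapping.lookup f m) \<in> genideal (poly_ring V) (monomial ` A)"
      using J.I_r_closed[of "monomial a" "Poly_Mapping.single c (Poly_Mapping.lookup f m)"] by simp
    then show ?thesis unfolding ac(2) by (simp add: mult_single)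
  qed
  have "(\<Sum>m\<in>K. Poly_Mapping.single m (Poly_Mapping.lookup f m)) \<in> genideal (poly_ring V) (monomial ` A)"
    if "K \<subseteq> Poly_Mapping.keys f" for K
    using finite_subset[OF that finite_keys] that
  proof (induction K rule: finite_induct)
    case empty
    then show ?case using J.zero_closed by simp
  next
    case (insert m K)
    then show ?case using J.a_closed[OF coeff[of m] insert.IH] by simp
  qed
  from this[OF order_refl] show "f \<in> genideal (poly_ring V) (monomial ` A)"
    by (simp flip: poly_mapping_sum_single)
qed


section \<open>Resolutions of monomial ideals\<close>

text \<open>For a nonzerodivisor \<open>g\<close> the ideals \<open>I\<close> and \<open>g I\<close>
  are isomorphic modules, and only the embedding into the ring changes. Resolutions therefore differ
  in the augmentation alone.\<close>

definition scale_augmentation :: "'r::comm_ring_1 \<Rightarrow> (nat \<Rightarrow> 'r mat) \<Rightarrow> nat \<Rightarrow> 'r mat" where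
  "scale_augmentation g D i = (if i = 0 then g \<cdot>\<^sub>m D 0 else D i)"

lemma smult_mat_mult_vec:
  "A \<in> carrier_mat m n \<Longrightarrow> v \<in> carrier_vec n \<Longrightarrow> (c \<cdot>\<^sub>m A) *\<^sub>v v = c \<cdot>\<^sub>v (A *\<^sub>v (v :: 'r::comm_ring_1 vec))"
  by (rule eq_vecI) (auto simp: scalar_prod_def sum_distrib_left mult.assoc)

context subring_set
begin

lemma scale_free_resolution:
  assumes F: "free_resolution R I b D" and g: "g \<in> R" and nz: "\<And>f. g * f = 0 \<Longrightarrow> f = 0"
  shows "free_resolution R {g * f | f. f \<in> I} b (scale_augmentation g D)"
proof -
  note D = free_resolutionD[OF F]
  let ?S = "scale_augmentation g D"
  have S0: "?S 0 = g \<cdot>\<^sub>m D 0" and SS: "?S (Suc i) = D (Suc i)" for i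
    by (simp_all add: scale_augmentation_def)
  have S0v: "?S 0 *\<^sub>v v = g \<cdot>\<^sub>v (D 0 *\<^sub>v v)" if "v \<in> carrier_vec (b 0)" for v
    unfolding S0 by (rule smult_mat_mult_vec[OF D(5) that])
  have "?S i \<in> mats R (target_rank b i) (b i)" for i
    using D(2,3) g mult by (cases i) (auto simp: S0 SS mats_def)
  moreover have "?S i * ?S (Suc i) = 0\<^sub>m (target_rank b i) (b (Suc i))" for i
  proof (cases i)
    case 0
    have "g \<cdot>\<^sub>m D 0 * D (Suc 0) = g \<cdot>\<^sub>m (D 0 * D (Suc 0))"
      by (rule mult_smult_assoc_mat[OF D(5) D(6)])
    then show ?thesis unfolding 0 S0 SS D(7) by (auto intro: eq_matI)
  next
    case (Suc j)
    then show ?thesis unfolding Suc SS using D(7) by blast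
  qed
  moreover have "exact_on R b ?S"
    unfolding exact_on_def
  proof (intro allI ballI impI)
    fix i v assume v: "v \<in> free_module R (b i)" and 0: "?S i *\<^sub>v v = 0\<^sub>v (target_rank b i)"
    have "D i *\<^sub>v v = 0\<^sub>v (target_rank b i)"
    proof (cases i)
      case 0
      have vc: "v \<in> carrier_vec (b 0)" using v 0 by (simp add: free_module_iff)
      have c: "D 0 *\<^sub>v v \<in> carrier_vec 1" by (rule mult_mat_vec_carrier[OF D(5) vc])
      have "g * (D 0 *\<^sub>v v) $ 0 = (g \<cdot>\<^sub>v (D 0 *\<^sub>v v)) $ 0"
        using D(5) by simp
      also have "g \<cdot>\<^sub>v (D 0 *\<^sub>v v) = 0\<^sub>v 1"
        using \<open>?S i *\<^sub>v v = 0\<^sub>v (target_rank b i)\<close> S0v[OF vc] 0 by simp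
      finally have "D 0 *\<^sub>v v = 0\<^sub>v 1"
        using nz[of "(D 0 *\<^sub>v v) $ 0"] by (intro vec_1_eqI[OF c]) auto
      then show ?thesis using 0 by simp
    next
      case (Suc j)
      then show ?thesis using 0 SS by simp
    qed
    then show "\<exists>w \<in> free_module R (b (Suc i)). ?S (Suc i) *\<^sub>v w = v"
      using D(8) v unfolding exact_on_def SS by blast
  qed
  moreover have "{(?S 0 *\<^sub>v v) $ 0 | v. v \<in> free_module R (b 0)} = {g * f | f. f \<in> I}"
  proof -
    have "(?S 0 *\<^sub>v v) $ 0 = g * (D 0 *\<^sub>v v) $ 0" if "v \<in> free_module R (b 0)" for v
      using S0v[OF free_module_carrier[OF that]] D(5) by simp
    then show ?thesis unfolding D(9)[symmetric] by force
  qed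
  ultimately show ?thesis unfolding free_resolution_iff by blast
qed

lemma free_resolution_zero:
  "free_resolution R {0} (\<lambda>_. 0) (\<lambda>i. 0\<^sub>m (target_rank (\<lambda>_. 0) i) 0)"
proof -
  have z: "free_module R 0 = {0\<^sub>v 0}" by (auto simp: free_module_iff)
  show ?thesis
    unfolding free_resolution_iff exact_on_def z by (auto simp: mats_def intro: eq_matI)
qed

lemma free_resolution_one:
  "free_resolution R R (\<lambda>i. if i = 0 then 1 else 0)
     (\<lambda>i. if i = 0 then 1\<^sub>m 1 else 0\<^sub>m (target_rank (\<lambda>i. if i = 0 then 1 else 0) i) 0)"
  (is "free_resolution R R ?b ?D")
proof -
  have z: "free_module R 0 = {0\<^sub>v 0}" by (auto simp: free_module_iff)
  have b: "?b (Suc i) = 0" "?b 0 = 1" for i by simp_all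
  have "?D i \<in> mats R (target_rank ?b i) (?b i)" for i
    using mats_one[of 1] by (cases i) (auto simp: mats_def)
  moreover have "?D i * ?D (Suc i) = 0\<^sub>m (target_rank ?b i) (?b (Suc i))" for i
    by (cases i) (auto intro!: eq_matI)
  moreover have "exact_on R ?b ?D"
    unfolding exact_on_def
  proof (intro allI ballI impI)
    fix i v assume "v \<in> free_module R (?b i)" "?D i *\<^sub>v v = 0\<^sub>v (target_rank ?b i)"
    then have "v = 0\<^sub>v (?b i)" by (cases i) (auto simp: free_module_iff)
    moreover have "?D (Suc i) *\<^sub>v 0\<^sub>v 0 = 0\<^sub>v (?b i)" by (cases i) (auto intro!: eq_vecI)
    ultimately show "\<exists>w \<in> free_module R (?b (Suc i)). ?D (Suc i) *\<^sub>v w = v"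
      unfolding b z by blast
  qed
  moreover have "{(?D 0 *\<^sub>v v) $ 0 | v. v \<in> free_module R (?b 0)} = R"
  proof (intro equalityI subsetI)
    fix f assume f: "f \<in> R"
    have "vec 1 (\<lambda>_. f) \<in> free_module R (?b 0)" "f = (?D 0 *\<^sub>v vec 1 (\<lambda>_. f)) $ 0"
      using f by (auto simp: free_module_iff)
    then show "f \<in> {(?D 0 *\<^sub>v v) $ 0 | v. v \<in> free_module R (?b 0)}" by (intro CollectI exI conjI)
  next
    fix f assume "f \<in> {(?D 0 *\<^sub>v v) $ 0 | v. v \<in> free_module R (?b 0)}"
    then show "f \<in> R" by (auto simp: free_module_iff)
  qed
  ultimately show ?thesis unfolding free_resolution_iff by blast
qed

end

text \<open>
  The induction adds one generator \<open>a\<close> at a time: \<open>I \<inter> (a)\<close> is generated by the least common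
  multiples of \<open>a\<close> with the generators of \<open>I\<close>.
\<close>

theorem mono_ideal_free_resolution:
  assumes "finite A" and "\<And>a. a \<in> A \<Longrightarrow> Poly_Mapping.keys a \<subseteq> V\<^sub>0"
  shows "\<exists>b D. \<forall>V. V\<^sub>0 \<subseteq> V \<longrightarrow>
    free_resolution (polys V) (mono_ideal V (multiples A) :: ('v, 'k::comm_ring_1) mpoly set) b D"
  using assms
proof (induction "card A" arbitrary: A rule: less_induct)
  case less
  show ?case
  proof (cases "A = {}")
    case True
    have "(mono_ideal V (multiples {}) :: ('v, 'k) mpoly set) = {0}" for V
      by (auto simp: mono_ideal_def multiples_def polys_def)
    then show ?thesis
      using subring_set.free_resolution_zero[OF subring_polys] unfolding True by metis
  next
    case False
    then obtain a where a: "a \<in> A" by blast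
    define A' where "A' = A - {a}"
    define L where "L = (\<lambda>b. a + (b - a)) ` A'"
    have fin: "finite A'" "finite L" using less.prems by (auto simp: A'_def L_def)
    have card: "card A' < card A" unfolding A'_def by (rule card_Diff1_less[OF less.prems(1) a])
    \<comment> \<open>Coinciding least common multiples can only shrink \<open>L\<close>, so one
      induction on the number of generators handles both \<open>A'\<close> and
      \<open>L\<close>.\<close>
    have cardL: "card L < card A" using card_image_le[OF fin(1), of "\<lambda>b. a + (b - a)"] card by (simp add: L_def)
    have keysA': "Poly_Mapping.keys b \<subseteq> V\<^sub>0" if "b \<in> A'" for b using less.prems that by (auto simp: A'_def)
    have keysa: "Poly_Mapping.keys a \<subseteq> V\<^sub>0" using less.prems a by auto
    have keysL: "Poly_Mapping.keys l \<subseteq> V\<^sub>0" if l: "l \<in> L" for l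
    proof -
      obtain b where b: "b \<in> A'" "l = a + (b - a)" using l unfolding L_def by blast
      have "Poly_Mapping.keys (b - a) \<subseteq> Poly_Mapping.keys b" by (auto simp: in_keys_iff lookup_minus)
      then show ?thesis using keysA'[OF b(1)] keysa unfolding b(2) keys_add_nat by blast
    qed
    have A: "A = insert a A'" using a by (auto simp: A'_def)
    obtain bA and DA :: "nat \<Rightarrow> ('v, 'k) mpoly mat" where FA:
      "\<And>V. V\<^sub>0 \<subseteq> V \<Longrightarrow> free_resolution (polys V) (mono_ideal V (multiples A')) bA DA"
      using less.hyps[OF card fin(1) keysA'] by blast
    obtain bC and DC :: "nat \<Rightarrow> ('v, 'k) mpoly mat" where FC:
      "\<And>V. V\<^sub>0 \<subseteq> V \<Longrightarrow> free_resolution (polys V) (mono_ideal V (multiples L)) bC DC"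
      using less.hyps[OF cardL fin(2) keysL] by blast
    \<comment> \<open>The principal ideal is a monomial times the whole ring, so it is resolved by
      the trivial resolution of the ring with scaled augmentation.\<close>
    have "\<exists>b D. \<forall>V. V\<^sub>0 \<subseteq> V \<longrightarrow> free_resolution (polys V) (mono_ideal V ((+) a ` UNIV) :: ('v, 'k) mpoly set) b D"
    proof (intro exI allI impI)
      fix V assume V: "V\<^sub>0 \<subseteq> V"
      interpret subring_set "polys V :: ('v, 'k) mpoly set" by (rule subring_polys)
      have "monomial a \<in> (polys V :: ('v, 'k) mpoly set)" using keysa V by (auto simp: polys_def)
      from scale_free_resolution[OF free_resolution_one this mono_mult_eq_0[of a]]
      show "free_resolution (polys V) (mono_ideal V ((+) a ` UNIV) :: ('v, 'k) mpoly set)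
        (\<lambda>i. if i = 0 then 1 else 0) (scale_augmentation (monomial a)
         (\<lambda>i. if i = 0 then 1\<^sub>m 1 else 0\<^sub>m (target_rank (\<lambda>i. if i = 0 then 1 else 0) i) 0))"
        unfolding mono_ideal_UNIV[symmetric, of V] mono_mult_ideal[OF order_trans[OF keysa V]]
        unfolding mono_ideal_UNIV .
    qed
    then obtain bB and DB :: "nat \<Rightarrow> ('v, 'k) mpoly mat" where FB:
      "\<And>V. V\<^sub>0 \<subseteq> V \<Longrightarrow> free_resolution (polys V) (mono_ideal V ((+) a ` UNIV)) bB DB" by blast
    have Int: "mono_ideal V (multiples L) = mono_ideal V (multiples A') \<inter> (mono_ideal V ((+) a ` UNIV) :: ('v, 'k) mpoly set)" for V
      unfolding L_def multiples_Int_principal[symmetric] by (rule mono_ideal_Int)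
    \<comment> \<open>The lifts are chosen over the smallest ring \<open>polys V\<^sub>0\<close>.
      Their defining identities do not mention \<open>V\<close>, so the same cone works over every
      larger ring.\<close>
    interpret V0: subring_set "polys V\<^sub>0 :: ('v, 'k) mpoly set" by (rule subring_polys)
    note FA0 = FA[OF order_refl] and FB0 = FB[OF order_refl] and FC0 = FC[OF order_refl]
    obtain \<Phi> where \<Phi>: "\<And>i. \<Phi> i \<in> mats (polys V\<^sub>0) (bA i) (bC i)" "DA 0 * \<Phi> 0 = DC 0"
      "\<And>i. DA (Suc i) * \<Phi> (Suc i) = \<Phi> i * DC (Suc i)"
      using V0.lift_inclusion[OF FC0 FA0] Int by blast
    obtain \<Psi> where \<Psi>: "\<And>i. \<Psi> i \<in> mats (polys V\<^sub>0) (bB i) (bC i)" "DB 0 * \<Psi> 0 = DC 0"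
      "\<And>i. DB (Suc i) * \<Psi> (Suc i) = \<Psi> i * DC (Suc i)"
      using V0.lift_inclusion[OF FC0 FB0] Int by blast
    note DB = V0.free_resolutionD[OF FB0] and DC = V0.free_resolutionD[OF FC0] and \<Psi>c = mats_carrier[OF \<Psi>(1)]
    have "free_resolution (polys V) (mono_ideal V (multiples A) :: ('v, 'k) mpoly set)
        (cone_rank bA bB bC) (cone_mat bA DA bB DB bC DC \<Phi> (\<lambda>i. - \<Psi> i))"
      if V: "V\<^sub>0 \<subseteq> V" for V
    proof -
      interpret V: subring_set "polys V :: ('v, 'k) mpoly set" by (rule subring_polys)
      have "free_resolution (polys V) {x + y | x y. x \<in> mono_ideal V (multiples A') \<and> y \<in> mono_ideal V ((+) a ` UNIV)}
          (cone_rank bA bB bC) (cone_mat bA DA bB DB bC DC \<Phi> (\<lambda>i. - \<Psi> i))"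
      proof (rule V.cone_free_resolution[OF FA[OF V] FB[OF V]])
        show "free_resolution (polys V) (mono_ideal V (multiples A') \<inter> mono_ideal V ((+) a ` UNIV)) bC DC"
          using FC[OF V] unfolding Int .
        show "\<Phi> i \<in> mats (polys V) (bA i) (bC i)" for i
          using mats_mono[OF \<Phi>(1) polys_mono[OF V]] .
        show "- \<Psi> i \<in> mats (polys V) (bB i) (bC i)" for i
          using V.ring.mats_uminus[OF mats_mono[OF \<Psi>(1) polys_mono[OF V]]] .
        show "DB 0 * - \<Psi> 0 = - DC 0"
          using uminus_mult_right_mat[of "DB 0" "\<Psi> 0"] DB(5) \<Psi>c[of 0] \<Psi>(2) by simp
        show "DB (Suc i) * - \<Psi> (Suc i) = - \<Psi> i * DC (Suc i)" for i
          using uminus_mult_right_mat[of "DB (Suc i)" "\<Psi> (Suc i)"] DB(6)[of i] \<Psi>c[of "Suc i"]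
            uminus_mult_left_mat[of "\<Psi> i" "DC (Suc i)"] DC(6)[of i] \<Psi>c[of i] \<Psi>(3)[of i] by simp
      qed (rule \<Phi>)+
      then show ?thesis unfolding A multiples_insert mono_ideal_Un .
    qed
    then show ?thesis by blast
  qed
qed

text \<open>One pair \<open>b'\<close>, \<open>D'\<close> resolves the ideal over
  \<open>polys V\<close> and over the ring in all variables, and residue homology depends on the
  matrices only. Uniqueness in the larger ring then allows any resolution \<open>D\<close> found
  there.\<close>

lemma betti_mono_ideal:
  assumes "finite A" and "\<And>a. a \<in> A \<Longrightarrow> Poly_Mapping.keys a \<subseteq> V"
    and F: "free_resolution (polys UNIV) (mono_ideal UNIV (multiples A) :: ('v, 'k::field) mpoly set) b D"
  shows "betti V (mono_ideal V (multiples A) :: ('v, 'k) mpoly set) (int i) = residue_homology_dim b D i"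
proof -
  obtain b' and D' :: "nat \<Rightarrow> ('v, 'k) mpoly mat" where F':
    "\<And>V'. V \<subseteq> V' \<Longrightarrow> free_resolution (polys V') (mono_ideal V' (multiples A)) b' D'"
    using mono_ideal_free_resolution[OF assms(1,2)] by blast
  have "betti V (mono_ideal V (multiples A) :: ('v, 'k) mpoly set) (int i) = residue_homology_dim b' D' i"
    by (rule betti_eq_residue_homology_dim[OF F'[OF order_refl]])
  also have "\<dots> = residue_homology_dim b D i"
    by (rule residue_homology_dim_unique[OF subring_polys F'[OF subset_UNIV] F])
  finally show ?thesis .
qed

section \<open>Cover ideals\<close>

text \<open>The exponents of the cover ideal, described by supports rather than by generators. No
  vertex set is mentioned, so cover ideals of different clutters can be compared as sets.\<close>

definition hitting_exponents :: "'v set set \<Rightarrow> ('v \<Rightarrow>\<^sub>0 nat) set" where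
  "hitting_exponents \<E> = {m. \<forall>E \<in> \<E>. Poly_Mapping.keys m \<inter> E \<noteq> {}}"

definition indicator_exponent :: "'v set \<Rightarrow> ('v \<Rightarrow>\<^sub>0 nat)" where
  "indicator_exponent W = (\<Sum>v\<in>W. Poly_Mapping.single v 1)"

lemma lookup_indicator_exponent:
  "finite W \<Longrightarrow> Poly_Mapping.lookup (indicator_exponent W) v = (if v \<in> W then 1 else 0)"
  by (simp add: indicator_exponent_def lookup_sum lookup_single when_def)

lemma keys_indicator_exponent: "finite W \<Longrightarrow> Poly_Mapping.keys (indicator_exponent W) = W"
  by (auto simp: in_keys_iff lookup_indicator_exponent split: if_splits)

lemma prod_mvar: "(\<Prod>v\<in>W. mvar v) = monomial (indicator_exponent W)"
  unfolding indicator_exponent_def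
  by (induction W rule: infinite_finite_induct) (auto simp: mvar_def mult_single)

text \<open>If the support of a monomial meets every edge, its part inside \<open>V\<close> is a
  vertex cover whose squarefree monomial divides the given one.\<close>

lemma multiples_vertex_covers:
  assumes V: "finite V" and E: "\<And>E. E \<in> \<E> \<Longrightarrow> E \<subseteq> V"
  shows "multiples (indicator_exponent ` {W. vertex_cover V \<E> W}) = hitting_exponents \<E>"
proof (intro equalityI subsetI)
  fix m assume "m \<in> multiples (indicator_exponent ` {W. vertex_cover V \<E> W})"
  then obtain W c where W: "vertex_cover V \<E> W" "m = indicator_exponent W + c"
    by (auto simp: multiples_def)
  have "finite W" using W(1) V by (auto simp: vertex_cover_def intro: finite_subset)
  then have "W \<subseteq> Poly_Mapping.keys m" by (simp add: W(2) keys_add_nat keys_indicator_exponent)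
  then show "m \<in> hitting_exponents \<E>"
    using W(1) unfolding vertex_cover_def hitting_exponents_def by blast
next
  fix m assume m: "m \<in> hitting_exponents \<E>"
  define W where "W = Poly_Mapping.keys m \<inter> V"
  have W: "vertex_cover V \<E> W"
    using m E unfolding vertex_cover_def hitting_exponents_def W_def by blast
  have "finite W" by (simp add: W_def)
  have "m = indicator_exponent W + (m - indicator_exponent W)"
  proof (rule poly_mapping_eqI)
    fix v
    have "v \<in> W \<Longrightarrow> Poly_Mapping.lookup m v > 0" by (simp add: W_def in_keys_iff)
    then show "Poly_Mapping.lookup m v = Poly_Mapping.lookup (indicator_exponent W + (m - indicator_exponent W)) v"
      by (simp add: lookup_add lookup_minus lookup_indicator_exponent[OF \<open>finite W\<close>])
  qed
  then show "m \<in> multiples (indicator_exponent ` {W. vertex_cover V \<E> W})"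
    using W unfolding multiples_def by blast
qed

text \<open>As \<open>v\<close> lies on no edge, dividing by the variable \<open>v\<close> once does
  not affect which edges are hit.\<close>

lemma hitting_exponents_shift:
  assumes "\<And>E. E \<in> \<E> \<Longrightarrow> v \<notin> E"
  shows "(+) (Poly_Mapping.single v 1) ` hitting_exponents \<E> = {m \<in> hitting_exponents \<E>. v \<in> Poly_Mapping.keys m}"
proof (intro equalityI subsetI)
  fix m assume "m \<in> (+) (Poly_Mapping.single v 1) ` hitting_exponents \<E>"
  then show "m \<in> {m \<in> hitting_exponents \<E>. v \<in> Poly_Mapping.keys m}"
    by (fastforce simp: hitting_exponents_def keys_add_nat)
next
  fix m assume m: "m \<in> {m \<in> hitting_exponents \<E>. v \<in> Poly_Mapping.keys m}"
  have eq: "m = Poly_Mapping.single v 1 + (m - Poly_Mapping.single v 1)"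
    by (rule poly_mapping_eqI) (use m in \<open>auto simp: lookup_add lookup_minus lookup_single when_def in_keys_iff\<close>)
  have "Poly_Mapping.keys m - {v} \<subseteq> Poly_Mapping.keys (m - Poly_Mapping.single v 1)"
    by (auto simp: in_keys_iff lookup_minus lookup_single when_def split: if_splits)
  then have "m - Poly_Mapping.single v 1 \<in> hitting_exponents \<E>"
    using m assms unfolding hitting_exponents_def by fastforce
  with eq show "m \<in> (+) (Poly_Mapping.single v 1) ` hitting_exponents \<E>" by blast
qed

section \<open>Exponents and resolutions of the cover ideals\<close>

lemma finite_clutter_vertices: "finite (clutter_vertices p n Q e)"
  by (rule finite_subset[of _ "{1..e} \<times> {1..n}"]) (auto simp: clutter_vertices_def)

lemma clutter_edges_subset: "E \<in> clutter_edges p n Q e \<Longrightarrow> E \<subseteq> clutter_vertices p n Q e"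
  by (auto simp: clutter_edges_def multichain_def clutter_vertices_def)

lemma hitting_clutter_iff:
  "m \<in> hitting_exponents (clutter_edges p n Q e) \<longleftrightarrow>
    (\<forall>j. multichain p n Q e j \<longrightarrow> (\<exists>r \<in> {1..e}. (r, j r) \<in> Poly_Mapping.keys m))"
  unfolding hitting_exponents_def clutter_edges_def by auto

definition cover_exponents :: "(nat \<Rightarrow> 'a::order) \<Rightarrow> nat \<Rightarrow> 'a set \<Rightarrow> nat \<Rightarrow> (nat \<times> nat \<Rightarrow>\<^sub>0 nat) set" where
  "cover_exponents p n Q e =
    indicator_exponent ` {W. vertex_cover (clutter_vertices p n Q e) (clutter_edges p n Q e) W}"

lemma finite_cover_exponents: "finite (cover_exponents p n Q e)"
  unfolding cover_exponents_def
  by (rule finite_imageI, rule finite_subset[of _ "Pow (clutter_vertices p n Q e)"])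
     (auto simp: vertex_cover_def finite_clutter_vertices)

lemma keys_cover_exponents:
  assumes "a \<in> cover_exponents p n Q e"
  shows "Poly_Mapping.keys a \<subseteq> clutter_vertices p n Q e"
proof -
  from assms obtain W where W: "a = indicator_exponent W" "W \<subseteq> clutter_vertices p n Q e"
    by (auto simp: cover_exponents_def vertex_cover_def)
  then have "finite W" using finite_clutter_vertices finite_subset by blast
  then show ?thesis using W by (simp add: keys_indicator_exponent)
qed

lemma multiples_cover_exponents:
  "multiples (cover_exponents p n Q e) = hitting_exponents (clutter_edges p n Q e)"
  unfolding cover_exponents_def
  by (rule multiples_vertex_covers[OF finite_clutter_vertices clutter_edges_subset])

lemma cover_ideal_eq_mono_ideal:
  "cover_ideal p n Q e =
    (mono_ideal (clutter_vertices p n Q e) (multiples (cover_exponents p n Q e)) :: (nat \<times> nat, 'k::field) mpoly set)"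
proof -
  have eq: "{\<Prod>v \<in> W. mvar v | W. vertex_cover (clutter_vertices p n Q e) (clutter_edges p n Q e) W}
      = (monomial ` cover_exponents p n Q e :: (nat \<times> nat, 'k) mpoly set)"
    unfolding prod_mvar cover_exponents_def by auto
  show ?thesis
    unfolding cover_ideal_def eq by (rule genideal_mono) (rule keys_cover_exponents)
qed

lemma betti_cover_ideal_eq:
  fixes D :: "nat \<Rightarrow> (nat \<times> nat, 'k::field) mpoly mat"
  assumes F: "free_resolution UNIV (mono_ideal UNIV (hitting_exponents (clutter_edges p n Q e))) b D"
  shows "betti_cover_ideal TYPE('k) p n Q e (int i) = residue_homology_dim b D i"
  unfolding betti_cover_ideal_def cover_ideal_eq_mono_ideal
  by (rule betti_mono_ideal[OF finite_cover_exponents keys_cover_exponents])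
     (use F in \<open>simp_all add: multiples_cover_exponents polys_UNIV\<close>)

text \<open>A resolution over the ring in all variables that is also one over the smallest ring, so
  its entries involve vertices of the clutter only. Setting other variables to zero leaves these
  matrices unchanged.\<close>

lemma ex_free_resolution_cover_ideal:
  "\<exists>b D. free_resolution UNIV (mono_ideal UNIV (hitting_exponents (clutter_edges p n Q e))) b
      (D :: nat \<Rightarrow> (nat \<times> nat, 'k::comm_ring_1) mpoly mat) \<and>
    (\<forall>i. D i \<in> mats (polys (clutter_vertices p n Q e)) (target_rank b i) (b i))"
proof -
  obtain b and D :: "nat \<Rightarrow> (nat \<times> nat, 'k) mpoly mat" where
    F: "\<And>V. clutter_vertices p n Q e \<subseteq> V \<Longrightarrow>
      free_resolution (polys V) (mono_ideal V (multiples (cover_exponents p n Q e))) b D"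
    using mono_ideal_free_resolution[OF finite_cover_exponents keys_cover_exponents] by blast
  from F[OF subset_UNIV] subring_set.free_resolutionD(1)[OF subring_polys F[OF order_refl]]
  show ?thesis unfolding multiples_cover_exponents polys_UNIV by blast
qed


section \<open>Lifts killed by specializing variables to zero\<close>

definition avoiding :: "'v set \<Rightarrow> ('v \<Rightarrow>\<^sub>0 nat) set" where
  "avoiding X = {m. Poly_Mapping.keys m \<inter> X = {}}"

lemma keep_avoiding_hom: "comm_ring_hom (keep_terms (avoiding X) :: ('v, 'k::comm_ring_1) mpoly \<Rightarrow> ('v, 'k) mpoly)"
proof
  show "keep_terms (avoiding X) (f * g) = keep_terms (avoiding X) f * keep_terms (avoiding X) g"
    for f g :: "('v, 'k) mpoly"
    by (rule keep_terms_mult) (auto simp: avoiding_def keys_add_nat)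
  show "keep_terms (avoiding X) (1 :: ('v, 'k) mpoly) = 1"
    unfolding single_one[symmetric] keep_terms_single by (simp add: avoiding_def)
qed (simp_all add: keep_terms_add keep_terms_zero)

lemma keep_avoiding_polys:
  assumes "V \<inter> X = {}" "f \<in> polys V"
  shows "keep_terms (avoiding X) f = f"
proof (rule poly_mapping_eqI)
  fix m
  have "m \<in> avoiding X" if "m \<in> Poly_Mapping.keys f"
    using assms that unfolding polys_def avoiding_def by blast
  then show "Poly_Mapping.lookup (keep_terms (avoiding X) f) m = Poly_Mapping.lookup f m"
    by (auto simp: lookup_keep_terms in_keys_iff)
qed

text \<open>The kernel of the specialization, that is the ideal generated by the variables in
  \<open>X\<close>.\<close>

definition vanishing :: "'v set \<Rightarrow> ('v, 'k::zero) mpoly set" where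
  "vanishing X = {f. keep_terms (avoiding X) f = 0}"

lemma ideal_vanishing: "ideal_set UNIV (vanishing X :: ('v, 'k::comm_ring_1) mpoly set)"
proof -
  interpret comm_ring_hom "keep_terms (avoiding X) :: ('v, 'k) mpoly \<Rightarrow> ('v, 'k) mpoly"
    by (rule keep_avoiding_hom)
  show ?thesis
    by unfold_locales (auto simp: vanishing_def hom_add hom_mult)
qed

text \<open>The exponent 0 avoids every \<open>X\<close>, so specialization preserves the constant
  term.\<close>

lemma const_term_vanishing: "f \<in> vanishing X \<Longrightarrow> const_term f = 0"
  unfolding vanishing_def const_term_def using lookup_keep_terms[of "avoiding X" f 0]
  by (simp add: avoiding_def)

text \<open>Subtracting from a preimage its image under the specialization yields a vanishing preimage.\<close>

lemma vanishing_preimage: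
  fixes D :: "('v, 'k::comm_ring_1) mpoly mat"
  assumes D: "D \<in> mats (polys V) m n" and V: "V \<inter> X = {}"
    and w: "w \<in> carrier_vec n" and Dw: "D *\<^sub>v w \<in> free_module (vanishing X) m"
  shows "\<exists>w' \<in> free_module (vanishing X) n. D *\<^sub>v w' = D *\<^sub>v w"
proof -
  let ?h = "keep_terms (avoiding X) :: ('v, 'k) mpoly \<Rightarrow> ('v, 'k) mpoly"
  interpret h: comm_ring_hom ?h by (rule keep_avoiding_hom)
  note Dc = mats_carrier[OF D]
  \<comment> \<open>The entries of \<open>D\<close> do not involve \<open>X\<close>, so
    \<open>D\<close> commutes with the specialization and the image of \<open>?h w\<close> is the
    specialization of a vector that vanishes under it.\<close>
  have hD: "map_mat ?h D = D"
    by (rule eq_matI) (use keep_avoiding_polys[OF V mats_index[OF D]] Dc in auto)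
  have hw: "map_vec ?h w \<in> carrier_vec n" using w by simp
  have "D *\<^sub>v map_vec ?h w = map_vec ?h (D *\<^sub>v w)"
    using h.mult_mat_vec_hom[OF Dc w] unfolding hD ..
  also have "\<dots> = 0\<^sub>v m"
  proof (rule eq_vecI)
    fix i assume "i < dim_vec (0\<^sub>v m :: ('v, 'k) mpoly vec)"
    then have "i < dim_row D" "(D *\<^sub>v w) $ i \<in> vanishing X"
      using Dw Dc by (auto simp: free_module_iff simp del: index_mult_mat_vec)
    then show "map_vec ?h (D *\<^sub>v w) $ i = 0\<^sub>v m $ i"
      using Dc unfolding vanishing_def by (simp del: index_mult_mat_vec(1))
  qed (use Dc in simp)
  finally have 0: "D *\<^sub>v map_vec ?h w = 0\<^sub>v m" .
  have "D *\<^sub>v (w - map_vec ?h w) = D *\<^sub>v w"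
    unfolding mult_minus_distrib_mat_vec[OF Dc w hw] 0
    using mult_mat_vec_carrier[OF Dc w] by simp
  moreover have "w - map_vec ?h w \<in> free_module (vanishing X) n"
  proof -
    have "?h (?h f) = ?h f" for f by (rule poly_mapping_eqI) (simp add: lookup_keep_terms)
    then show ?thesis using w by (auto simp: free_module_iff vanishing_def h.hom_minus)
  qed
  ultimately show ?thesis by blast
qed

lemma exact_on_vanishing:
  fixes D :: "nat \<Rightarrow> ('v, 'k::comm_ring_1) mpoly mat"
  assumes ex: "exact_on UNIV b D" and D: "\<And>i. D i \<in> mats (polys V) (target_rank b i) (b i)"
    and V: "V \<inter> X = {}"
  shows "exact_on (vanishing X) b D"
  unfolding exact_on_def
proof (intro allI ballI impI)
  fix i v assume v: "v \<in> free_module (vanishing X) (b i)" "D i *\<^sub>v v = 0\<^sub>v (target_rank b i)"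
  then have "v \<in> free_module UNIV (b i)" by (simp add: free_module_iff)
  with v ex obtain w where w: "w \<in> carrier_vec (b (Suc i))" "D (Suc i) *\<^sub>v w = v"
    unfolding exact_on_def by (metis free_module_carrier)
  from vanishing_preimage[OF D V, of w "Suc i"] w v(1)
  show "\<exists>w \<in> free_module (vanishing X) (b (Suc i)). D (Suc i) *\<^sub>v w = v" by auto
qed


section \<open>The recursion for cover ideals of multichain clutters\<close>

lemma multichain_mono:
  assumes "multichain p n Q e j" "1 \<le> r" "r \<le> s" "s \<le> e"
  shows "p (j r) \<le> p (j s)"
  using assms(3,4)
proof (induction s rule: dec_induct)
  case (step s)
  then have "p (j s) \<le> p (j (Suc s))" using assms(1,2) by (auto simp: multichain_def)
  with step show ?case by auto
qed simp

lemma multichain_shorten: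
  "multichain p n Q e j \<Longrightarrow> e' \<le> e \<Longrightarrow> Q \<subseteq> Q' \<Longrightarrow> multichain p n Q' e' j"
  by (auto simp: multichain_def)

text \<open>The first \<open>e'\<close> entries of a multichain in \<open>Q\<close> form a
  multichain in \<open>Q'\<close>, so every edge of the one clutter contains an edge of the
  other.\<close>

lemma hitting_clutter_mono:
  "e' \<le> e \<Longrightarrow> Q \<subseteq> Q' \<Longrightarrow>
    hitting_exponents (clutter_edges p n Q' e') \<subseteq> hitting_exponents (clutter_edges p n Q e)"
proof
  fix m assume le: "e' \<le> e" "Q \<subseteq> Q'" and m: "m \<in> hitting_exponents (clutter_edges p n Q' e')"
  show "m \<in> hitting_exponents (clutter_edges p n Q e)"
    unfolding hitting_clutter_iff
  proof (intro allI impI)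
    fix j assume "multichain p n Q e j"
    then have "multichain p n Q' e' j" using le by (rule multichain_shorten)
    with m obtain r where "r \<in> {1..e'}" "(r, j r) \<in> Poly_Mapping.keys m"
      unfolding hitting_clutter_iff by blast
    with le(1) show "\<exists>r \<in> {1..e}. (r, j r) \<in> Poly_Mapping.keys m" by (intro bexI[of _ r]) auto
  qed
qed

context
  fixes p :: "nat \<Rightarrow> 'a::order" and P :: "'a set" and n d :: nat
  assumes inj: "inj_on p {1..n}" and P: "P = p ` {1..n}"
    and max: "{q \<in> P. \<not> (\<exists>q' \<in> P. q < q')} = {p n}" and d: "d \<ge> 2"
begin

text \<open>In a finite poset every element lies below some maximal one, and \<open>p n\<close> is
  the only candidate.\<close>

lemma greatest_pn: "q \<in> P \<Longrightarrow> q \<le> p n"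
proof -
  assume q: "q \<in> P"
  have "finite P" using P by simp
  from finite_has_maximal2[OF this q] obtain m where m: "m \<in> P" "q \<le> m" "\<forall>b\<in>P. m \<le> b \<longrightarrow> m = b"
    by blast
  then have "m \<in> {q \<in> P. \<not> (\<exists>q' \<in> P. q < q')}" by (auto simp: less_le)
  with m(2) show ?thesis unfolding max by simp
qed

lemma pn_in: "p n \<in> P" and n_in: "n \<in> {1..n}"
proof -
  show "p n \<in> P" using max by blast
  \<comment> \<open>An element of \<open>P\<close> forces the index set to be nonempty, so
    \<open>n\<close> is at least 1.\<close>
  then show "n \<in> {1..n}" unfolding P by auto
qed

lemma pn_index: "j \<in> {1..n} \<Longrightarrow> p j = p n \<longleftrightarrow> j = n"
  using inj n_in by (auto dest: inj_onD)

text \<open>In one clutter no edge uses the index \<open>n\<close>, in the other no edge reaches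
  position \<open>d\<close>.\<close>

lemma top_notin_edges:
  "E \<in> clutter_edges p n (P - {p n}) d \<Longrightarrow> (d, n) \<notin> E"
  "E \<in> clutter_edges p n P (d - 1) \<Longrightarrow> (d, n) \<notin> E"
  using d by (auto simp: clutter_edges_def multichain_def)

lemma hitting_clutter_shift:
  "(+) (Poly_Mapping.single (d, n) 1) ` hitting_exponents (clutter_edges p n (P - {p n}) d) =
    {m \<in> hitting_exponents (clutter_edges p n (P - {p n}) d). (d, n) \<in> Poly_Mapping.keys m}"
  "(+) (Poly_Mapping.single (d, n) 1) ` hitting_exponents (clutter_edges p n P (d - 1)) =
    {m \<in> hitting_exponents (clutter_edges p n P (d - 1)). (d, n) \<in> Poly_Mapping.keys m}"
  by (rule hitting_exponents_shift, erule top_notin_edges)+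

lemma hitting_clutter_decomp:
  "hitting_exponents (clutter_edges p n P d) =
    (+) (Poly_Mapping.single (d, n) 1) ` hitting_exponents (clutter_edges p n (P - {p n}) d)
    \<union> hitting_exponents (clutter_edges p n P (d - 1))"
  unfolding hitting_clutter_shift(1)
proof (intro equalityI subsetI)
  fix m assume m: "m \<in> hitting_exponents (clutter_edges p n P d)"
  show "m \<in> {m \<in> hitting_exponents (clutter_edges p n (P - {p n}) d). (d, n) \<in> Poly_Mapping.keys m}
    \<union> hitting_exponents (clutter_edges p n P (d - 1))"
  proof (cases "(d, n) \<in> Poly_Mapping.keys m")
    case True
    then show ?thesis using m hitting_clutter_mono[of d d "P - {p n}" P p n] by auto
  next
    case False
    have "m \<in> hitting_exponents (clutter_edges p n P (d - 1))"
      unfolding hitting_clutter_iff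
    proof (intro allI impI)
      fix j assume j: "multichain p n P (d - 1) j"
      \<comment> \<open>Every multichain of length \<open>d - 1\<close> extends by the greatest
        element. The added vertex \<open>(d, n)\<close> is not in the support of \<open>m\<close>,
        so the extended edge must be hit in one of its first \<open>d - 1\<close> positions.\<close>
      have "multichain p n P d (j(d := n))"
        unfolding multichain_def
      proof (intro conjI ballI)
        fix r assume r: "r \<in> {1..d}"
        show "(j(d := n)) r \<in> {1..n}" "p ((j(d := n)) r) \<in> P"
          using r j n_in pn_in by (auto simp: multichain_def)
      next
        fix r assume r: "r \<in> {1..<d}"
        then have "r \<in> {1..d - 1}" by auto
        then have "p (j r) \<in> P" using j unfolding multichain_def by blast
        then show "p ((j(d := n)) r) \<le> p ((j(d := n)) (Suc r))"
          using r j greatest_pn by (cases "Suc r = d") (auto simp: multichain_def)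
      qed
      with m obtain r where r: "r \<in> {1..d}" "(r, (j(d := n)) r) \<in> Poly_Mapping.keys m"
        unfolding hitting_clutter_iff by blast
      with False have "r \<noteq> d" by auto
      with r show "\<exists>r \<in> {1..d - 1}. (r, j r) \<in> Poly_Mapping.keys m" by (intro bexI[of _ r]) auto
    qed
    then show ?thesis by blast
  qed
next
  fix m assume "m \<in> {m \<in> hitting_exponents (clutter_edges p n (P - {p n}) d). (d, n) \<in> Poly_Mapping.keys m}
    \<union> hitting_exponents (clutter_edges p n P (d - 1))"
  then consider "m \<in> hitting_exponents (clutter_edges p n (P - {p n}) d)" "(d, n) \<in> Poly_Mapping.keys m"
    | "m \<in> hitting_exponents (clutter_edges p n P (d - 1))" by blast
  then show "m \<in> hitting_exponents (clutter_edges p n P d)"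
  proof cases
    case 1
    show ?thesis
      unfolding hitting_clutter_iff
    proof (intro allI impI)
      fix j assume j: "multichain p n P d j"
      show "\<exists>r \<in> {1..d}. (r, j r) \<in> Poly_Mapping.keys m"
      proof (cases "\<exists>r \<in> {1..d}. p (j r) = p n")
        case True
        then obtain r where r: "r \<in> {1..d}" "p (j r) = p n" by blast
        have jd: "j d \<in> {1..n}" "p (j d) \<in> P" using j d by (auto simp: multichain_def)
        \<comment> \<open>A multichain that meets the greatest element stays there to its end, so
          its last vertex is \<open>(d, n)\<close>, which \<open>m\<close> contains.\<close>
        have "p n \<le> p (j d)" using multichain_mono[OF j, of r d] r by simp
        then have "p (j d) = p n" using greatest_pn[OF jd(2)] by simp
        then have "j d = n" using pn_index[OF jd(1)] by simp
        then show ?thesis using 1(2) d by (intro bexI[of _ d]) auto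
      next
        case False
        then have "multichain p n (P - {p n}) d j" using j by (auto simp: multichain_def)
        then show ?thesis using 1(1) unfolding hitting_clutter_iff by blast
      qed
    qed
  next
    case 2
    then show ?thesis using hitting_clutter_mono[of "d - 1" d P P p n] by auto
  qed
qed

lemma hitting_top_column:
  "m \<in> hitting_exponents (clutter_edges p n P (d - 1)) \<Longrightarrow> m \<notin> avoiding {(r, n) | r. True}"
proof -
  assume m: "m \<in> hitting_exponents (clutter_edges p n P (d - 1))"
  have "multichain p n P (d - 1) (\<lambda>_. n)" using n_in pn_in by (auto simp: multichain_def)
  with m show ?thesis unfolding hitting_clutter_iff avoiding_def by blast
qed

text \<open>
  With \<open>K = H\<^bsub>P \<setminus> {p\<^sub>n}, d\<^esub>\<close>, \<open>J = H\<^bsub>P, d - 1\<^esub>\<close> and \<open>x\<close> the variable \<open>x\<^sub>d\<^sub>n\<close>, the cone is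
  that of \<open>x J \<rightarrow> x K \<oplus> J\<close>.
\<close>

lemma betti_cover_ideal_recursion:
  fixes i :: nat
  shows "betti_cover_ideal TYPE('k::field) p n P d (int i) =
    betti_cover_ideal TYPE('k) p n (P - {p n}) d (int i) + betti_cover_ideal TYPE('k) p n P (d - 1) (int i)
    + (case i of 0 \<Rightarrow> 0 | Suc j \<Rightarrow> betti_cover_ideal TYPE('k) p n P (d - 1) (int j))"
proof -
  let ?UH = "hitting_exponents (clutter_edges p n P d)"
  let ?UK = "hitting_exponents (clutter_edges p n (P - {p n}) d)"
  let ?UJ = "hitting_exponents (clutter_edges p n P (d - 1))"
  let ?VK = "clutter_vertices p n (P - {p n}) d"
  define X where "X = {(r :: nat, n) | r. True}"
  define a where "a = Poly_Mapping.single (d, n) (1::nat)"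
  define x :: "(nat \<times> nat, 'k) mpoly" where "x = monomial a"
  have VX: "?VK \<inter> X = {}" by (auto simp: clutter_vertices_def X_def)
  have R: "subring_set (UNIV :: (nat \<times> nat, 'k) mpoly set)"
    using subring_polys[of UNIV] unfolding polys_UNIV .
  interpret subring_set "UNIV :: (nat \<times> nat, 'k) mpoly set" by (rule R)
  obtain bK and DK :: "nat \<Rightarrow> (nat \<times> nat, 'k) mpoly mat" where
    FK: "free_resolution UNIV (mono_ideal UNIV ?UK) bK DK" and
    DKV: "\<And>i. DK i \<in> mats (polys ?VK) (target_rank bK i) (bK i)"
    using ex_free_resolution_cover_ideal by blast
  obtain bJ and DJ :: "nat \<Rightarrow> (nat \<times> nat, 'k) mpoly mat" where
    FJ: "free_resolution UNIV (mono_ideal UNIV ?UJ) bJ DJ"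
    using ex_free_resolution_cover_ideal by blast
  note K = free_resolutionD[OF FK] and J = free_resolutionD[OF FJ]
  have scale: "free_resolution UNIV (mono_ideal UNIV ((+) a ` U)) b (scale_augmentation x D)"
    if "free_resolution UNIV (mono_ideal UNIV U) b D" for U b and D :: "nat \<Rightarrow> (nat \<times> nat, 'k) mpoly mat"
    using scale_free_resolution[where g = "monomial a", OF that UNIV_I mono_mult_eq_0[of a]]
    unfolding x_def mono_mult_ideal[OF subset_UNIV] .
  have UJK: "?UJ \<subseteq> ?UK" by (rule hitting_clutter_mono) auto
  \<comment> \<open>Each shifted set consists of the exponents of the unshifted one that contain
    \<open>(d, n)\<close>, so the claim reduces to \<open>?UJ \<subseteq> ?UK\<close>.\<close>
  have Int: "(+) a ` ?UK \<inter> ?UJ = (+) a ` ?UJ"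
    using UJK unfolding a_def hitting_clutter_shift by blast
  \<comment> \<open>The lift of the inclusion of \<open>J\<close> in \<open>K\<close>, taken with
    all entries in \<open>vanishing X\<close>. This is possible because the matrices
    \<open>DK\<close> do not involve \<open>X\<close>, while every column of the augmentation
    \<open>DJ 0\<close> lies in \<open>vanishing X\<close>.\<close>
  have "\<exists>f. (\<forall>i. f i \<in> mats (vanishing X) (bK i) (bJ i)) \<and> DK 0 * f 0 = DJ 0 \<and>
     (\<forall>i. DK (Suc i) * f (Suc i) = f i * DJ (Suc i))"
  proof (rule lift_chain_map[OF ideal_vanishing J(1) J(7) K(1) exact_on_vanishing[OF K(8) DKV VX]])
    fix j assume j: "j < bJ 0"
    have unit: "unit_vec (bJ 0) j \<in> free_module UNIV (bJ 0)" by (simp add: free_module_iff)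
    define f where "f = col (DJ 0) j $ 0"
    have "f = (DJ 0 *\<^sub>v unit_vec (bJ 0) j) $ 0" unfolding f_def mult_unit_vec[OF J(5) j] ..
    then have f: "f \<in> mono_ideal UNIV ?UJ" using J(9) unit by blast
    then have "f \<in> mono_ideal UNIV ?UK" using UJK by (auto simp: mono_ideal_def)
    then obtain w where w: "w \<in> free_module UNIV (bK 0)" "(DK 0 *\<^sub>v w) $ 0 = f"
      unfolding K(9)[symmetric] by blast
    have wc: "w \<in> carrier_vec (bK 0)" using w(1) by (rule free_module_carrier)
    have c: "DK 0 *\<^sub>v w \<in> carrier_vec 1" "col (DJ 0) j \<in> carrier_vec 1"
      using mult_mat_vec_carrier[OF K(5) wc] col_carrier_vec[OF j J(5)] by auto
    have eq: "DK 0 *\<^sub>v w = col (DJ 0) j"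
      by (rule vec_1_eqI[OF c]) (use w(2) f_def in simp)
    have "f \<in> vanishing X"
      unfolding vanishing_def
    proof (intro CollectI poly_mapping_eqI)
      fix m
      show "Poly_Mapping.lookup (keep_terms (avoiding X) f) m = Poly_Mapping.lookup 0 m"
        using f hitting_top_column unfolding X_def mono_ideal_def
        by (auto simp: lookup_keep_terms in_keys_iff subset_iff)
    qed
    then have "DK 0 *\<^sub>v w \<in> free_module (vanishing X) 1"
      using c w(2) by (auto simp: free_module_iff simp del: index_mult_mat_vec)
    from vanishing_preimage[OF _ VX wc this] DKV[of 0]
    show "\<exists>w \<in> free_module (vanishing X) (bK 0). DK 0 *\<^sub>v w = col (DJ 0) j"
      unfolding eq by simp
  qed
  then obtain \<Phi> where \<Phi>: "\<And>i. \<Phi> i \<in> mats (vanishing X) (bK i) (bJ i)" "DK 0 * \<Phi> 0 = DJ 0"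
     "\<And>i. DK (Suc i) * \<Phi> (Suc i) = \<Phi> i * DJ (Suc i)" by blast
  note \<Phi>c = mats_carrier[OF \<Phi>(1)]
  \<comment> \<open>A scalar matrix commutes with all differentials. The sign makes this component
    lift the negative inclusion of \<open>x J\<close> in \<open>J\<close>, as the cone
    requires.\<close>
  define \<Psi> where "\<Psi> i = (- x) \<cdot>\<^sub>m 1\<^sub>m (bJ i)" for i
  have \<Psi>c: "\<Psi> i \<in> carrier_mat (bJ i) (bJ i)" for i by (simp add: \<Psi>_def)
  let ?DA = "scale_augmentation x DK" and ?DC = "scale_augmentation x DJ"
  note FA = scale[OF FK] and FC = scale[OF FJ]
  have U: "A \<in> mats UNIV m n" if "A \<in> carrier_mat m n" for m n and A :: "(nat \<times> nat, 'k) mpoly mat"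
    using that by (simp add: mats_def)
  have "free_resolution UNIV {f + g | f g. f \<in> mono_ideal UNIV ((+) a ` ?UK) \<and> g \<in> mono_ideal UNIV ?UJ}
      (cone_rank bK bJ bJ) (cone_mat bK ?DA bJ DJ bJ ?DC \<Phi> \<Psi>)"
  proof (rule cone_free_resolution[OF FA FJ])
    show "free_resolution UNIV (mono_ideal UNIV ((+) a ` ?UK) \<inter> mono_ideal UNIV ?UJ) bJ ?DC"
      using FC unfolding Int[symmetric] mono_ideal_Int .
    show "\<Phi> i \<in> mats UNIV (bK i) (bJ i)" "\<Psi> i \<in> mats UNIV (bJ i) (bJ i)" for i
      using \<Phi>c \<Psi>c by (auto intro: U)
    \<comment> \<open>Both augmentations are scaled by the same \<open>x\<close>, so the lift for
      \<open>J\<close> and \<open>K\<close> also lifts the inclusion of \<open>x J\<close> in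
      \<open>x K\<close>.\<close>
    show "?DA 0 * \<Phi> 0 = ?DC 0"
      using mult_smult_assoc_mat[OF K(5) \<Phi>c, where k = x] \<Phi>(2) by (simp add: scale_augmentation_def)
    show "?DA (Suc i) * \<Phi> (Suc i) = \<Phi> i * ?DC (Suc i)" for i
      using \<Phi>(3) by (simp add: scale_augmentation_def)
    show "DJ 0 * \<Psi> 0 = - ?DC 0"
      using mult_smult_distrib[OF J(5) one_carrier_mat, where k = "- x"] right_mult_one_mat[OF J(5)]
      by (auto simp: scale_augmentation_def \<Psi>_def intro!: eq_matI)
    show "DJ (Suc i) * \<Psi> (Suc i) = \<Psi> i * ?DC (Suc i)" for i
      using mult_smult_distrib[OF J(6) one_carrier_mat, where k = "- x"] right_mult_one_mat[OF J(6)]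
        mult_smult_assoc_mat[OF one_carrier_mat J(6), where k = "- x"] left_mult_one_mat[OF J(6)]
      by (simp add: scale_augmentation_def \<Psi>_def)
  qed
  then have FH: "free_resolution UNIV (mono_ideal UNIV ?UH)
      (cone_rank bK bJ bJ) (cone_mat bK ?DA bJ DJ bJ ?DC \<Phi> \<Psi>)"
    unfolding hitting_clutter_decomp a_def[symmetric] mono_ideal_Un .
  have "residue_mat (\<Phi> i) = 0\<^sub>m (bK i) (bJ i)" for i
    using \<Phi>c[of i] const_term_vanishing[OF mats_index[OF \<Phi>(1)]] by (intro eq_matI) auto
  moreover have "residue_mat (\<Psi> i) = 0\<^sub>m (bJ i) (bJ i)" for i
  proof -
    have "a \<noteq> 0" by (metis a_def lookup_single_eq lookup_zero zero_neq_one)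
    then have "const_term x = 0" by (simp add: x_def const_term_def lookup_single when_def)
    then show ?thesis by (intro eq_matI) (auto simp: \<Psi>_def const_term_mult const_term_uminus)
  qed
  ultimately have "residue_homology_dim (cone_rank bK bJ bJ) (cone_mat bK ?DA bJ DJ bJ ?DC \<Phi> \<Psi>) i =
    residue_homology_dim bK ?DA i + residue_homology_dim bJ DJ i +
    (case i of 0 \<Rightarrow> 0 | Suc j \<Rightarrow> residue_homology_dim bJ ?DC j)"
    using \<Phi>c \<Psi>c by (intro residue_homology_dim_cone[OF R FA FJ FC])
  \<comment> \<open>The augmentation is dropped on tensoring, so \<open>x K\<close> and
    \<open>x J\<close> contribute the Betti numbers of \<open>K\<close> and
    \<open>J\<close>.\<close>
  moreover have "residue_homology_dim b (scale_augmentation x D) i = residue_homology_dim b D i"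
    for b i and D :: "nat \<Rightarrow> (nat \<times> nat, 'k) mpoly mat"
    by (simp add: residue_homology_dim_def residue_diff_def scale_augmentation_def)
  ultimately show ?thesis
    unfolding betti_cover_ideal_eq[OF FH] betti_cover_ideal_eq[OF FK] betti_cover_ideal_eq[OF FJ] 
    by (simp split: nat.split)
qed

end

theorem corollary3p11:
  fixes p :: "nat \<Rightarrow> 'a::order" and P :: "'a set" and n d :: nat and i :: int
  assumes "inj_on p {1..n}"
    and "P = p ` {1..n}"
    and "\<forall>i \<in> {1..n}. \<forall>j \<in> {1..n}. p i < p j \<longrightarrow> i < j"
    and "{q \<in> P. \<not> (\<exists>q' \<in> P. q < q')} = {p n}"
    and "d \<ge> 2"
    and "i \<ge> 0"
  shows "betti_cover_ideal TYPE('k::field) p n P d i =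
           betti_cover_ideal TYPE('k) p n (P - {p n}) d i
           + betti_cover_ideal TYPE('k) p n P (d - 1) i
           + betti_cover_ideal TYPE('k) p n P (d - 1) (i - 1)"
proof -
  obtain k where k: "i = int k" using assms(6) nonneg_int_cases by blast
  \<comment> \<open>For \<open>k = 0\<close> the index is -1, where the Betti number is 0 by
    definition. This matches the cone, which has no shifted summand in degree 0.\<close>
  have "betti_cover_ideal TYPE('k) p n P (d - 1) (i - 1) =
      (case k of 0 \<Rightarrow> 0 | Suc j \<Rightarrow> betti_cover_ideal TYPE('k) p n P (d - 1) (int j))"
    unfolding k by (cases k) (auto simp: betti_cover_ideal_def betti_def)
  then show ?thesis
    unfolding k using betti_cover_ideal_recursion[OF assms(1,2,4,5), where ?'k = 'k, of k] by simp
qed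

end
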